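(* Let $G$ be a homogeneous group, $X_{n1},\dots,X_{nn}$ an iid array of $G$-valued random variables and $\mathbf X^n$ the associated random walk. For every $i\in\{1,\dots,m\}$ let $0<q_i\le2$ be a real number, and define $\kappa=\max\{q_1d_1,\dots,q_md_m\}$. Suppose that: (A) for every fixed $h\in[0,1]$, $(\mathbf X^n_h)_{n\ge1}$ is a tight collection of $G$-valued random variables; (B) for all $i\in\{1,\dots,m\}$, $\sup_{n\ge1}n\,|\mathbb E[\xi_i(X_{n1})]|<\infty$; (C) the array $X_{nk}$ is scaled by a scaling function $\theta$, where $\theta\equiv\sum_{i=1}^m|\xi_i|^{q_i}$ on a neighbourhood of $1_G$. Then $(\mathbf X^n)_{n\ge1}$ is a tight collection of $D_o([0,1],G)$-valued random variables and, for every $p>\kappa$, $(\|\mathbf X^n\|_{p\text{-var};[0,1]})_{n\ge1}$ is a tight collection of real random variables.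
   Context: Homogeneous group: $G$ is a nilpotent, connected, simply connected Lie group with Lie algebra $\mathfrak g$, endowed with dilations (group automorphisms) $(\delta_\lambda)_{\lambda>0}$ which, identifying $G$ with $\mathfrak g$ via $\exp$, satisfy $\delta_\lambda(u_i)=\lambda^{d_i}u_i$ for a basis $u_1,\dots,u_m$ of $\mathfrak g$ and reals $d_m\ge\dots\ge d_1\ge1$. $\|\cdot\|$ is a sub-additive homogeneous norm and $d(x,y)=\|x^{-1}y\|$. $D_o([0,1],G)$ is the space of càdlàg functions $[0,1]\to G$ starting at $1_G$, with the Skorokhod topology. $\|\mathbf x\|_{p\text{-var};[s,t]}=\|\mathbf x_s\|+\sup_{\mathcal D}(\sum_{t_j\in\mathcal D}\|\mathbf x_{t_j}^{-1}\mathbf x_{t_{j+1}}\|^p)^{1/p}$, supremum over partitions of $[s,t]$. Local coordinates: $U\subset G$ is a fixed open neighbourhood of $1_G$ with compact closure such that $\exp$ is a diffeomorphism from a neighbourhood of zero in $\mathfrak g$ onto $U$; $\xi_1,\dots,\xi_m\in C_c^\infty(G,\mathbb R)$ are fixed with $\log(x)=\sum_i\xi_i(x)u_i$ on $U$; $\xi=\sum_i\xi_iu_i$, with $|\cdot|$ the Euclidean norm on $\mathfrak g$ making $(u_i)$ orthonormal. Iid array: for each $n\ge1$, $X_{n1},\dots,X_{nn}$ are iid $G$-valued random variables, and the array is infinitesimal: $\lim_n\mathbb P[X_{n1}\notin V]=0$ for every neighbourhood $V$ of $1_G$. Associated random walk: $\mathbf X^n_t=1_G$ for $t\in[0,1/n)$,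 $\mathbf X^n_t=X_{n1}\cdots X_{n\lfloor tn\rfloor}$ for $t\in[1/n,1]$. Scaling function: a continuous bounded $\theta:G\to\mathbb R$ with $\theta(1_G)=0$, $\theta(x)>0$ for $x\ne1_G$, $|\xi|^2\le C\theta$ for some $C>0$, and $\theta>c$ on $G\setminus U$ for some $c>0$. It scales the array if $\sup_nn\mathbb E[\theta(X_{n1})]<\infty$. *)

theory Defs
  imports "HOL-Probability.Probability" "HOL-Algebra.Generated_Groups"
begin

section \<open>Homogeneous groups\<close>

primrec C_k_map :: "nat \<Rightarrow> ('a::euclidean_space \<Rightarrow> 'b::euclidean_space) \<Rightarrow> bool" where
  "C_k_map 0 f \<longleftrightarrow> continuous_on UNIV f"
| "C_k_map (Suc k) f \<longleftrightarrow>
     (\<exists>f'. (\<forall>x. (f has_derivative f' x) (at x)) \<and> (\<forall>v. C_k_map k (\<lambda>x. f' x v)))"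

definition smooth_map :: "('a::euclidean_space \<Rightarrow> 'b::euclidean_space) \<Rightarrow> bool" where
  "smooth_map f \<longleftrightarrow> (\<forall>k. C_k_map k f)"

primrec lower_central_series :: "'g monoid \<Rightarrow> nat \<Rightarrow> 'g set" where
  "lower_central_series G 0 = carrier G"
| "lower_central_series G (Suc k) =
     generate G {inv\<^bsub>G\<^esub> x \<otimes>\<^bsub>G\<^esub> inv\<^bsub>G\<^esub> y \<otimes>\<^bsub>G\<^esub> x \<otimes>\<^bsub>G\<^esub> y | x y.
                   x \<in> lower_central_series G k \<and> y \<in> carrier G}"

text \<open>
  A nilpotent, connected, simply connected Lie group, presented together with its exponential map
  \<open>Exp\<close>. For such groups \<open>Exp\<close> is a diffeomorphism from the Lie algebra (here the vector space
  \<open>'v\<close>) onto the group, so it serves as a global chart: smoothness on the group is smoothness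
  after composition with \<open>Exp\<close>. Conversely, the assumptions below say that the smooth structure
  transported by \<open>Exp\<close> makes \<open>G\<close> a Lie group, diffeomorphic to a vector space, with tangent space
  \<open>'v\<close> at the identity, and that \<open>t \<mapsto> Exp (t v)\<close> is the one-parameter subgroup with
  velocity \<open>v\<close>; that is, \<open>Exp\<close> is the exponential map of this Lie group.
\<close>

locale nilpotent_lie_group = group G
  for G :: "('g::{second_countable_topology, t2_space}) monoid" (structure)
  and Exp :: "'v::euclidean_space \<Rightarrow> 'g" +
  assumes carrier_UNIV: "carrier G = UNIV"
    and nilpotent: "\<exists>k. lower_central_series G k = {\<one>}"
    and homeomorphism_Exp: "homeomorphism UNIV UNIV Exp (inv_into UNIV Exp)"
    and Exp_one_parameter: "Exp ((s + t) *\<^sub>R v) = Exp (s *\<^sub>R v) \<otimes> Exp (t *\<^sub>R v)"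
    and smooth_mult: "smooth_map (\<lambda>(v, w). inv_into UNIV Exp (Exp v \<otimes> Exp w))"
    and smooth_inv: "smooth_map (\<lambda>v. inv_into UNIV Exp (inv (Exp v)))"

definition dilation ::
  "('v::euclidean_space \<Rightarrow> 'g) \<Rightarrow> (nat \<Rightarrow> 'v) \<Rightarrow> (nat \<Rightarrow> real) \<Rightarrow> real \<Rightarrow> 'g \<Rightarrow> 'g" where
  "dilation Exp u d l x =
     Exp (\<Sum>i = 1..DIM('v). (l powr d i * (inv_into UNIV Exp x \<bullet> u i)) *\<^sub>R u i)"

text \<open>
  The inner product of \<open>'v\<close> plays the role of the one that makes \<open>u\<^sub>1, \<dots>, u\<^sub>m\<close> orthonormal;
  since \<open>m = DIM('v)\<close>, orthonormality implies that they form a basis.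
\<close>

locale homogeneous_group = nilpotent_lie_group G Exp
  for G :: "('g::{second_countable_topology, t2_space}) monoid" (structure)
  and Exp :: "'v::euclidean_space \<Rightarrow> 'g"
  and u :: "nat \<Rightarrow> 'v"
  and d :: "nat \<Rightarrow> real" +
  assumes orthonormal_basis:
      "\<lbrakk>i \<in> {1..DIM('v)}; j \<in> {1..DIM('v)}\<rbrakk> \<Longrightarrow> u i \<bullet> u j = (if i = j then 1 else 0)"
    and d_ge_1: "d 1 \<ge> 1"
    and d_mono: "mono_on {1..DIM('v)} d"
    and dilation_automorphism: "l > 0 \<Longrightarrow> dilation Exp u d l \<in> iso G G"

text \<open>Symmetry \<open>N (inv x) = N x\<close>, which some authors include, is not required.\<close>

definition subadditive_homogeneous_norm ::
  "('g::topological_space) monoid \<Rightarrow> ('v::euclidean_space \<Rightarrow> 'g) \<Rightarrow> (nat \<Rightarrow> 'v) \<Rightarrow> (nat \<Rightarrow> real)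
     \<Rightarrow> ('g \<Rightarrow> real) \<Rightarrow> bool" where
  "subadditive_homogeneous_norm G Exp u d N \<longleftrightarrow>
     continuous_on UNIV N \<and>
     (\<forall>x. N x \<ge> 0) \<and>
     (\<forall>x. N x = 0 \<longleftrightarrow> x = \<one>\<^bsub>G\<^esub>) \<and>
     (\<forall>l>0. \<forall>x. N (dilation Exp u d l x) = l * N x) \<and>
     (\<forall>x y. N (x \<otimes>\<^bsub>G\<^esub> y) \<le> N x + N y)"

definition group_dist :: "'g monoid \<Rightarrow> ('g \<Rightarrow> real) \<Rightarrow> 'g \<Rightarrow> 'g \<Rightarrow> real" where
  "group_dist G N x y = N (inv\<^bsub>G\<^esub> x \<otimes>\<^bsub>G\<^esub> y)"

section \<open>Path spaces and variation\<close>

definition cadlag_paths :: "('g::topological_space) monoid \<Rightarrow> (real \<Rightarrow> 'g) set" where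
  "cadlag_paths G =
     {x \<in> extensional {0..1}. x 0 = \<one>\<^bsub>G\<^esub> \<and>
        (\<forall>t\<in>{0..<1}. (x \<longlongrightarrow> x t) (at_right t)) \<and>
        (\<forall>t\<in>{0<..1}. \<exists>l. (x \<longlongrightarrow> l) (at_left t))}"

text \<open>Increasing bijections of the unit interval; continuity is automatic.\<close>

definition time_changes :: "(real \<Rightarrow> real) set" where
  "time_changes = {l. strict_mono_on {0..1} l \<and> l ` {0..1} = {0..1}}"

definition skorokhod_ball ::
  "('g::topological_space) monoid \<Rightarrow> ('g \<Rightarrow> real) \<Rightarrow> (real \<Rightarrow> 'g) \<Rightarrow> real \<Rightarrow> (real \<Rightarrow> 'g) set" where
  "skorokhod_ball G N x r =
     {y \<in> cadlag_paths G. \<exists>l\<in>time_changes. \<forall>t\<in>{0..1}.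
        \<bar>l t - t\<bar> < r \<and> group_dist G N (x t) (y (l t)) < r}"

text \<open>The Skorokhod \<open>J\<^sub>1\<close> topology.\<close>

definition skorokhod_topology ::
  "('g::topological_space) monoid \<Rightarrow> ('g \<Rightarrow> real) \<Rightarrow> (real \<Rightarrow> 'g) topology" where
  "skorokhod_topology G N =
     topology (\<lambda>W. W \<subseteq> cadlag_paths G \<and> (\<forall>x\<in>W. \<exists>r>0. skorokhod_ball G N x r \<subseteq> W))"

lemma openin_skorokhod_topology:
  "openin (skorokhod_topology G N) W \<longleftrightarrow>
     W \<subseteq> cadlag_paths G \<and> (\<forall>x\<in>W. \<exists>r>0. skorokhod_ball G N x r \<subseteq> W)"
proof -
  have mono: "skorokhod_ball G N x r \<subseteq> skorokhod_ball G N x r'" if "r \<le> r'" for x r r'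
  proof -
    have *: "a < r \<Longrightarrow> a < r'" for a :: real
      using that by linarith
    show ?thesis
      unfolding skorokhod_ball_def using * by blast
  qed
  have "istopology (\<lambda>W. W \<subseteq> cadlag_paths G \<and> (\<forall>x\<in>W. \<exists>r>0. skorokhod_ball G N x r \<subseteq> W))"
    unfolding istopology_def
  proof (intro conjI allI impI)
    fix S T
    assume S: "S \<subseteq> cadlag_paths G \<and> (\<forall>x\<in>S. \<exists>r>0. skorokhod_ball G N x r \<subseteq> S)"
      and T: "T \<subseteq> cadlag_paths G \<and> (\<forall>x\<in>T. \<exists>r>0. skorokhod_ball G N x r \<subseteq> T)"
    show "S \<inter> T \<subseteq> cadlag_paths G" using S by blast
    show "\<forall>x\<in>S \<inter> T. \<exists>r>0. skorokhod_ball G N x r \<subseteq> S \<inter> T"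
    proof
      fix x assume "x \<in> S \<inter> T"
      then obtain r r' where r: "r > 0" "skorokhod_ball G N x r \<subseteq> S"
        and r': "r' > 0" "skorokhod_ball G N x r' \<subseteq> T"
        using S T by blast
      have "skorokhod_ball G N x (min r r') \<subseteq> S \<inter> T"
        using r(2) r'(2) mono[of "min r r'" r x] mono[of "min r r'" r' x] by auto
      then show "\<exists>r>0. skorokhod_ball G N x r \<subseteq> S \<inter> T"
        using r(1) r'(1) by (intro exI[of _ "min r r'"]) auto
    qed
  next
    fix \<K>
    assume K: "\<forall>S\<in>\<K>. S \<subseteq> cadlag_paths G \<and> (\<forall>x\<in>S. \<exists>r>0. skorokhod_ball G N x r \<subseteq> S)"
    show "\<Union>\<K> \<subseteq> cadlag_paths G" using K by blast
    show "\<forall>x\<in>\<Union>\<K>. \<exists>r>0. skorokhod_ball G N x r \<subseteq> \<Union>\<K>"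
    proof
      fix x assume "x \<in> \<Union>\<K>"
      then obtain S where "S \<in> \<K>" "x \<in> S" by blast
      moreover from this K obtain r where "r > 0" "skorokhod_ball G N x r \<subseteq> S" by blast
      ultimately show "\<exists>r>0. skorokhod_ball G N x r \<subseteq> \<Union>\<K>" by blast
    qed
  qed
  then show ?thesis
    unfolding skorokhod_topology_def by (simp only: topology_inverse')
qed

lemma topspace_skorokhod_topology [simp]: "topspace (skorokhod_topology G N) = cadlag_paths G"
proof (rule antisym)
  show "topspace (skorokhod_topology G N) \<subseteq> cadlag_paths G"
    using openin_topspace[of "skorokhod_topology G N"]
    unfolding openin_skorokhod_topology by (rule conjunct1)
  have "skorokhod_ball G N x 1 \<subseteq> cadlag_paths G" for x
    unfolding skorokhod_ball_def by (rule Collect_restrict)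
  then have "openin (skorokhod_topology G N) (cadlag_paths G)"
    unfolding openin_skorokhod_topology using zero_less_one by blast
  then show "cadlag_paths G \<subseteq> topspace (skorokhod_topology G N)"
    by (rule openin_subset)
qed

definition partitions :: "real \<Rightarrow> real \<Rightarrow> real list set" where
  "partitions s t = {ts. ts \<noteq> [] \<and> sorted_wrt (<) ts \<and> hd ts = s \<and> last ts = t}"

definition p_variation ::
  "'g monoid \<Rightarrow> ('g \<Rightarrow> real) \<Rightarrow> real \<Rightarrow> real \<Rightarrow> real \<Rightarrow> (real \<Rightarrow> 'g) \<Rightarrow> ennreal" where
  "p_variation G N p s t x =
     ennreal (N (x s)) +
     (SUP ts\<in>partitions s t. ennreal
        ((\<Sum>j<length ts - 1. group_dist G N (x (ts ! j)) (x (ts ! Suc j)) powr p) powr (1 / p)))"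

section \<open>Local coordinates and scaling functions\<close>

text \<open>
  As \<open>Exp\<close> is a global diffeomorphism, every open \<open>U\<close> is the diffeomorphic image of an open set
  of the Lie algebra, so nothing has to be required for this.
\<close>

definition local_coordinates ::
  "'g monoid \<Rightarrow> ('v::euclidean_space \<Rightarrow> 'g::topological_space) \<Rightarrow> (nat \<Rightarrow> 'v) \<Rightarrow> 'g set
     \<Rightarrow> (nat \<Rightarrow> 'g \<Rightarrow> real) \<Rightarrow> bool" where
  "local_coordinates G Exp u U \<xi> \<longleftrightarrow>
     open U \<and> \<one>\<^bsub>G\<^esub> \<in> U \<and> compact (closure U) \<and>
     (\<forall>i\<in>{1..DIM('v)}. smooth_map (\<xi> i \<circ> Exp) \<and> compact (closure {x. \<xi> i x \<noteq> 0})) \<and>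
     (\<forall>x\<in>U. inv_into UNIV Exp x = (\<Sum>i = 1..DIM('v). \<xi> i x *\<^sub>R u i))"

definition scaling_function ::
  "'g monoid \<Rightarrow> (nat \<Rightarrow> 'v::euclidean_space) \<Rightarrow> 'g set \<Rightarrow> (nat \<Rightarrow> 'g \<Rightarrow> real)
     \<Rightarrow> ('g::topological_space \<Rightarrow> real) \<Rightarrow> bool" where
  "scaling_function G u U \<xi> \<theta> \<longleftrightarrow>
     continuous_on UNIV \<theta> \<and> bounded (range \<theta>) \<and>
     \<theta> \<one>\<^bsub>G\<^esub> = 0 \<and> (\<forall>x. x \<noteq> \<one>\<^bsub>G\<^esub> \<longrightarrow> \<theta> x > 0) \<and>
     (\<exists>C>0. \<forall>x. (norm (\<Sum>i = 1..DIM('v). \<xi> i x *\<^sub>R u i))\<^sup>2 \<le> C * \<theta> x) \<and>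
     (\<exists>c>0. \<forall>x. x \<notin> U \<longrightarrow> \<theta> x > c)"

section \<open>Random walks and tightness\<close>

text \<open>The rows of the array may live on different probability spaces \<open>M n\<close>.\<close>

definition iid_array ::
  "'g monoid \<Rightarrow> (nat \<Rightarrow> 'w measure) \<Rightarrow> (nat \<Rightarrow> nat \<Rightarrow> 'w \<Rightarrow> 'g::topological_space) \<Rightarrow> bool" where
  "iid_array G M X \<longleftrightarrow>
     (\<forall>n\<ge>1. prob_space (M n) \<and>
        prob_space.indep_vars (M n) (\<lambda>_. borel) (X n) {1..n} \<and>
        (\<forall>k\<in>{1..n}. distr (M n) borel (X n k) = distr (M n) borel (X n 1))) \<and>
     (\<forall>V. open V \<and> \<one>\<^bsub>G\<^esub> \<in> V \<longrightarrow>
        (\<lambda>n. measure (M n) {\<omega> \<in> space (M n). X n 1 \<omega> \<notin> V}) \<longlonglongrightarrow> 0)"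

definition scales ::
  "(nat \<Rightarrow> 'w measure) \<Rightarrow> (nat \<Rightarrow> nat \<Rightarrow> 'w \<Rightarrow> 'g) \<Rightarrow> ('g \<Rightarrow> real) \<Rightarrow> bool" where
  "scales M X \<theta> \<longleftrightarrow>
     bdd_above ((\<lambda>n. real n * integral\<^sup>L (M n) (\<lambda>\<omega>. \<theta> (X n 1 \<omega>))) ` {1..})"

primrec partial_product :: "'g monoid \<Rightarrow> (nat \<Rightarrow> 'g) \<Rightarrow> nat \<Rightarrow> 'g" where
  "partial_product G x 0 = \<one>\<^bsub>G\<^esub>"
| "partial_product G x (Suc k) = partial_product G x k \<otimes>\<^bsub>G\<^esub> x (Suc k)"

text \<open>For \<open>t < 1/n\<close> the product is empty, so that the walk starts at the identity.\<close>

definition random_walk ::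
  "'g monoid \<Rightarrow> (nat \<Rightarrow> nat \<Rightarrow> 'w \<Rightarrow> 'g) \<Rightarrow> nat \<Rightarrow> 'w \<Rightarrow> real \<Rightarrow> 'g" where
  "random_walk G X n \<omega> =
     (\<lambda>t\<in>{0..1}. partial_product G (\<lambda>k. X n k \<omega>) (nat \<lfloor>t * real n\<rfloor>))"

definition borel_of :: "'a topology \<Rightarrow> 'a measure" where
  "borel_of T = sigma (topspace T) {U. openin T U}"

definition tight_family ::
  "'a topology \<Rightarrow> 'i set \<Rightarrow> ('i \<Rightarrow> 'w measure) \<Rightarrow> ('i \<Rightarrow> 'w \<Rightarrow> 'a) \<Rightarrow> bool" where
  "tight_family T I M Y \<longleftrightarrow>
     (\<forall>i\<in>I. Y i \<in> measurable (M i) (borel_of T)) \<and>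
     (\<forall>\<epsilon>>0. \<exists>K. compactin T K \<and>
        (\<forall>i\<in>I. measure (M i) {\<omega> \<in> space (M i). Y i \<omega> \<in> K} \<ge> 1 - \<epsilon>))"

end

theory Submission
  imports Defs
begin

text \<open>
  Let \<open>f\<close> be a smooth function that vanishes at the identity and equals \<open>1\<close> off the unit ball, and let
  \<open>f\<^sub>l = f \<circ> \<delta>\<^sub>l\<close> for \<open>l \<ge> 1\<close>. A Taylor expansion of \<open>y \<mapsto> f\<^sub>l (x y)\<close> at the identity, in which the
  \<open>i\<close>-th first order term is absorbed into \<open>\<theta>\<close> if \<open>q\<^sub>i \<le> 1\<close>, gives
  \<open>E f\<^sub>l (x X) \<le> f\<^sub>l x + C l\<^sup>\<kappa> / n\<close> uniformly in \<open>x\<close>. Restart the walk each time it leaves the ball of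
  radius \<open>1 / l\<close> around its last restarting point. Since \<open>f\<^sub>l\<close> grows by \<open>1\<close> before each restart, the
  expected number of restarts is at most \<open>C l\<^sup>\<kappa>\<close>, and restarts that follow each other within time \<open>\<delta>\<close>
  are unlikely. The latter controls the Skorokhod modulus of continuity. For the former, an increment
  larger than \<open>2 / l\<close> contains a restart at scale \<open>1 / l\<close>, so the sum of the \<open>p\<close>-th powers of the
  increments is bounded by \<open>\<Sum>\<^sub>i 2\<^sup>-\<^sup>i\<^sup>p\<close> times the number of restarts at scale \<open>2\<^sup>-\<^sup>i\<close>, whose expectation
  is finite for \<open>p > \<kappa>\<close>. Tightness of the marginals only enters through Ottaviani's inequality, to
  bound the whole walk.
\<close>

section \<open>Time changes\<close>

text \<open>Dilations are automorphisms, so \<open>dbump l (x \<otimes> y)\<close> is a bump of the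
  product of \<open>dil l x\<close> and \<open>dil l y\<close>, and one expansion at scale
  \<open>1\<close> serves all scales. Dilation multiplies a summand
  \<open>\<bar>\<xi> i y\<bar> powr q i\<close> of \<open>\<theta>\<close> by
  \<open>l powr (q i * d i)\<close>, whence the exponent \<open>\<kappa>\<close>; a linear term that
  is kept has \<open>q i > 1\<close>, so it costs \<open>l powr d i \<le> l powr \<kappa>\<close>,
  and hypothesis \<open>B\<close> controls its mean.

  Restarts are not stopping times here but components of a recursion on the increments. Each restart
  estimate thus becomes a one-step inequality for a potential of the current state, integrated
  against an independent increment.

  Skorokhod compactness asks for partitions whose intervals are all long, the last one included,
  while a restart may fall just before time \<open>1\<close>. Restarts in a last window are
  therefore discarded, and a second chain, started where the window begins, controls the walk there.

  As \<open>N\<close> may fail to be symmetric, the distance is symmetrised before any metric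
  argument. Tightness is claimed for all rows at once, so rows too short for the block argument are
  bounded time by time.\<close>

lemma time_changes_id: "(\<lambda>t. t) \<in> time_changes"
  by (auto simp: time_changes_def strict_mono_on_def)

lemma time_changes_compose:
  assumes "l \<in> time_changes" "k \<in> time_changes"
  shows "(\<lambda>t. k (l t)) \<in> time_changes"
proof -
  have "k ` l ` {0..1} = {0..1}" using assms by (simp add: time_changes_def)
  moreover have "strict_mono_on {0..1} (\<lambda>t. k (l t))"
  proof (rule strict_mono_onI)
    fix s t :: real assume st: "s \<in> {0..1}" "t \<in> {0..1}" "s < t"
    have l: "l s < l t" "l s \<in> {0..1}" "l t \<in> {0..1}"
      using assms(1) st by (auto simp: time_changes_def strict_mono_on_def)
    show "k (l s) < k (l t)"
      using assms(2) l by (simp add: time_changes_def strict_mono_on_def)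
  qed
  ultimately show ?thesis by (auto simp: time_changes_def image_image)
qed

lemma time_changes_in: "l \<in> time_changes \<Longrightarrow> t \<in> {0..1} \<Longrightarrow> l t \<in> {0..1}"
  unfolding time_changes_def by blast

text \<open>Supplies the symmetry of the Skorokhod distance, whose definition moves the time of one
  path only.\<close>

lemma time_changes_inverse:
  assumes l: "l \<in> time_changes"
  obtains k where "k \<in> time_changes" "\<And>t. t \<in> {0..1} \<Longrightarrow> k (l t) = t"
    "\<And>t. t \<in> {0..1} \<Longrightarrow> l (k t) = t"
proof
  let ?k = "inv_into {0..1} l"
  have sm: "strict_mono_on {0..1} l" and im: "l ` {0..1} = {0..1}"
    using l by (auto simp: time_changes_def)
  then have inj: "inj_on l {0..1}" by (simp add: strict_mono_on_imp_inj_on)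
  show lk: "l (?k t) = t" if "t \<in> {0..1}" for t using im that by (simp add: f_inv_into_f)
  show kl: "?k (l t) = t" if "t \<in> {0..1}" for t using inj that by simp
  have k_in: "?k t \<in> {0..1}" if "t \<in> {0..1}" for t using im that by (metis inv_into_into)
  have "strict_mono_on {0..1} ?k"
  proof (rule strict_mono_onI)
    fix s t :: real assume st: "s \<in> {0..1}" "t \<in> {0..1}" "s < t"
    show "?k s < ?k t"
    proof (rule ccontr)
      assume "\<not> ?k s < ?k t"
      then consider "?k t < ?k s" | "?k t = ?k s" by linarith
      then have "l (?k t) \<le> l (?k s)"
        by cases (use strict_mono_onD[OF sm k_in[OF st(2)] k_in[OF st(1)]] in auto)
      then show False using lk st by simp
    qed
  qed
  moreover have "?k ` {0..1} = {0..1}"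
  proof
    show "?k ` {0..1} \<subseteq> {0..1}" using k_in by blast
    show "{0..1} \<subseteq> ?k ` {0..1}"
    proof
      fix t :: real assume "t \<in> {0..1}"
      then show "t \<in> ?k ` {0..1}"
        using kl[of t] time_changes_in[OF l, of t] by (intro image_eqI[of _ _ "l t"]) simp_all
    qed
  qed
  ultimately show "?k \<in> time_changes" by (simp add: time_changes_def)
qed

text \<open>Right continuity compares two paths at times just after \<open>t\<close>, which leaves
  out \<open>t = 1\<close>; there the fixed endpoint makes the comparison direct.\<close>

lemma time_changes_1:
  assumes "l \<in> time_changes"
  shows "l 1 = 1"
proof -
  have "1 \<in> l ` {0..1}" using assms by (simp add: time_changes_def)
  then obtain t where t: "t \<in> {0..1}" "l t = 1" by auto
  have "l t \<le> l 1"
  proof (cases "t = 1")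
    case False
    have "strict_mono_on {0..1} l" using assms by (simp add: time_changes_def)
    from strict_mono_onD[OF this, of t 1] show ?thesis using t(1) False by auto
  qed simp
  moreover have "l 1 \<le> 1" using time_changes_in[OF assms, of 1] by simp
  ultimately show ?thesis using t by simp
qed

lemma exists_partition_index:
  fixes a :: "nat \<Rightarrow> real"
  assumes "a 0 \<le> t" "t < a J"
  obtains k where "k < J" "a k \<le> t" "t < a (Suc k)"
proof -
  have "\<exists>k<J. a k \<le> t \<and> t < a (Suc k)"
    using assms
  proof (induction J)
    case 0 then show ?case by simp
  next
    case (Suc J)
    show ?case
    proof (cases "t < a J")
      case True then show ?thesis using Suc by (meson less_SucI)
    next
      case False then show ?thesis using Suc by (intro exI[of _ J]) simp
    qed
  qed
  then show ?thesis using that by blast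
qed

text \<open>Matches two partitions with equally many points. The piecewise linear map through the
  points \<open>(a i, b i)\<close> displaces each time by a convex combination of the displacements
  at two neighbouring nodes.\<close>

lemma time_change_interpolation:
  fixes a b :: "nat \<Rightarrow> real"
  assumes a0: "a 0 = 0" and b0: "b 0 = 0" and aJ: "a J = 1" and bJ: "b J = 1"
    and ai: "\<And>i. i < J \<Longrightarrow> a i < a (Suc i)" and bi: "\<And>i. i < J \<Longrightarrow> b i < b (Suc i)"
    and ab: "\<And>i. i \<le> J \<Longrightarrow> \<bar>b i - a i\<bar> \<le> \<epsilon>"
  obtains l where "l \<in> time_changes"
    "\<And>i t. i < J \<Longrightarrow> a i \<le> t \<Longrightarrow> t < a (Suc i) \<Longrightarrow> b i \<le> l t \<and> l t < b (Suc i)"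
    "\<And>t. t \<in> {0..1} \<Longrightarrow> \<bar>l t - t\<bar> \<le> \<epsilon>"
proof
  \<comment> \<open>The ramp \<open>c i\<close> rises from \<open>0\<close> to \<open>1\<close>
    across the \<open>i\<close>-th interval. As a sum of ramps, \<open>l\<close> has one formula on
    the whole line, and continuity needs no gluing.\<close>
  define c where "c i t = max 0 (min 1 ((t - a i) / (a (Suc i) - a i)))" for i t
  define l where "l t = (\<Sum>i<J. (b (Suc i) - b i) * c i t)" for t
  have amono: "a i \<le> a j" if "i \<le> j" "j \<le> J" for i j
    using that
  proof (induction j)
    case (Suc j)
    then show ?case using ai[of j] by (cases "i = Suc j") auto
  qed simp
  have c1: "c i t = 1" if "i < J" "a (Suc i) \<le> t" for i t
    using ai[OF that(1)] that(2) by (simp add: c_def divide_simps)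
  have c0: "c i t = 0" if "i < J" "t \<le> a i" for i t
    using ai[OF that(1)] that(2) by (simp add: c_def divide_simps)
  have telescope: "(\<Sum>i<k. b (Suc i) - b i) = b k" for k
    using b0 by (induction k) auto
  have l_eq: "l t = b k + (b (Suc k) - b k) * ((t - a k) / (a (Suc k) - a k))"
    if k: "k < J" "a k \<le> t" "t \<le> a (Suc k)" for k t
  proof -
    have "l t = (\<Sum>i\<in>{..<k} \<union> {k} \<union> {k<..<J}. (b (Suc i) - b i) * c i t)"
      unfolding l_def using k by (intro sum.cong) auto
    also have "\<dots> = (\<Sum>i<k. (b (Suc i) - b i) * c i t) + (b (Suc k) - b k) * c k t
        + (\<Sum>i\<in>{k<..<J}. (b (Suc i) - b i) * c i t)"
      by (subst sum.union_disjoint) auto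
    also have "(\<Sum>i<k. (b (Suc i) - b i) * c i t) = (\<Sum>i<k. b (Suc i) - b i)"
    proof (rule sum.cong)
      fix i assume "i \<in> {..<k}"
      then have "a (Suc i) \<le> a k" "i < J" using k amono by auto
      then show "(b (Suc i) - b i) * c i t = b (Suc i) - b i" using c1[of i t] k by simp
    qed simp
    also have "(\<Sum>i\<in>{k<..<J}. (b (Suc i) - b i) * c i t) = 0"
    proof (rule sum.neutral, rule ballI)
      fix i assume "i \<in> {k<..<J}"
      then have "a (Suc k) \<le> a i" "i < J" using amono by auto
      then show "(b (Suc i) - b i) * c i t = 0" using c0[of i t] k by simp
    qed
    also have "c k t = (t - a k) / (a (Suc k) - a k)"
      using ai[OF k(1)] k by (simp add: c_def divide_simps)
    finally show ?thesis by (simp add: telescope)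
  qed
  have l1: "l t = 1" if "t \<ge> 1" for t
  proof -
    have "l t = (\<Sum>i<J. b (Suc i) - b i)"
      unfolding l_def
    proof (rule sum.cong)
      fix i assume "i \<in> {..<J}"
      then have "a (Suc i) \<le> a J" "i < J" using amono by auto
      then show "(b (Suc i) - b i) * c i t = b (Suc i) - b i" using c1[of i t] aJ that by simp
    qed simp
    then show ?thesis using telescope bJ by simp
  qed
  have l0: "l 0 = 0"
    unfolding l_def
  proof (rule sum.neutral, rule ballI)
    fix i assume "i \<in> {..<J}"
    then have "a 0 \<le> a i" "i < J" using amono by auto
    then show "(b (Suc i) - b i) * c i 0 = 0" using c0[of i 0] a0 by simp
  qed
  have cmono: "c i s \<le> c i t" if "i < J" "s \<le> t" for i s t
  proof -
    have "(s - a i) / (a (Suc i) - a i) \<le> (t - a i) / (a (Suc i) - a i)"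
      using ai[OF that(1)] that(2) by (intro divide_right_mono) auto
    then show ?thesis unfolding c_def by linarith
  qed
  have lmono: "l s < l t" if "s \<in> {0..1}" "t \<in> {0..1}" "s < t" for s t
  proof -
    have "a 0 \<le> s" "s < a J" using that a0 aJ by auto
    then obtain k where k: "k < J" "a k \<le> s" "s < a (Suc k)" by (rule exists_partition_index)
    show ?thesis unfolding l_def
    proof (rule sum_strict_mono_ex1)
      show "\<forall>i\<in>{..<J}. (b (Suc i) - b i) * c i s \<le> (b (Suc i) - b i) * c i t"
        using bi cmono that(3) by (intro ballI mult_left_mono) (auto simp: less_imp_le)
      have "c k s < c k t"
      proof -
        have "(s - a k) / (a (Suc k) - a k) < (t - a k) / (a (Suc k) - a k)"
          "(s - a k) / (a (Suc k) - a k) < 1" "(s - a k) / (a (Suc k) - a k) \<ge> 0"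
          using k that by (auto simp: divide_simps)
        then show ?thesis unfolding c_def by linarith
      qed
      then show "\<exists>i\<in>{..<J}. (b (Suc i) - b i) * c i s < (b (Suc i) - b i) * c i t"
        using k bi[of k] by (intro bexI[of _ k]) auto
    qed simp
  qed
  have "continuous_on {0..1} l"
    unfolding l_def c_def using ai by (intro continuous_intros) (auto dest: ai)
  then have "{0..1} \<subseteq> l ` {0..1}"
    using IVT'[of l 0 _ 1] l0 l1[of 1] by fastforce
  moreover have "l ` {0..1} \<subseteq> {0..1}"
  proof safe
    fix t :: real assume t: "t \<in> {0..1}"
    have "l 0 \<le> l t" using lmono[of 0 t] t by (cases "t = 0") auto
    moreover have "l t \<le> l 1" using lmono[of t 1] t by (cases "t = 1") auto
    ultimately show "l t \<in> {0..1}" using l0 l1[of 1] by simp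
  qed
  ultimately show "l \<in> time_changes"
    using lmono by (auto simp: time_changes_def intro: strict_mono_onI)
  show "b i \<le> l t \<and> l t < b (Suc i)" if "i < J" "a i \<le> t" "t < a (Suc i)" for i t
  proof -
    define w where "w = (t - a i) / (a (Suc i) - a i)"
    have w: "0 \<le> w" "w < 1" using that ai[of i] by (auto simp: w_def divide_simps)
    have "l t = b i + (b (Suc i) - b i) * w" using l_eq[of i t] that w_def by simp
    moreover have "(b (Suc i) - b i) * w < (b (Suc i) - b i) * 1"
      using w bi[OF that(1)] by (intro mult_strict_left_mono) auto
    moreover have "0 \<le> (b (Suc i) - b i) * w" using w bi[OF that(1)] by simp
    ultimately show ?thesis by simp
  qed
  show "\<bar>l t - t\<bar> \<le> \<epsilon>" if "t \<in> {0..1}" for t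
  proof (cases "t = 1")
    case True
    then show ?thesis using l1[of 1] ab[of J] aJ bJ by simp
  next
    case False
    then have "a 0 \<le> t" "t < a J" using that a0 aJ by auto
    then obtain k where k: "k < J" "a k \<le> t" "t < a (Suc k)" by (rule exists_partition_index)
    define w where "w = (t - a k) / (a (Suc k) - a k)"
    have w: "0 \<le> w" "w \<le> 1" using k ai[of k] by (auto simp: w_def divide_simps)
    have t: "t = a k + (a (Suc k) - a k) * w" using ai[OF k(1)] by (simp add: w_def)
    have lt: "l t = b k + (b (Suc k) - b k) * w" using l_eq[of k t] k w_def by simp
    have "l t - t = (b k + (b (Suc k) - b k) * w) - (a k + (a (Suc k) - a k) * w)"
      using lt t by linarith
    also have "\<dots> = (1 - w) * (b k - a k) + w * (b (Suc k) - a (Suc k))"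
      by (simp add: algebra_simps)
    finally have eq: "l t - t = (1 - w) * (b k - a k) + w * (b (Suc k) - a (Suc k))" .
    have "\<bar>l t - t\<bar> \<le> (1 - w) * \<epsilon> + w * \<epsilon>"
      unfolding eq using ab[of k] ab[of "Suc k"] k w
      by (intro order_trans[OF abs_triangle_ineq] add_mono)
         (auto simp: abs_mult intro!: mult_left_mono)
    also have "\<dots> = \<epsilon>" by (simp add: algebra_simps)
    finally show ?thesis .
  qed
qed

section \<open>A metric for the Skorokhod topology\<close>

text \<open>The Skorokhod theory below only uses a metric that induces the topology. It is kept
  apart from the group because \<open>group_dist\<close> need not be symmetric; a symmetrised
  distance is inserted later.\<close>

locale metrised_paths =
  fixes G :: "('g::{second_countable_topology, t2_space}) monoid"
    and \<rho> :: "'g \<Rightarrow> 'g \<Rightarrow> real"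
  assumes rho_metric: "Metric_space UNIV \<rho>"
    and rho_open: "open W \<longleftrightarrow> (\<forall>x\<in>W. \<exists>r>0. \<forall>y. \<rho> x y < r \<longrightarrow> y \<in> W)"
begin

lemma rho_nonneg: "0 \<le> \<rho> x y"
  and rho_commute: "\<rho> x y = \<rho> y x"
  and rho_triangle: "\<rho> x z \<le> \<rho> x y + \<rho> y z"
  and rho_zero: "\<rho> x y = 0 \<longleftrightarrow> x = y"
  using rho_metric by (simp_all add: Metric_space_def)

lemma rho_self [simp]: "\<rho> x x = 0"
  by (simp add: rho_zero)

lemma open_rho_ball: "open {y. \<rho> x y < r}"
  unfolding rho_open
proof (rule ballI, unfold mem_Collect_eq)
  fix y assume y: "\<rho> x y < r"
  have "\<rho> x z < r" if "\<rho> y z < r - \<rho> x y" for z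
    using rho_triangle[of x z y] that by linarith
  then show "\<exists>s>0. \<forall>z. \<rho> y z < s \<longrightarrow> \<rho> x z < r"
    using y by (intro exI[of _ "r - \<rho> x y"]) auto
qed

lemma tendsto_rho_iff: "(f \<longlongrightarrow> l) F \<longleftrightarrow> (\<forall>\<epsilon>>0. eventually (\<lambda>t. \<rho> l (f t) < \<epsilon>) F)"
proof
  assume f: "(f \<longlongrightarrow> l) F"
  show "\<forall>\<epsilon>>0. eventually (\<lambda>t. \<rho> l (f t) < \<epsilon>) F"
  proof (intro allI impI)
    fix \<epsilon> :: real assume "\<epsilon> > 0"
    then show "eventually (\<lambda>t. \<rho> l (f t) < \<epsilon>) F"
      using topological_tendstoD[OF f open_rho_ball[of l \<epsilon>]] by simp
  qed
next
  assume ev: "\<forall>\<epsilon>>0. eventually (\<lambda>t. \<rho> l (f t) < \<epsilon>) F"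
  show "(f \<longlongrightarrow> l) F"
  proof (rule topological_tendstoI)
    fix W assume "open W" "l \<in> W"
    then obtain r where "r > 0" "\<forall>y. \<rho> l y < r \<longrightarrow> y \<in> W" using rho_open by blast
    then show "eventually (\<lambda>t. f t \<in> W) F" using ev by (metis (mono_tags, lifting) eventually_mono)
  qed
qed

lemma tendsto_rho:
  assumes "(f \<longlongrightarrow> a) F" "(g \<longlongrightarrow> b) F"
  shows "((\<lambda>t. \<rho> (f t) (g t)) \<longlongrightarrow> \<rho> a b) F"
proof (rule tendstoI)
  fix e :: real assume "e > 0"
  then have "eventually (\<lambda>t. \<rho> a (f t) < e / 2) F" "eventually (\<lambda>t. \<rho> b (g t) < e / 2) F"
    using assms half_gt_zero unfolding tendsto_rho_iff by blast+
  then show "eventually (\<lambda>t. dist (\<rho> (f t) (g t)) (\<rho> a b) < e) F"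
  proof eventually_elim
    case (elim t)
    then show ?case
      using rho_triangle[of a b "f t"] rho_triangle[of "f t" b "g t"] rho_triangle[of "f t" "g t" a]
        rho_triangle[of a "g t" b] rho_commute[of "g t" b] rho_commute[of "f t" a]
      by (simp add: dist_real_def)
  qed
qed

definition sk_close :: "(real \<Rightarrow> 'g) \<Rightarrow> (real \<Rightarrow> 'g) \<Rightarrow> real \<Rightarrow> bool" where
  "sk_close x y r \<longleftrightarrow> (\<exists>l\<in>time_changes. \<forall>t\<in>{0..1}. \<bar>l t - t\<bar> \<le> r \<and> \<rho> (x t) (y (l t)) \<le> r)"

text \<open>Truncation at \<open>1\<close> makes the infimum exist without knowing that paths are bounded.\<close>

definition sk_dist :: "(real \<Rightarrow> 'g) \<Rightarrow> (real \<Rightarrow> 'g) \<Rightarrow> real" where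
  "sk_dist x y = Inf (insert 1 {r. r > 0 \<and> sk_close x y r})"

lemma sk_close_mono: "sk_close x y r \<Longrightarrow> r \<le> s \<Longrightarrow> sk_close x y s"
  unfolding sk_close_def by (meson order_trans)

lemma sk_close_refl: "r \<ge> 0 \<Longrightarrow> sk_close x x r"
  unfolding sk_close_def by (intro bexI[OF _ time_changes_id]) simp

lemma sk_close_sym:
  assumes "sk_close x y r"
  shows "sk_close y x r"
proof -
  obtain l where l: "l \<in> time_changes" and lr: "\<forall>t\<in>{0..1}. \<bar>l t - t\<bar> \<le> r \<and> \<rho> (x t) (y (l t)) \<le> r"
    using assms unfolding sk_close_def by blast
  obtain k where k: "k \<in> time_changes" and lk: "\<And>t. t \<in> {0..1} \<Longrightarrow> l (k t) = t"
    using time_changes_inverse[OF l] by metis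
  have "\<bar>k t - t\<bar> \<le> r \<and> \<rho> (y t) (x (k t)) \<le> r" if "t \<in> {0..1}" for t
    using lr time_changes_in[OF k that] lk[OF that] rho_commute by (metis abs_minus_commute)
  then show ?thesis using k unfolding sk_close_def by blast
qed

lemma sk_close_trans:
  assumes "sk_close x y r" "sk_close y z s"
  shows "sk_close x z (r + s)"
proof -
  obtain l where l: "l \<in> time_changes" and lr: "\<forall>t\<in>{0..1}. \<bar>l t - t\<bar> \<le> r \<and> \<rho> (x t) (y (l t)) \<le> r"
    using assms unfolding sk_close_def by blast
  obtain k where k: "k \<in> time_changes" and kr: "\<forall>t\<in>{0..1}. \<bar>k t - t\<bar> \<le> s \<and> \<rho> (y t) (z (k t)) \<le> s"
    using assms unfolding sk_close_def by blast
  have "\<bar>k (l t) - t\<bar> \<le> r + s \<and> \<rho> (x t) (z (k (l t))) \<le> r + s" if t: "t \<in> {0..1}" for t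
    using bspec[OF lr t] bspec[OF kr time_changes_in[OF l t]]
      rho_triangle[of "x t" "z (k (l t))" "y (l t)"] by linarith
  then show ?thesis
    unfolding sk_close_def by (intro bexI[OF _ time_changes_compose[OF l k]] ballI)
qed

lemma sk_dist_bdd: "bdd_below (insert 1 {r. r > 0 \<and> sk_close x y r})"
  by (rule bdd_belowI[of _ 0]) auto

lemma sk_dist_nonneg: "0 \<le> sk_dist x y"
  unfolding sk_dist_def by (rule cInf_greatest) auto

lemma sk_dist_le_1: "sk_dist x y \<le> 1"
  unfolding sk_dist_def by (rule cInf_lower[OF _ sk_dist_bdd]) simp

lemma sk_dist_le: "sk_close x y r \<Longrightarrow> r > 0 \<Longrightarrow> sk_dist x y \<le> r"
  unfolding sk_dist_def by (rule cInf_lower[OF _ sk_dist_bdd]) simp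

lemma sk_dist_less:
  assumes "sk_dist x y < r" "r \<le> 1"
  obtains s where "0 < s" "s < r" "sk_close x y s"
  using cInf_lessD[OF _ assms(1)[unfolded sk_dist_def]] assms(2) that by auto

lemma sk_dist_sym: "sk_dist x y = sk_dist y x"
  using sk_close_sym unfolding sk_dist_def by (intro arg_cong[where f = Inf]) blast

lemma sk_dist_triangle: "sk_dist x z \<le> sk_dist x y + sk_dist y z"
proof (rule field_le_epsilon)
  fix e :: real assume e: "e > 0"
  show "sk_dist x z \<le> sk_dist x y + sk_dist y z + e"
  proof (cases "sk_dist x y + sk_dist y z + e < 1")
    case False
    then show ?thesis using sk_dist_le_1[of x z] by linarith
  next
    case True
    obtain r where r: "0 < r" "r < sk_dist x y + e / 2" "sk_close x y r"
      using sk_dist_less[of x y "sk_dist x y + e / 2"] True e sk_dist_nonneg[of y z] by auto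
    obtain s where s: "0 < s" "s < sk_dist y z + e / 2" "sk_close y z s"
      using sk_dist_less[of y z "sk_dist y z + e / 2"] True e sk_dist_nonneg[of x y] by auto
    have "sk_dist x z \<le> r + s"
      using sk_close_trans[OF r(3) s(3)] r(1) s(1) by (intro sk_dist_le) auto
    then show ?thesis using r s by linarith
  qed
qed

lemma cadlag_right:
  assumes "x \<in> cadlag_paths G" "t \<in> {0..<1}" "\<epsilon> > 0"
  obtains \<eta> where "\<eta> > 0" "t + \<eta> \<le> 1" "\<And>s. t \<le> s \<Longrightarrow> s < t + \<eta> \<Longrightarrow> \<rho> (x t) (x s) < \<epsilon>"
proof -
  have "(x \<longlongrightarrow> x t) (at_right t)" using assms(1,2) by (simp add: cadlag_paths_def)
  then have "eventually (\<lambda>s. \<rho> (x t) (x s) < \<epsilon>) (at_right t)"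
    using assms(3) unfolding tendsto_rho_iff by blast
  then obtain b where b: "b > t" "\<And>s. t < s \<Longrightarrow> s < b \<Longrightarrow> \<rho> (x t) (x s) < \<epsilon>"
    unfolding eventually_at_right_field by blast
  show ?thesis
    by (rule that[of "min b 1 - t"]) (use b assms(2,3) in \<open>auto simp: less_eq_real_def\<close>)
qed

lemma sk_dist_zero:
  assumes x: "x \<in> cadlag_paths G" and y: "y \<in> cadlag_paths G"
  shows "sk_dist x y = 0 \<longleftrightarrow> x = y"
proof
  assume "x = y"
  then have "sk_dist x y \<le> e" if "e > 0" for e
    using that sk_dist_le[OF sk_close_refl] by simp
  then show "sk_dist x y = 0" using sk_dist_nonneg field_le_epsilon by (metis add_0 antisym)
next
  assume "sk_dist x y = 0"
  then have close: "sk_close x y e" if "e > 0" for e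
    using sk_dist_less[of x y "min e 1"] that sk_close_mono
    by (metis less_eq_real_def min.bounded_iff min_less_iff_conj zero_less_one)
  have "x t = y t" if t: "t \<in> {0..1}" for t
  proof -
    have "\<rho> (x t) (y t) \<le> 0 + e" if e: "e > 0" for e
    proof (cases "t = 1")
      case True
      obtain l where l: "l \<in> time_changes" "\<forall>t\<in>{0..1}. \<bar>l t - t\<bar> \<le> e \<and> \<rho> (x t) (y (l t)) \<le> e"
        using close[OF e] unfolding sk_close_def by blast
      show ?thesis using True time_changes_1[OF l(1)] bspec[OF l(2), of 1] by simp
    next
      case False
      then have t1: "t \<in> {0..<1}" using t by auto
      have e3: "e / 3 > 0" using e by simp
      obtain a where a: "a > 0" "t + a \<le> 1" "\<And>s. t \<le> s \<Longrightarrow> s < t + a \<Longrightarrow> \<rho> (x t) (x s) < e / 3"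
        using cadlag_right[OF x t1 e3] by metis
      obtain b where b: "b > 0" "t + b \<le> 1" "\<And>s. t \<le> s \<Longrightarrow> s < t + b \<Longrightarrow> \<rho> (y t) (y s) < e / 3"
        using cadlag_right[OF y t1 e3] by metis
      define c where "c = min a b"
      have c: "c > 0" "c \<le> a" "c \<le> b" using a b by (auto simp: c_def)
      define r where "r = min (e / 3) (c / 4)"
      have r: "r > 0" "r \<le> e / 3" "r \<le> c / 4" using e c by (auto simp: r_def)
      obtain l where l: "\<forall>t\<in>{0..1}. \<bar>l t - t\<bar> \<le> r \<and> \<rho> (x t) (y (l t)) \<le> r"
        using close[OF r(1)] unfolding sk_close_def by blast
      \<comment> \<open>The comparison is made a little after \<open>t\<close>: the time change
        moves \<open>s\<close> by at most \<open>c / 4\<close>, so both \<open>s\<close> and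
        \<open>l s\<close> stay in the interval to the right of \<open>t\<close> where the two paths
        are nearly constant.\<close>
      define s where "s = t + c / 2"
      have s: "s \<in> {0..1}" using t a c by (auto simp: s_def)
      have ls: "t \<le> l s" "l s < t + c" using bspec[OF l s] r c by (auto simp: s_def)
      have "\<rho> (x t) (y t) \<le> \<rho> (x t) (x s) + \<rho> (x s) (y (l s)) + \<rho> (y t) (y (l s))"
        using rho_triangle[of "x t" "y t" "x s"] rho_triangle[of "x s" "y t" "y (l s)"]
          rho_commute[of "y t"] by simp
      also have "\<dots> \<le> e / 3 + e / 3 + e / 3"
        using a(3)[of s] b(3)[of "l s"] bspec[OF l s] c r ls
        by (intro add_mono) (auto simp: s_def)
      finally show ?thesis by simp
    qed
    then have "\<rho> (x t) (y t) \<le> 0" by (rule field_le_epsilon)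
    then show ?thesis using rho_nonneg[of "x t" "y t"] rho_zero by force
  qed
  moreover have "x \<in> extensional {0..1}" "y \<in> extensional {0..1}"
    using x y by (auto simp: cadlag_paths_def)
  ultimately show "x = y" by (intro extensionalityI)
qed

sublocale sk: Metric_space "cadlag_paths G" sk_dist
  by unfold_locales (auto intro: sk_dist_nonneg sk_dist_sym sk_dist_triangle simp: sk_dist_zero)

text \<open>Partitions of the unit interval with all gaps at least \<open>\<delta>\<close>,
  continued by the constant \<open>1\<close>. As infinite sequences, partitions with different
  numbers of points share one product space. Both alternatives are closed conditions, so they
  survive pointwise limits, and no point lies strictly between \<open>1 - \<delta>\<close> and
  \<open>1\<close>.\<close>

definition gap_seq :: "real \<Rightarrow> (nat \<Rightarrow> real) \<Rightarrow> bool" where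
  "gap_seq \<delta> p \<longleftrightarrow> p 0 = 0 \<and>
     (\<forall>i. (p i \<le> 1 - \<delta> \<and> p i + \<delta> \<le> p (Suc i) \<and> p (Suc i) \<le> 1) \<or> (p i = 1 \<and> p (Suc i) = 1))"

definition step_approx :: "'g set \<Rightarrow> real \<Rightarrow> (nat \<Rightarrow> real) \<Rightarrow> (nat \<Rightarrow> 'g) \<Rightarrow> (real \<Rightarrow> 'g) \<Rightarrow> bool" where
  "step_approx B \<eta> p v x \<longleftrightarrow>
     (\<forall>i. v i \<in> B \<and> (\<forall>t. p i \<le> t \<and> t < p (Suc i) \<longrightarrow> \<rho> (v i) (x t) \<le> \<eta>))"

text \<open>The Skorokhod analogue of an Arzela-Ascoli set: values in a compact set, and at each
  level \<open>m\<close> a partition with gaps at least \<open>\<delta> m\<close> on whose half-open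
  intervals the path oscillates by at most \<open>2 * \<eta> m\<close>. The value at time
  \<open>1\<close> is only confined to \<open>B\<close>.\<close>

definition sk_set :: "'g set \<Rightarrow> (nat \<Rightarrow> real) \<Rightarrow> (nat \<Rightarrow> real) \<Rightarrow> (real \<Rightarrow> 'g) set" where
  "sk_set B \<delta> \<eta> = {x \<in> cadlag_paths G. x ` {0..1} \<subseteq> B \<and>
     (\<forall>m. \<exists>p v. gap_seq (\<delta> m) p \<and> step_approx B (\<eta> m) p v x)}"

lemma gap_seq_in:
  assumes "gap_seq \<delta> p" "\<delta> > 0"
  shows "p i \<in> {0..1}"
proof (induction i)
  case 0 then show ?case using assms by (simp add: gap_seq_def)
next
  case (Suc i)
  then show ?case using assms unfolding gap_seq_def by (smt (verit) atLeastAtMost_iff)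
qed

lemma gap_seq_less:
  assumes "gap_seq \<delta> p" "\<delta> > 0" "p i < 1"
  shows "p i \<le> 1 - \<delta>" "p i + \<delta> \<le> p (Suc i)"
  using assms unfolding gap_seq_def by (metis less_irrefl)+

lemma gap_seq_end:
  assumes "gap_seq \<delta> p" "\<delta> > 0"
  obtains J where "p J = 1" "\<And>i. i < J \<Longrightarrow> p i < 1"
proof -
  have grow: "p i = 1 \<or> p i \<ge> real i * \<delta>" for i
  proof (induction i)
    case 0 then show ?case using assms by (simp add: gap_seq_def)
  next
    case (Suc i)
    have "(p i \<le> 1 - \<delta> \<and> p i + \<delta> \<le> p (Suc i)) \<or> p (Suc i) = 1"
      using assms(1) unfolding gap_seq_def by blast
    then show ?case using Suc assms(2) by (auto simp: algebra_simps)
  qed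
  obtain k :: nat where "real k * \<delta> > 1" using assms(2) reals_Archimedean3 by blast
  then have "p k = 1" using grow[of k] gap_seq_in[OF assms, of k] by auto
  then have ex: "p (LEAST k. p k = 1) = 1" by (rule LeastI)
  show ?thesis
  proof (rule that[OF ex])
    fix i assume "i < (LEAST k. p k = 1)"
    then have "p i \<noteq> 1" using not_less_Least by blast
    then show "p i < 1" using gap_seq_in[OF assms, of i] by auto
  qed
qed

lemma gap_seq_limit:
  assumes "\<And>n. gap_seq \<delta> (p n)" "\<And>i. (\<lambda>n. p n i) \<longlonglongrightarrow> q i"
  shows "gap_seq \<delta> q"
proof -
  have "q 0 = 0"
    using assms(2)[of 0] assms(1) LIMSEQ_unique[OF _ tendsto_const] by (auto simp: gap_seq_def)
  moreover have "(q i \<le> 1 - \<delta> \<and> q i + \<delta> \<le> q (Suc i) \<and> q (Suc i) \<le> 1) \<or> (q i = 1 \<and> q (Suc i) = 1)" for i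
  proof -
    let ?C = "({(a, b). a \<le> 1 - \<delta>} \<inter> {(a, b). a + \<delta> \<le> b} \<inter> {(a, b). b \<le> 1}) \<union> {(1, 1)} :: (real \<times> real) set"
    have "closed ?C"
      unfolding case_prod_beta by (intro closed_Un closed_Int closed_Collect_le continuous_intros closed_singleton)
    moreover have "\<forall>\<^sub>F n in sequentially. (p n i, p n (Suc i)) \<in> ?C"
    proof (rule always_eventually, rule allI)
      fix n show "(p n i, p n (Suc i)) \<in> ?C"
        using assms(1)[of n] unfolding gap_seq_def by auto
    qed
    moreover have "((\<lambda>n. (p n i, p n (Suc i))) \<longlongrightarrow> (q i, q (Suc i))) sequentially"
      using assms(2) by (intro tendsto_Pair)
    ultimately have "(q i, q (Suc i)) \<in> ?C"
      by (rule Lim_in_closed_set[OF _ _ trivial_limit_sequentially])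
    then show ?thesis by auto
  qed
  ultimately show ?thesis by (simp add: gap_seq_def)
qed

end

section \<open>Compact sets of paths\<close>

lemma compact_UNIV_PiE:
  fixes B :: "'b::topological_space set"
  assumes "compact B"
  shows "compact {f :: 'i \<Rightarrow> 'b. \<forall>z. f z \<in> B}"
proof -
  have "compactin (product_topology (\<lambda>_. euclidean) UNIV) (PiE UNIV (\<lambda>_::'i. B))"
    using assms by (simp add: compactin_PiE)
  then show ?thesis by (simp add: euclidean_product_topology PiE_UNIV_domain Pi_def)
qed

context metrised_paths
begin

text \<open>The partitions, step values and terminal values of a sequence of paths range over a
  compact product, so they converge along a subsequence. The limit path is recovered from the
  limiting steps at all levels; a time change carrying limiting partition points to those of the
  sequence then compares both paths within steps of equal index.\<close>

theorem sk_set_compact: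
  assumes B: "compact B" and \<delta>: "\<And>m. \<delta> m > 0" and \<eta>: "\<eta> \<longlonglongrightarrow> 0"
  shows "compactin sk.mtopology (sk_set B \<delta> \<eta>)"
  unfolding sk.compactin_sequentially
proof (intro conjI allI impI)
  show "sk_set B \<delta> \<eta> \<subseteq> cadlag_paths G" by (auto simp: sk_set_def)
  fix \<sigma>0 :: "nat \<Rightarrow> real \<Rightarrow> 'g" assume "range \<sigma>0 \<subseteq> sk_set B \<delta> \<eta>"
  then have \<sigma>0: "\<And>n. \<sigma>0 n \<in> sk_set B \<delta> \<eta>" by blast
  have "\<forall>n m. \<exists>p v. gap_seq (\<delta> m) p \<and> step_approx B (\<eta> m) p v (\<sigma>0 n)"
    using \<sigma>0 by (auto simp: sk_set_def)
  then obtain p0 v0 where p0: "\<And>n m. gap_seq (\<delta> m) (p0 n m)"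
    and v0: "\<And>n m. step_approx B (\<eta> m) (p0 n m) (v0 n m) (\<sigma>0 n)"
    by metis
  \<comment> \<open>Packing all levels and indices into one point gives a common subsequence without
    a diagonal argument. The value at time \<open>1\<close> is added because half-open steps do not
    see it.\<close>
  define code where "code n = ((\<lambda>(m, i). p0 n m i), (\<lambda>(m, i). v0 n m i), \<sigma>0 n 1)" for n
  let ?K = "{f :: nat \<times> nat \<Rightarrow> real. \<forall>z. f z \<in> {0..1}} \<times> {f :: nat \<times> nat \<Rightarrow> 'g. \<forall>z. f z \<in> B} \<times> B"
  have "compact ?K"
    by (intro compact_Times compact_UNIV_PiE compact_Icc B)
  then have "seq_compact ?K" by (rule compact_imp_seq_compact)
  moreover have "\<forall>n. code n \<in> ?K"
  proof
    fix n
    have "\<sigma>0 n 1 \<in> B" using \<sigma>0[of n] by (auto simp: sk_set_def)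
    moreover have "p0 n m i \<in> {0..1}" for m i using gap_seq_in[OF p0 \<delta>] .
    moreover have "v0 n m i \<in> B" for m i using v0[of m n] by (simp add: step_approx_def)
    ultimately show "code n \<in> ?K" by (auto simp: code_def)
  qed
  ultimately obtain L r where L: "L \<in> ?K" and r: "strict_mono r" and lim: "(code \<circ> r) \<longlonglongrightarrow> L"
    by (rule seq_compactE)
  define p where "p n = p0 (r n)" for n
  define v where "v n = v0 (r n)" for n
  define \<sigma> where "\<sigma> n = \<sigma>0 (r n)" for n
  obtain Lp Lv w where Lpv: "L = (Lp, Lv, w)" by (cases L) auto
  define q where "q m i = Lp (m, i)" for m i
  define c where "c m i = Lv (m, i)" for m i
  have cB: "c m i \<in> B" and wB: "w \<in> B" for m i using L by (auto simp: Lpv c_def)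
  have "(\<lambda>n. fst ((code \<circ> r) n)) \<longlonglongrightarrow> Lp" using tendsto_fst[OF lim] by (simp add: Lpv)
  from continuous_on_tendsto_compose[OF continuous_on_product_coordinates this, of "(m, i)" for m i]
  have pq: "(\<lambda>n. p n m i) \<longlonglongrightarrow> q m i" for m i by (simp add: code_def p_def q_def)
  have "(\<lambda>n. fst (snd ((code \<circ> r) n))) \<longlonglongrightarrow> Lv" using tendsto_fst[OF tendsto_snd[OF lim]] by (simp add: Lpv)
  from continuous_on_tendsto_compose[OF continuous_on_product_coordinates this, of "(m, i)" for m i]
  have vc: "(\<lambda>n. v n m i) \<longlonglongrightarrow> c m i" for m i by (simp add: code_def v_def c_def)
  have w: "(\<lambda>n. \<sigma> n 1) \<longlonglongrightarrow> w" using tendsto_snd[OF tendsto_snd[OF lim]] by (simp add: Lpv code_def \<sigma>_def o_def)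
  have gp: "gap_seq (\<delta> m) (p n m)" for n m by (simp add: p_def p0)
  have gq: "gap_seq (\<delta> m) (q m)" for m using gap_seq_limit[OF gp pq] .
  have sa: "\<rho> (v n m i) (\<sigma> n t) \<le> \<eta> m" if "p n m i \<le> t" "t < p n m (Suc i)" for n m i t
    using v0[of m "r n"] that by (auto simp: step_approx_def p_def v_def \<sigma>_def)
  have \<sigma>D: "\<sigma> n \<in> cadlag_paths G" for n using \<sigma>0[of "r n"] by (simp add: sk_set_def \<sigma>_def)
  have "\<forall>m. \<exists>J. q m J = 1 \<and> (\<forall>i<J. q m i < 1)"
    using gap_seq_end[OF gq \<delta>] by metis
  then obtain J where J: "\<And>m. q m (J m) = 1" and iJ: "\<And>m i. i < J m \<Longrightarrow> q m i < 1" by metis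
  have q_less: "q m i < q m (Suc i)" if "i < J m" for m i
    using gap_seq_less(2)[OF gq \<delta> iJ[OF that]] \<delta>[of m] by linarith
  have q0: "q m 0 = 0" for m using gq by (simp add: gap_seq_def)
  have \<eta>_nonneg: "\<eta> m \<ge> 0" for m
  proof -
    have "p 0 m 0 = 0" using gp[of m 0] by (simp add: gap_seq_def)
    then have "p 0 m 0 < p 0 m (Suc 0)" using gap_seq_less(2)[OF gp \<delta>, of 0 m 0] \<delta>[of m] by simp
    from sa[OF order_refl this] show ?thesis using rho_nonneg order_trans by blast
  qed
  have idx: "\<exists>i. i < J m \<and> q m i \<le> t \<and> t < q m (Suc i)" if "t \<in> {0..<1}" for m t
  proof -
    have "q m 0 \<le> t" "t < q m (J m)" using that q0 J by auto
    then show ?thesis using exists_partition_index[of "q m" t "J m"] by blast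
  qed
  define k where "k m t = (SOME i. i < J m \<and> q m i \<le> t \<and> t < q m (Suc i))" for m t
  have k: "k m t < J m" "q m (k m t) \<le> t" "t < q m (Suc (k m t))" if "t \<in> {0..<1}" for m t
    using someI_ex[OF idx[OF that, of m]] by (auto simp: k_def)
  \<comment> \<open>The inequalities are strict because only times interior to a limiting step
    eventually lie in the corresponding step of the \<open>n\<close>-th partition.\<close>
  have inner: "eventually (\<lambda>n. \<rho> (v n m i) (\<sigma> n t) \<le> \<eta> m) sequentially"
    if "q m i < t" "t < q m (Suc i)" for m i t
    using order_tendstoD(2)[OF pq that(1)] order_tendstoD(1)[OF pq that(2)]
    by eventually_elim (auto intro: sa)
  have agree: "\<rho> (c m i) (c m' i') \<le> \<eta> m + \<eta> m'"
    if "t \<in> {0..<1}" "q m i \<le> t" "t < q m (Suc i)" "q m' i' \<le> t" "t < q m' (Suc i')" for m m' i i' t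
  proof -
    \<comment> \<open>Two half-open steps that share \<open>t\<close> also share an interval to its
      right; its midpoint is interior to both.\<close>
    define s where "s = (t + min (q m (Suc i)) (q m' (Suc i'))) / 2"
    have s: "q m i < s" "s < q m (Suc i)" "q m' i' < s" "s < q m' (Suc i')"
      using that by (auto simp: s_def)
    have "eventually (\<lambda>n. \<rho> (v n m i) (v n m' i') \<le> \<eta> m + \<eta> m') sequentially"
      using inner[OF s(1,2)] inner[OF s(3,4)]
    proof eventually_elim
      case (elim n)
      then show ?case
        using rho_triangle[of "v n m i" "v n m' i'" "\<sigma> n s"] rho_commute[of "\<sigma> n s"] by simp
    qed
    then show ?thesis
      using tendsto_upperbound[OF tendsto_rho[OF vc vc]] trivial_limit_sequentially by blast
  qed
  \<comment> \<open>No partition point lies strictly between \<open>1 - \<delta> m\<close> and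
    \<open>1\<close>, so points converging to \<open>1\<close> are eventually equal to
    \<open>1\<close>. The interpolated time change needs this exact equality.\<close>
  have w_end: "eventually (\<lambda>n. p n m (J m) = 1) sequentially" for m
  proof -
    have "1 - \<delta> m < q m (J m)" using J[of m] \<delta>[of m] by simp
    from order_tendstoD(1)[OF pq this]
    show ?thesis
    proof eventually_elim
      case (elim n)
      then show ?case using gp[of m n] unfolding gap_seq_def by (meson not_le)
    qed
  qed
  \<comment> \<open>The values of the steps containing \<open>t\<close>, at levels \<open>m\<close>
    and \<open>m'\<close>, differ by at most \<open>\<eta> m + \<eta> m'\<close>. A cluster point as
    \<open>m'\<close> grows is therefore within \<open>\<eta> m\<close> of each of them.\<close>
  have "\<exists>y\<in>B. \<forall>m. \<rho> (c m (k m t)) y \<le> \<eta> m" if t: "t \<in> {0..<1}" for t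
  proof -
    have "seq_compact B" using B by (rule compact_imp_seq_compact)
    moreover have "\<forall>m. c m (k m t) \<in> B" using cB by simp
    ultimately obtain y s where y: "y \<in> B" "strict_mono s" "((\<lambda>m. c m (k m t)) \<circ> s) \<longlonglongrightarrow> y"
      by (rule seq_compactE)
    have "\<rho> (c m (k m t)) y \<le> \<eta> m + 0" for m
    proof (rule LIMSEQ_le)
      show "(\<lambda>j. \<rho> (c m (k m t)) (((\<lambda>m. c m (k m t)) \<circ> s) j)) \<longlonglongrightarrow> \<rho> (c m (k m t)) y"
        by (intro tendsto_rho tendsto_const y)
      show "(\<lambda>j. \<eta> m + \<eta> (s j)) \<longlonglongrightarrow> \<eta> m + 0"
        using LIMSEQ_subseq_LIMSEQ[OF \<eta> y(2)] by (intro tendsto_intros) (simp add: o_def)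
      show "\<exists>N. \<forall>n\<ge>N. \<rho> (c m (k m t)) (((\<lambda>m. c m (k m t)) \<circ> s) n) \<le> \<eta> m + \<eta> (s n)"
        using agree[OF t] k[OF t] by auto
    qed
    then show ?thesis using y(1) by auto
  qed
  then obtain x0 where x0: "\<And>t. t \<in> {0..<1} \<Longrightarrow> x0 t \<in> B"
    "\<And>t m. t \<in> {0..<1} \<Longrightarrow> \<rho> (c m (k m t)) (x0 t) \<le> \<eta> m"
    by metis
  \<comment> \<open>Time \<open>1\<close> lies in no half-open step, so its value is the limit of
    the terminal values.\<close>
  define x where "x = (\<lambda>t\<in>{0..1}. if t < 1 then x0 t else w)"
  have k_eq: "k m t = i" if "i < J m" "q m i \<le> t" "t < q m (Suc i)" "t \<in> {0..<1}" for m t i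
  proof -
    have mono: "q m a \<le> q m b" if "a \<le> b" for a b
      using that
    proof (rule lift_Suc_mono_le[rotated])
      fix j show "q m j \<le> q m (Suc j)"
      proof -
        have "q m j + \<delta> m \<le> q m (Suc j) \<or> (q m j = 1 \<and> q m (Suc j) = 1)"
          using gq[of m] unfolding gap_seq_def by blast
        then show ?thesis using \<delta>[of m] by auto
      qed
    qed
    have "\<not> Suc i \<le> k m t" "\<not> Suc (k m t) \<le> i"
      using k[OF that(4), of m] that mono[of "Suc i" "k m t"] mono[of "Suc (k m t)" i] by linarith+
    then show ?thesis by simp
  qed
  have xc: "\<rho> (c m i) (x t) \<le> \<eta> m" if "q m i \<le> t" "t < q m (Suc i)" for m t i
  proof -
    have q_in: "0 \<le> q m i" "q m (Suc i) \<le> 1" using gap_seq_in[OF gq \<delta>, of m] by auto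
    then have t: "t \<in> {0..<1}" using that by auto
    have "i < J m"
    proof (rule ccontr)
      assume "\<not> i < J m"
      then have "J m \<le> i" by simp
      then have "q m i = 1"
      proof (induction i rule: dec_induct)
        case base then show ?case by (rule J)
      next
        case (step i)
        have "q m i \<le> 1 - \<delta> m \<or> q m (Suc i) = 1" using gq[of m] unfolding gap_seq_def by blast
        then show ?case using step \<delta>[of m] by auto
      qed
      then show False using that q_in by simp
    qed
    from k_eq[OF this that t] x0(2)[OF t, of m] t show ?thesis by (simp add: x_def)
  qed
  have xB: "x ` {0..1} \<subseteq> B" using x0(1) wB by (auto simp: x_def)
  have \<eta>_small: "\<exists>m. \<eta> m < e" if "e > 0" for e
    using order_tendstoD(2)[OF \<eta> that] by (meson eventually_sequentially order_refl)
  have xD: "x \<in> cadlag_paths G"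
    unfolding cadlag_paths_def
  proof (intro CollectI conjI ballI)
    show "x \<in> extensional {0..1}" by (simp add: x_def)
    have "\<rho> \<one>\<^bsub>G\<^esub> (x 0) \<le> 0 + e" if e: "e > 0" for e
    proof -
      obtain m where m: "\<eta> m < e / 2" using \<eta>_small[of "e / 2"] e by auto
      have "0 < J m" using J[of m] q0[of m] by (metis gr0I zero_neq_one)
      then have q1: "q m 0 \<le> 0" "0 < q m (Suc 0)" using q_less[of 0 m] q0[of m] by auto
      have "\<rho> (v n m 0) \<one>\<^bsub>G\<^esub> \<le> \<eta> m" for n
      proof -
        have p0: "p n m 0 = 0" using gp by (simp add: gap_seq_def)
        then have "p n m 0 < p n m (Suc 0)" using gap_seq_less(2)[OF gp \<delta>, of n m 0] \<delta>[of m] by simp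
        from sa[OF order_refl this] show ?thesis
          using \<sigma>D[of n] p0 by (simp add: cadlag_paths_def)
      qed
      then have "\<rho> (c m 0) \<one>\<^bsub>G\<^esub> \<le> \<eta> m"
        by (intro tendsto_upperbound[OF tendsto_rho[OF vc tendsto_const]]) auto
      then show ?thesis
        using xc[OF q1] m rho_triangle[of "\<one>\<^bsub>G\<^esub>" "x 0" "c m 0"] rho_commute[of "\<one>\<^bsub>G\<^esub>"] by simp
    qed
    then have "\<rho> \<one>\<^bsub>G\<^esub> (x 0) \<le> 0" by (rule field_le_epsilon)
    then show "x 0 = \<one>\<^bsub>G\<^esub>" using rho_zero rho_nonneg by (metis antisym)
  next
    fix t :: real assume t: "t \<in> {0..<1}"
    show "(x \<longlongrightarrow> x t) (at_right t)"
      unfolding tendsto_rho_iff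
    proof (intro allI impI)
      fix e :: real assume e: "e > 0"
      obtain m where m: "\<eta> m < e / 2" using \<eta>_small[of "e / 2"] e by auto
      show "eventually (\<lambda>s. \<rho> (x t) (x s) < e) (at_right t)"
        unfolding eventually_at_right_field
      proof (intro exI[of _ "q m (Suc (k m t))"] conjI allI impI)
        show "t < q m (Suc (k m t))" using k[OF t] by simp
        fix s assume "t < s" "s < q m (Suc (k m t))"
        then have "\<rho> (c m (k m t)) (x s) \<le> \<eta> m" "\<rho> (c m (k m t)) (x t) \<le> \<eta> m"
          using k[OF t, of m] by (auto intro!: xc)
        then show "\<rho> (x t) (x s) < e"
          using m rho_triangle[of "x t" "x s" "c m (k m t)"] rho_commute[of "x t"] by simp
      qed
    qed
  next
    fix t :: real assume t: "t \<in> {0<..1}"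
    \<comment> \<open>For left limits the relevant step is the one that reaches \<open>t\<close>
      from below, hence intervals open on the left and closed on the right.\<close>
    have left: "\<exists>i. q m i < t \<and> t \<le> q m (Suc i)" for m
    proof -
      have "\<exists>i<j. q m i < t \<and> t \<le> q m (Suc i)" if "t \<le> q m j" for j
        using that
      proof (induction j)
        case 0 then show ?case using q0[of m] t by simp
      next
        case (Suc j) then show ?case by (meson less_SucI lessI not_le)
      qed
      from this[of "J m"] show ?thesis using t J[of m] by auto
    qed
    then obtain j where j: "\<And>m. q m (j m) < t" "\<And>m. t \<le> q m (Suc (j m))" by metis
    \<comment> \<open>Times increasing to \<open>t\<close>: the compact \<open>B\<close> provides a
      cluster point of the path along them, the candidate for the left limit.\<close>
    define a where "a n = t * (1 - 1 / real (Suc n))" for n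
    have "(\<lambda>n. t * (1 - 1 / real (Suc n))) \<longlonglongrightarrow> t * (1 - 0)"
      by (intro tendsto_intros LIMSEQ_Suc[OF lim_1_over_n])
    then have a: "a \<longlonglongrightarrow> t" unfolding a_def by simp
    have a_less: "a n < t" for n using t by (auto simp: a_def divide_simps)
    moreover have "0 \<le> a n" for n using t by (auto simp: a_def)
    ultimately have a_in: "a n < t" "a n \<in> {0..1}" for n
      using t less_imp_le[OF a_less, of n] by auto
    have "seq_compact B" using B by (rule compact_imp_seq_compact)
    moreover have "\<forall>n. x (a n) \<in> B" using xB a_in by blast
    ultimately obtain y s where y: "y \<in> B" "strict_mono s" "((\<lambda>n. x (a n)) \<circ> s) \<longlonglongrightarrow> y"
      by (rule seq_compactE)
    have as: "(\<lambda>n. a (s n)) \<longlonglongrightarrow> t" using LIMSEQ_subseq_LIMSEQ[OF a y(2)] by (simp add: o_def)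
    have cy: "\<rho> (c m (j m)) y \<le> \<eta> m" for m
    proof (rule tendsto_upperbound)
      show "((\<lambda>n. \<rho> (c m (j m)) (((\<lambda>n. x (a n)) \<circ> s) n)) \<longlongrightarrow> \<rho> (c m (j m)) y) sequentially"
        by (intro tendsto_rho tendsto_const y)
      show "\<forall>\<^sub>F n in sequentially. \<rho> (c m (j m)) (((\<lambda>n. x (a n)) \<circ> s) n) \<le> \<eta> m"
        using order_tendstoD(1)[OF as j(1)[of m]]
      proof eventually_elim
        case (elim n)
        then show ?case using a_in(1)[of "s n"] j(2)[of m] by (auto intro!: xc)
      qed
    qed simp
    have "(x \<longlongrightarrow> y) (at_left t)"
      unfolding tendsto_rho_iff
    proof (intro allI impI)
      fix e :: real assume e: "e > 0"
      obtain m where m: "\<eta> m < e / 2" using \<eta>_small[of "e / 2"] e by auto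
      show "eventually (\<lambda>s. \<rho> y (x s) < e) (at_left t)"
        unfolding eventually_at_left_field
      proof (intro exI[of _ "q m (j m)"] conjI allI impI)
        show "q m (j m) < t" using j by simp
        fix s assume "q m (j m) < s" "s < t"
        then have "\<rho> (c m (j m)) (x s) \<le> \<eta> m"
          using j(2)[of m] by (auto intro!: xc)
        then show "\<rho> y (x s) < e"
          using m cy[of m] rho_triangle[of y "x s" "c m (j m)"] rho_commute[of y] by simp
      qed
    qed
    then show "\<exists>y. (x \<longlongrightarrow> y) (at_left t)" ..
  qed
  have xK: "x \<in> sk_set B \<delta> \<eta>"
    unfolding sk_set_def using xD xB gq xc cB by (auto simp: step_approx_def intro!: exI)
  have "limitin sk.mtopology (\<sigma>0 \<circ> r) x sequentially"
    unfolding sk.limitin_metric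
  proof (intro conjI allI impI xD)
    fix e :: real assume e: "e > 0"
    obtain m where m: "\<eta> m < e / 4" using \<eta>_small[of "e / 4"] e by auto
    have "\<forall>\<^sub>F n in sequentially. \<forall>i\<in>{..J m}. \<bar>p n m i - q m i\<bar> < e / 4"
      using tendstoD[OF pq, of "e / 4" m] e
      by (intro eventually_ball_finite ballI) (auto simp: dist_real_def)
    moreover have "\<forall>\<^sub>F n in sequentially. \<forall>i\<in>{..J m}. \<rho> (c m i) (v n m i) < e / 4"
      using iffD1[OF tendsto_rho_iff vc, rule_format, of "e / 4"] e
      by (intro eventually_ball_finite ballI) auto
    moreover have "\<forall>\<^sub>F n in sequentially. \<forall>i\<in>{..<J m}. p n m i < 1"
      using iJ[of _ m] by (intro eventually_ball_finite ballI order_tendstoD(2)[OF pq]) auto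
    moreover have "\<forall>\<^sub>F n in sequentially. \<rho> w (\<sigma> n 1) < e / 4"
      using iffD1[OF tendsto_rho_iff w, rule_format, of "e / 4"] e by simp
    ultimately show "\<forall>\<^sub>F n in sequentially. (\<sigma>0 \<circ> r) n \<in> cadlag_paths G \<and> sk_dist ((\<sigma>0 \<circ> r) n) x < e"
      using w_end[of m]
    proof eventually_elim
      case (elim n)
      have p_less: "p n m i < p n m (Suc i)" if "i < J m" for i
        using gap_seq_less(2)[OF gp \<delta>, of n m i] elim(3) that \<delta>[of m] by fastforce
      have p0: "p n m 0 = 0" using gp by (simp add: gap_seq_def)
      obtain l where l: "l \<in> time_changes"
        "\<And>i t. i < J m \<Longrightarrow> q m i \<le> t \<Longrightarrow> t < q m (Suc i) \<Longrightarrow> p n m i \<le> l t \<and> l t < p n m (Suc i)"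
        "\<And>t. t \<in> {0..1} \<Longrightarrow> \<bar>l t - t\<bar> \<le> e / 4"
        using time_change_interpolation[of "q m" "p n m" "J m" "e / 4", OF q0 p0 J elim(5) q_less p_less]
          elim(1) by (auto intro: less_imp_le)
      have "sk_close x (\<sigma> n) (3 * e / 4)"
        unfolding sk_close_def
      proof (intro bexI[OF _ l(1)] ballI conjI)
        fix t :: real assume t: "t \<in> {0..1}"
        show "\<bar>l t - t\<bar> \<le> 3 * e / 4" using l(3)[OF t] e by linarith
        show "\<rho> (x t) (\<sigma> n (l t)) \<le> 3 * e / 4"
        proof (cases "t = 1")
          case True
          then show ?thesis using time_changes_1[OF l(1)] elim(4) e by (simp add: x_def)
        next
          case False
          then have t1: "t \<in> {0..<1}" using t by auto
          let ?i = "k m t"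
          have i: "?i < J m" "q m ?i \<le> t" "t < q m (Suc ?i)" using k[OF t1] by auto
          have "\<rho> (x t) (\<sigma> n (l t)) \<le> \<rho> (c m ?i) (x t) + \<rho> (c m ?i) (v n m ?i) + \<rho> (v n m ?i) (\<sigma> n (l t))"
            using rho_triangle[of "x t" "\<sigma> n (l t)" "c m ?i"] rho_commute[of "x t"]
              rho_triangle[of "c m ?i" "\<sigma> n (l t)" "v n m ?i"] by simp
          also have "\<dots> \<le> e / 4 + e / 4 + e / 4"
          proof (intro add_mono)
            show "\<rho> (c m ?i) (x t) \<le> e / 4" using xc[OF i(2,3)] m by linarith
            show "\<rho> (c m ?i) (v n m ?i) \<le> e / 4" using bspec[OF elim(2), of ?i] i(1) by simp
            have "\<rho> (v n m ?i) (\<sigma> n (l t)) \<le> \<eta> m" using l(2)[OF i] by (intro sa) auto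
            then show "\<rho> (v n m ?i) (\<sigma> n (l t)) \<le> e / 4" using m by linarith
          qed
          finally show ?thesis by simp
        qed
      qed
      then have "sk_dist (\<sigma> n) x \<le> 3 * e / 4"
        using e by (intro sk_dist_le[OF sk_close_sym]) auto
      then show ?case using e \<sigma>D[of n] by (simp add: \<sigma>_def)
    qed
  qed
  then show "\<exists>l r. l \<in> sk_set B \<delta> \<eta> \<and> strict_mono r \<and> limitin sk.mtopology (\<sigma>0 \<circ> r) l sequentially"
    using xK r by blast
qed

end

section \<open>Taylor expansion of the group product\<close>

text \<open>\<open>C_k_map\<close> only makes each directional derivative continuous. Bounding those
  along a basis bounds the operator norm on a ball, and the mean value inequality applies because
  balls are convex.\<close>

lemma C_k_map_1_lipschitz:
  fixes f :: "'a::euclidean_space \<Rightarrow> 'b::euclidean_space"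
  assumes "C_k_map (Suc 0) f"
  obtains L where "\<And>x y. x \<in> cball 0 R \<Longrightarrow> y \<in> cball 0 R \<Longrightarrow> norm (f x - f y) \<le> L * norm (x - y)"
proof -
  obtain f' where f': "\<And>x. (f has_derivative f' x) (at x)" and cont: "\<And>v. continuous_on UNIV (\<lambda>x. f' x v)"
    using assms by auto
  have "\<forall>e. \<exists>b. \<forall>x\<in>cball 0 R. norm (f' x e) \<le> b"
  proof
    fix e
    have "compact ((\<lambda>x. f' x e) ` cball 0 R)"
      by (rule compact_continuous_image[OF continuous_on_subset[OF cont subset_UNIV] compact_cball])
    from compact_imp_bounded[OF this] show "\<exists>b. \<forall>x\<in>cball 0 R. norm (f' x e) \<le> b"
      unfolding bounded_iff by simp
  qed
  then obtain b where b: "\<And>e x. x \<in> cball 0 R \<Longrightarrow> norm (f' x e) \<le> b e" by metis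
  have on: "onorm (f' x) \<le> (\<Sum>e\<in>Basis. b e)" if x: "x \<in> cball 0 R" for x
  proof (rule onorm_le)
    fix h
    have lin: "linear (f' x)" using f' has_derivative_linear by blast
    have "f' x h = f' x (\<Sum>e\<in>Basis. (h \<bullet> e) *\<^sub>R e)" by (simp add: euclidean_representation)
    also have "\<dots> = (\<Sum>e\<in>Basis. (h \<bullet> e) *\<^sub>R f' x e)"
      by (simp add: linear_sum[OF lin] linear_cmul[OF lin])
    finally have "norm (f' x h) \<le> (\<Sum>e\<in>Basis. norm ((h \<bullet> e) *\<^sub>R f' x e))" by (simp only: norm_sum)
    also have "\<dots> \<le> (\<Sum>e\<in>Basis. b e * norm h)"
    proof (rule sum_mono)
      fix e :: 'a assume "e \<in> Basis"
      then have "\<bar>h \<bullet> e\<bar> \<le> norm h" by (rule Basis_le_norm)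
      then have "\<bar>h \<bullet> e\<bar> * norm (f' x e) \<le> norm h * b e" using b[OF x, of e] by (intro mult_mono) auto
      then show "norm ((h \<bullet> e) *\<^sub>R f' x e) \<le> b e * norm h" by (simp add: mult.commute)
    qed
    finally show "norm (f' x h) \<le> (\<Sum>e\<in>Basis. b e) * norm h" by (simp add: sum_distrib_right)
  qed
  show ?thesis
  proof
    fix x y :: 'a assume "x \<in> cball 0 R" "y \<in> cball 0 R"
    then show "norm (f x - f y) \<le> (\<Sum>e\<in>Basis. b e) * norm (x - y)"
      using on by (intro differentiable_bound[of "cball 0 R" f f'] has_derivative_at_withinI[OF f']) auto
  qed
qed

text \<open>The regularity of a first derivative that a quadratic remainder requires. Unlike
  differentiability, it is preserved by the truncation \<open>max 0\<close> in the derivative of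
  \<open>bump\<close>.\<close>

definition loc_lipschitz :: "('a::real_normed_vector \<Rightarrow> 'b::real_normed_vector) \<Rightarrow> bool" where
  "loc_lipschitz f \<longleftrightarrow> (\<forall>R. \<exists>L\<ge>0. \<forall>x\<in>cball 0 R. \<forall>y\<in>cball 0 R. norm (f x - f y) \<le> L * norm (x - y))"

lemma loc_lipschitzD:
  assumes "loc_lipschitz f"
  obtains L where "L \<ge> 0"
    "\<And>x y. norm x \<le> R \<Longrightarrow> norm y \<le> R \<Longrightarrow> norm (f x - f y) \<le> L * norm (x - y)"
proof -
  obtain L where "L\<ge>0" "\<forall>x\<in>cball 0 R. \<forall>y\<in>cball 0 R. norm (f x - f y) \<le> L * norm (x - y)"
    using assms unfolding loc_lipschitz_def by blast
  then show ?thesis by (intro that[of L]) auto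
qed

lemma loc_lipschitz_C_k_map:
  fixes f :: "'a::euclidean_space \<Rightarrow> 'b::euclidean_space"
  assumes "C_k_map (Suc 0) f"
  shows "loc_lipschitz f"
  unfolding loc_lipschitz_def
proof
  fix R
  obtain L where L: "\<And>x y. x \<in> cball 0 R \<Longrightarrow> y \<in> cball 0 R \<Longrightarrow> norm (f x - f y) \<le> L * norm (x - y)"
    using C_k_map_1_lipschitz[OF assms, of R] by blast
  have "norm (f x - f y) \<le> max 0 L * norm (x - y)" if "x \<in> cball 0 R" "y \<in> cball 0 R" for x y
    using L[OF that] mult_right_mono[of L "max 0 L" "norm (x - y)"] by simp
  then show "\<exists>L\<ge>0. \<forall>x\<in>cball 0 R. \<forall>y\<in>cball 0 R. norm (f x - f y) \<le> L * norm (x - y)"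
    by (intro exI[of _ "max 0 L"]) auto
qed

lemma loc_lipschitz_bounded:
  fixes f :: "'a::real_normed_vector \<Rightarrow> 'b::real_normed_vector"
  assumes "loc_lipschitz f"
  obtains B where "B \<ge> 0" "\<And>x. norm x \<le> R \<Longrightarrow> norm (f x) \<le> B"
proof -
  obtain L where L: "L \<ge> 0" "\<And>x y. norm x \<le> R \<Longrightarrow> norm y \<le> R \<Longrightarrow> norm (f x - f y) \<le> L * norm (x - y)"
    using loc_lipschitzD[OF assms, of R] by blast
  show ?thesis
  proof (rule that[of "norm (f 0) + L * \<bar>R\<bar>"])
    fix x :: 'a assume x: "norm x \<le> R"
    then have "0 \<le> R" using norm_ge_zero order_trans by blast
    have "norm (f x) \<le> norm (f 0) + norm (f x - f 0)" using norm_triangle_ineq[of "f 0" "f x - f 0"] by simp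
    also have "norm (f x - f 0) \<le> L * norm (x - 0)" using x \<open>0 \<le> R\<close> by (intro L(2)) auto
    also have "\<dots> \<le> L * \<bar>R\<bar>" using x L(1) by (intro mult_left_mono) auto
    finally show "norm (f x) \<le> norm (f 0) + L * \<bar>R\<bar>" by simp
  qed (use L in auto)
qed

lemma loc_lipschitz_inner:
  assumes "loc_lipschitz f" "loc_lipschitz g"
  shows "loc_lipschitz (\<lambda>x. f x \<bullet> g x)"
  unfolding loc_lipschitz_def
proof
  fix R
  obtain L where L: "L \<ge> 0" "\<And>x y. norm x \<le> R \<Longrightarrow> norm y \<le> R \<Longrightarrow> norm (f x - f y) \<le> L * norm (x - y)"
    using loc_lipschitzD[OF assms(1), of R] by blast
  obtain K where K: "K \<ge> 0" "\<And>x y. norm x \<le> R \<Longrightarrow> norm y \<le> R \<Longrightarrow> norm (g x - g y) \<le> K * norm (x - y)"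
    using loc_lipschitzD[OF assms(2), of R] by blast
  obtain A where A: "A \<ge> 0" "\<And>x. norm x \<le> R \<Longrightarrow> norm (f x) \<le> A"
    using loc_lipschitz_bounded[OF assms(1), of R] by blast
  obtain B where B: "B \<ge> 0" "\<And>x. norm x \<le> R \<Longrightarrow> norm (g x) \<le> B"
    using loc_lipschitz_bounded[OF assms(2), of R] by blast
  have "norm (f x \<bullet> g x - f y \<bullet> g y) \<le> (A * K + L * B) * norm (x - y)"
    if x: "norm x \<le> R" and y: "norm y \<le> R" for x y
  proof -
    have "norm (f x \<bullet> g x - f y \<bullet> g y) = norm (f x \<bullet> (g x - g y) + (f x - f y) \<bullet> g y)"
      by (simp add: inner_diff_left inner_diff_right)
    also have "\<dots> \<le> norm (f x) * norm (g x - g y) + norm (f x - f y) * norm (g y)"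
      using Cauchy_Schwarz_ineq2[of "f x" "g x - g y"] Cauchy_Schwarz_ineq2[of "f x - f y" "g y"]
      by simp
    also have "\<dots> \<le> A * (K * norm (x - y)) + (L * norm (x - y)) * B"
      using L K A B x y by (intro add_mono mult_mono) auto
    finally show ?thesis by (simp add: algebra_simps)
  qed
  then show "\<exists>L\<ge>0. \<forall>x\<in>cball 0 R. \<forall>y\<in>cball 0 R. norm (f x \<bullet> g x - f y \<bullet> g y) \<le> L * norm (x - y)"
    using A B L K by (intro exI[of _ "A * K + L * B"]) auto
qed

lemma loc_lipschitz_mult:
  fixes f g :: "'a::real_normed_vector \<Rightarrow> real"
  shows "loc_lipschitz f \<Longrightarrow> loc_lipschitz g \<Longrightarrow> loc_lipschitz (\<lambda>x. f x * g x)"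
  using loc_lipschitz_inner[of f g] by simp

lemma loc_lipschitz_max_const_diff:
  fixes f :: "'a::real_normed_vector \<Rightarrow> real"
  assumes "loc_lipschitz f"
  shows "loc_lipschitz (\<lambda>x. max 0 (1 - f x))"
  unfolding loc_lipschitz_def
proof
  fix R
  obtain L where L: "L \<ge> 0" "\<And>x y. norm x \<le> R \<Longrightarrow> norm y \<le> R \<Longrightarrow> norm (f x - f y) \<le> L * norm (x - y)"
    using loc_lipschitzD[OF assms, of R] by blast
  have "norm (max 0 (1 - f x) - max 0 (1 - f y)) \<le> L * norm (x - y)" if "norm x \<le> R" "norm y \<le> R" for x y
    using L(2)[OF that] by (simp add: abs_if max_def split: if_splits)
  then show "\<exists>L\<ge>0. \<forall>x\<in>cball 0 R. \<forall>y\<in>cball 0 R.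
      norm (max 0 (1 - f x) - max 0 (1 - f y)) \<le> L * norm (x - y)"
    using L(1) by (intro exI[of _ L]) auto
qed

text \<open>The cube makes the function differentiable across the unit sphere, with a locally
  Lipschitz derivative. The value \<open>1\<close> is taken exactly off the open unit ball, so the
  equation \<open>dbump l x = 1\<close> can serve as the exit event.\<close>

definition bump :: "'a::euclidean_space \<Rightarrow> real" where
  "bump v = 1 - max 0 (1 - v \<bullet> v) ^ 3"

lemma bump_nonneg: "0 \<le> bump v" and bump_le_1: "bump v \<le> 1" and bump_0: "bump 0 = 0"
  unfolding bump_def by (auto simp: power_le_one_iff max_def power_le_one)

lemma bump_eq_1_iff: "bump v = 1 \<longleftrightarrow> norm v \<ge> 1"
proof -
  have "norm v \<ge> 1 \<longleftrightarrow> v \<bullet> v \<ge> 1"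
    by (metis abs_1 abs_norm_cancel abs_square_le_1 dot_square_norm linorder_not_le norm_ge_zero one_power2 power_mono_iff zero_less_one zero_less_numeral zero_le_one)
  then show ?thesis unfolding bump_def by (auto simp: max_def)
qed

lemma continuous_bump: "continuous_on UNIV bump"
  unfolding bump_def by (intro continuous_intros)

lemma DERIV_max_cube:
  fixes t :: real
  shows "((\<lambda>t. max 0 t ^ 3) has_real_derivative 3 * (max 0 t)\<^sup>2) (at t)"
proof -
  consider "t > 0" | "t < 0" | "t = 0" by linarith
  then show ?thesis
  proof cases
    case 1
    have "((\<lambda>t. t ^ 3) has_real_derivative 3 * t\<^sup>2) (at t)"
      by (auto intro!: derivative_eq_intros)
    then have "((\<lambda>t. max 0 t ^ 3) has_real_derivative 3 * t\<^sup>2) (at t)"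
      by (rule has_field_derivative_transform_within_open[of _ _ _ "{0<..}"]) (use 1 in auto)
    then show ?thesis using 1 by (simp add: max_absorb2)
  next
    case 2
    have "((\<lambda>t. 0) has_real_derivative 0) (at t)" by simp
    then have "((\<lambda>t. max 0 t ^ 3) has_real_derivative 0) (at t)"
      by (rule has_field_derivative_transform_within_open[of _ _ _ "{..<0}"]) (use 2 in auto)
    then show ?thesis using 2 by (simp add: max_absorb1)
  next
    case 3
    have "max 0 z ^ 3 - max 0 0 ^ 3 = (max 0 z)\<^sup>2 * (z - 0)" for z :: real
      by (simp add: power2_eq_square power3_eq_cube max_def)
    moreover have "isCont (\<lambda>z::real. (max 0 z)\<^sup>2) 0" by (intro continuous_intros)
    ultimately have "((\<lambda>t. max 0 t ^ 3) has_real_derivative 0) (at 0)"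
      unfolding CARAT_DERIV by (intro exI[of _ "\<lambda>z::real. (max 0 z)\<^sup>2"]) simp
    then show ?thesis using 3 by simp
  qed
qed

lemma bump_has_derivative:
  "(bump has_derivative (\<lambda>e. 6 * (max 0 (1 - v \<bullet> v))\<^sup>2 * (v \<bullet> e))) (at v)"
proof -
  have "((\<lambda>v::'a. 1 - v \<bullet> v) has_derivative (\<lambda>e. - (2 * (v \<bullet> e)))) (at v)"
    by (auto intro!: derivative_eq_intros simp: inner_commute)
  from DERIV_compose_FDERIV[OF DERIV_max_cube this]
  have "((\<lambda>v::'a. 1 - max 0 (1 - v \<bullet> v) ^ 3) has_derivative
      (\<lambda>e. 0 - (- (2 * (v \<bullet> e))) * (3 * (max 0 (1 - v \<bullet> v))\<^sup>2))) (at v)"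
    by (intro derivative_intros)
  then show ?thesis unfolding bump_def[abs_def] by (simp add: algebra_simps)
qed

section \<open>The group product in the exponential chart\<close>

context nilpotent_lie_group
begin

abbreviation Log :: "'g \<Rightarrow> 'v" where "Log \<equiv> inv_into UNIV Exp"

declare carrier_UNIV [simp]

lemma Log_Exp [simp]: "Log (Exp v) = v" and Exp_Log [simp]: "Exp (Log x) = x"
  using homeomorphism_Exp by (simp_all add: homeomorphism_def)

lemma continuous_Exp: "continuous_on UNIV Exp" and continuous_Log: "continuous_on UNIV Log"
  using homeomorphism_Exp by (simp_all add: homeomorphism_def)

lemma Exp_0: "Exp 0 = \<one>"
proof -
  have "Exp 0 \<otimes> Exp 0 = Exp 0" using Exp_one_parameter[of 0 0 0] by simp
  then show ?thesis by (metis UNIV_I carrier_UNIV l_cancel_one)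
qed

lemma Log_one: "Log \<one> = 0"
  by (metis Exp_0 Log_Exp)

lemma Log_eq_0_iff: "Log x = 0 \<longleftrightarrow> x = \<one>"
  by (metis Exp_0 Exp_Log Log_one)

lemma inv_Exp: "inv (Exp v) = Exp (- v)"
proof -
  have "Exp (- v) \<otimes> Exp v = \<one>" using Exp_one_parameter[of "-1" 1 v] by (simp add: Exp_0)
  then show ?thesis by (metis UNIV_I carrier_UNIV inv_equality)
qed

definition chart_mult :: "'v \<times> 'v \<Rightarrow> 'v" where
  "chart_mult = (\<lambda>(v, w). Log (Exp v \<otimes> Exp w))"

lemma C_k_chart_mult: "C_k_map k chart_mult"
  using smooth_mult unfolding smooth_map_def chart_mult_def by blast

lemma continuous_chart_mult: "continuous_on UNIV chart_mult"
  using C_k_chart_mult[of 0] by simp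

lemma continuous_on_mult_group [continuous_intros]:
  assumes "continuous_on S f" "continuous_on S g"
  shows "continuous_on S (\<lambda>x. f x \<otimes> g x)"
proof -
  have "continuous_on S (\<lambda>x. Exp (chart_mult (Log (f x), Log (g x))))"
    using assms
    by (intro continuous_on_compose2[OF continuous_Exp] continuous_on_compose2[OF continuous_chart_mult]
        continuous_on_Pair continuous_on_compose2[OF continuous_Log]) auto
  then show ?thesis by (simp add: chart_mult_def)
qed

lemma continuous_on_inv_group [continuous_intros]:
  assumes "continuous_on S f"
  shows "continuous_on S (\<lambda>x. inv (f x))"
proof -
  have "inv (f x) = Exp (- Log (f x))" for x using inv_Exp[of "Log (f x)"] by simp
  then show ?thesis
    using assms by (auto intro!: continuous_on_compose2[OF continuous_Exp] continuous_intros
        continuous_on_compose2[OF continuous_Log])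
qed

text \<open>If both \<open>w\<close> and the product of \<open>v\<close> and \<open>w\<close> lie in
  the unit ball, then \<open>v\<close> is that product times the inverse of \<open>w\<close>, hence
  in a compact set.\<close>

lemma bump_mult_vanish:
  obtains R where "R > 0" "\<And>v w. norm w \<le> 1 \<Longrightarrow> norm v > R \<Longrightarrow> norm (chart_mult (v, w)) \<ge> 1"
proof -
  have "compact (chart_mult ` (cball 0 1 \<times> cball 0 1))"
    by (rule compact_continuous_image[OF continuous_on_subset[OF continuous_chart_mult subset_UNIV]])
       (intro compact_Times compact_cball)
  then obtain R where R: "R > 0" "\<And>z. z \<in> chart_mult ` (cball 0 1 \<times> cball 0 1) \<Longrightarrow> norm z \<le> R"
    by (metis bounded_pos compact_imp_bounded)
  show ?thesis
  proof (rule that[OF R(1)], rule ccontr)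
    fix v w assume w: "norm w \<le> 1" and v: "norm v > R" and "\<not> norm (chart_mult (v, w)) \<ge> 1"
    then have "(chart_mult (v, w), - w) \<in> cball 0 1 \<times> cball 0 1" by simp
    moreover have "chart_mult (chart_mult (v, w), - w) = v"
      by (simp add: chart_mult_def inv_Exp[symmetric] m_assoc)
    ultimately have "v \<in> chart_mult ` (cball 0 1 \<times> cball 0 1)" by (metis image_eqI)
    then show False using R(2) v by fastforce
  qed
qed

text \<open>Uniformity in \<open>v\<close> is automatic, as both sides vanish for large \<open>v\<close>.\<close>

lemma bump_taylor:
  obtains C where "C > 0"
    "\<And>v. \<exists>b. norm b \<le> C \<and>
       (\<forall>w. norm w \<le> 1 \<longrightarrow> \<bar>bump (chart_mult (v, w)) - bump v - b \<bullet> w\<bar> \<le> C * (norm w)\<^sup>2)"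
proof -
  obtain m' where m': "\<And>z. (chart_mult has_derivative m' z) (at z)"
    and C1: "\<And>e. C_k_map (Suc 0) (\<lambda>z. m' z e)"
    using C_k_chart_mult[of "Suc (Suc 0)"] by (auto simp del: C_k_map.simps(1))
  define D where "D z e = 6 * (max 0 (1 - chart_mult z \<bullet> chart_mult z))\<^sup>2 * (chart_mult z \<bullet> m' z e)" for z e
  have deriv: "((\<lambda>z. bump (chart_mult z)) has_derivative D z) (at z)" for z
    using diff_chain_at[OF m' bump_has_derivative] by (simp add: o_def D_def[abs_def])
  have lin: "linear (D z)" for z using deriv has_derivative_linear by blast
  have lip: "loc_lipschitz (\<lambda>z. D z e)" for e
  proof -
    have m: "loc_lipschitz chart_mult" by (rule loc_lipschitz_C_k_map[OF C_k_chart_mult])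
    have me: "loc_lipschitz (\<lambda>z. m' z e)" by (rule loc_lipschitz_C_k_map[OF C1])
    have const: "loc_lipschitz (\<lambda>z::'v \<times> 'v. 6::real)" by (auto simp: loc_lipschitz_def)
    show ?thesis unfolding D_def power2_eq_square
      by (intro loc_lipschitz_mult loc_lipschitz_max_const_diff loc_lipschitz_inner m me const)
  qed
  obtain R where R: "R > 0" "\<And>v w. norm w \<le> 1 \<Longrightarrow> norm v > R \<Longrightarrow> norm (chart_mult (v, w)) \<ge> 1"
    using bump_mult_vanish by blast
  \<comment> \<open>Base points of norm at most \<open>R\<close> are paired with a vector of norm at
    most \<open>1\<close>, so all pairs lie in the ball of radius \<open>R + 1\<close>.\<close>
  have "\<forall>e. \<exists>L\<ge>0. \<forall>x y. norm x \<le> R + 1 \<longrightarrow> norm y \<le> R + 1 \<longrightarrow> norm (D x e - D y e) \<le> L * norm (x - y)"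
    using loc_lipschitzD[OF lip] by metis
  then obtain L where L: "\<And>e. L e \<ge> 0"
    "\<And>e x y. norm x \<le> R + 1 \<Longrightarrow> norm y \<le> R + 1 \<Longrightarrow> norm (D x e - D y e) \<le> L e * norm (x - y)"
    by metis
  have "\<forall>e. \<exists>B\<ge>0. \<forall>x. norm x \<le> R + 1 \<longrightarrow> norm (D x e) \<le> B"
    using loc_lipschitz_bounded[OF lip] by metis
  then obtain B where B: "\<And>e. B e \<ge> 0" "\<And>e x. norm x \<le> R + 1 \<Longrightarrow> norm (D x e) \<le> B e" by metis
  define C where "C = 1 + (\<Sum>e\<in>Basis. L (0, e)) + (\<Sum>e\<in>Basis. B (0, e))"
  have sums: "(\<Sum>e\<in>Basis. L (0, e)) \<ge> 0" "(\<Sum>e\<in>Basis. B (0, e)) \<ge> 0"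
    using L(1) B(1) by (auto intro: sum_nonneg)
  define b where "b v = (\<Sum>e\<in>Basis. D (v, 0) (0, e) *\<^sub>R e)" for v
  have Dexp: "D z (0, w) = (\<Sum>e\<in>Basis. (w \<bullet> e) * D z (0, e))" for z w
  proof -
    have "(0, w) = (\<Sum>e\<in>Basis. (w \<bullet> e) *\<^sub>R (0 :: 'v, e))"
      by (simp add: sum_prod euclidean_representation)
    then have "D z (0, w) = D z (\<Sum>e\<in>Basis. (w \<bullet> e) *\<^sub>R (0, e))" by (rule arg_cong)
    also have "\<dots> = (\<Sum>e\<in>Basis. (w \<bullet> e) *\<^sub>R D z (0, e))"
      by (simp only: linear_sum[OF lin] linear_cmul[OF lin])
    finally show ?thesis by simp
  qed
  have bw: "b v \<bullet> w = D (v, 0) (0, w)" for v w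
    unfolding b_def Dexp[of _ w] inner_sum_left
    by (intro sum.cong) (simp_all add: inner_commute)
  show ?thesis
  proof (rule that[of C])
    show "C > 0" using sums by (simp add: C_def)
    fix v
    show "\<exists>b. norm b \<le> C \<and>
       (\<forall>w. norm w \<le> 1 \<longrightarrow> \<bar>bump (chart_mult (v, w)) - bump v - b \<bullet> w\<bar> \<le> C * (norm w)\<^sup>2)"
    proof (intro exI[of _ "b v"] conjI allI impI)
      have m0: "chart_mult (v, 0) = v" by (simp add: chart_mult_def Exp_0)
      have big: "norm v > R \<Longrightarrow> D (v, 0) e = 0" for e
        using R(2)[of 0 v] bump_eq_1_iff[of v] by (auto simp: D_def m0 bump_def)
      show "norm (b v) \<le> C"
      proof (cases "norm v > R")
        case True
        then show ?thesis using sums by (simp add: b_def big C_def)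
      next
        case False
        have "norm (b v) \<le> (\<Sum>e\<in>Basis. norm (D (v, 0) (0, e) *\<^sub>R e))" unfolding b_def by (rule norm_sum)
        also have "\<dots> \<le> (\<Sum>e\<in>Basis. B (0, e))"
          using B(2)[of "(v, 0)"] False by (intro sum_mono) (simp add: norm_Pair)
        finally show ?thesis using sums by (simp add: C_def)
      qed
      fix w :: 'v assume w: "norm w \<le> 1"
      show "\<bar>bump (chart_mult (v, w)) - bump v - b v \<bullet> w\<bar> \<le> C * (norm w)\<^sup>2"
      proof (cases "norm v > R")
        case True
        then have "bump (chart_mult (v, w)) = 1" "bump (chart_mult (v, 0)) = 1"
          using R(2)[of w v] R(2)[of 0 v] w by (auto simp: bump_eq_1_iff)
        then show ?thesis using True sums by (simp add: bw big m0 C_def)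
      next
        case False
        \<comment> \<open>Along the segment from \<open>0\<close> to \<open>w\<close>, the mean
          value theorem leaves a difference of two first derivatives in direction \<open>w\<close>;
          their Lipschitz continuity supplies the second factor \<open>norm w\<close>.\<close>
        have "((\<lambda>t. bump (chart_mult (v, t *\<^sub>R w))) has_derivative (\<lambda>h. D (v, t *\<^sub>R w) (0, h *\<^sub>R w))) (at t)" for t :: real
        proof -
          have "((\<lambda>t::real. (v, t *\<^sub>R w)) has_derivative (\<lambda>h. (0, h *\<^sub>R w))) (at t)"
            by (auto intro!: derivative_eq_intros)
          from diff_chain_at[OF this deriv] show ?thesis by (simp add: o_def)
        qed
        then have "\<exists>t::real\<in>{0<..<1}. bump (chart_mult (v, 1 *\<^sub>R w)) - bump (chart_mult (v, 0 *\<^sub>R w)) =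
            (\<lambda>h. D (v, t *\<^sub>R w) (0, h *\<^sub>R w)) (1 - 0)"
          by (intro mvt_simple[of 0 1 "\<lambda>t. bump (chart_mult (v, t *\<^sub>R w))" "\<lambda>t h. D (v, t *\<^sub>R w) (0, h *\<^sub>R w)"])
             (auto intro: has_derivative_at_withinI)
        then obtain t :: real where t: "0 < t" "t < 1"
          "bump (chart_mult (v, w)) - bump v = D (v, t *\<^sub>R w) (0, w)"
          by (auto simp: m0)
        have tw: "norm (t *\<^sub>R w) \<le> norm w" using t by (simp add: mult_left_le_one_le)
        have "\<bar>D (v, t *\<^sub>R w) (0, w) - D (v, 0) (0, w)\<bar> =
            \<bar>\<Sum>e\<in>Basis. (w \<bullet> e) * (D (v, t *\<^sub>R w) (0, e) - D (v, 0) (0, e))\<bar>"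
          by (simp add: Dexp[of _ w] sum_subtractf right_diff_distrib)
        also have "\<dots> \<le> (\<Sum>e\<in>Basis. norm w * (L (0, e) * norm w))"
        proof (rule order_trans[OF sum_abs sum_mono])
          fix e :: 'v assume "e \<in> Basis"
          then have "\<bar>w \<bullet> e\<bar> \<le> norm w" by (rule Basis_le_norm)
          moreover have "\<bar>D (v, t *\<^sub>R w) (0, e) - D (v, 0) (0, e)\<bar> \<le> L (0, e) * norm w"
          proof -
            have "norm (v, t *\<^sub>R w) \<le> R + 1"
              using norm_Pair_le[of v "t *\<^sub>R w"] False w tw by linarith
            moreover have "norm (v, 0 :: 'v) \<le> R + 1" using False by (simp add: norm_Pair)
            ultimately have "norm (D (v, t *\<^sub>R w) (0, e) - D (v, 0) (0, e)) \<le> L (0, e) * norm ((v, t *\<^sub>R w) - (v, 0))"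
              by (rule L(2))
            also have "norm ((v, t *\<^sub>R w) - (v, 0)) \<le> norm w" using tw by (simp add: norm_Pair)
            finally show ?thesis using L(1) by (simp add: mult_left_mono)
          qed
          ultimately show "\<bar>(w \<bullet> e) * (D (v, t *\<^sub>R w) (0, e) - D (v, 0) (0, e))\<bar> \<le> norm w * (L (0, e) * norm w)"
            unfolding abs_mult by (intro mult_mono) auto
        qed
        also have "\<dots> = (\<Sum>e\<in>Basis. L (0, e)) * (norm w)\<^sup>2"
          unfolding sum_distrib_right by (intro sum.cong) (simp_all add: power2_eq_square algebra_simps)
        also have "\<dots> \<le> C * (norm w)\<^sup>2" using sums by (intro mult_right_mono) (auto simp: C_def)
        finally show ?thesis using t(3) by (simp add: bw)
      qed
    qed
  qed
qed

end

section \<open>Dilated bump functions\<close>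

context homogeneous_group
begin

abbreviation dil :: "real \<Rightarrow> 'g \<Rightarrow> 'g" where "dil \<equiv> dilation Exp u d"

lemma inj_u: "inj_on u {1..DIM('v)}"
proof
  fix i j assume "i \<in> {1..DIM('v)}" "j \<in> {1..DIM('v)}" "u i = u j"
  then show "i = j" using orthonormal_basis[of i j] orthonormal_basis[of j j] by (auto split: if_splits)
qed

lemma u_span: "span (u ` {1..DIM('v)}) = UNIV"
proof -
  have "pairwise orthogonal (u ` {1..DIM('v)})"
    by (auto simp: pairwise_def orthogonal_def orthonormal_basis)
  moreover have "0 \<notin> u ` {1..DIM('v)}"
    using orthonormal_basis by (metis (no_types, lifting) image_iff inner_zero_left zero_neq_one)
  ultimately have "independent (u ` {1..DIM('v)})" by (rule pairwise_orthogonal_independent)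
  moreover have "card (u ` {1..DIM('v)}) = DIM('v)" using card_image[OF inj_u] by simp
  ultimately show ?thesis
    using card_ge_dim_independent[OF subset_UNIV, of "u ` {1..DIM('v)}"] by (simp add: top.extremum_unique)
qed

lemma u_expand: "(\<Sum>i = 1..DIM('v). (v \<bullet> u i) *\<^sub>R u i) = v"
proof -
  have "(\<Sum>b\<in>u ` {1..DIM('v)}. (v \<bullet> b) *\<^sub>R b) = v"
  proof (rule orthonormal_basis_expand)
    show "pairwise orthogonal (u ` {1..DIM('v)})"
      by (auto simp: pairwise_def orthogonal_def orthonormal_basis)
    show "norm b = 1" if "b \<in> u ` {1..DIM('v)}" for b
      using that orthonormal_basis by (auto simp: norm_eq_sqrt_inner)
    show "v \<in> span (u ` {1..DIM('v)})" unfolding u_span ..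
    show "finite (u ` {1..DIM('v)})" by simp
  qed
  then show ?thesis unfolding sum.reindex[OF inj_u] o_def .
qed

lemma inner_u_sum:
  assumes "i \<in> {1..DIM('v)}"
  shows "(\<Sum>j = 1..DIM('v). a j *\<^sub>R u j) \<bullet> u i = a i"
proof -
  have "(\<Sum>j = 1..DIM('v). a j *\<^sub>R u j) \<bullet> u i = (\<Sum>j = 1..DIM('v). if j = i then a j else 0)"
    unfolding inner_sum_left by (intro sum.cong) (use assms in \<open>auto simp: orthonormal_basis\<close>)
  then show ?thesis using assms by simp
qed

lemma inner_expand: "v \<bullet> w = (\<Sum>i = 1..DIM('v). (v \<bullet> u i) * (w \<bullet> u i))"
proof -
  have "v \<bullet> w = (\<Sum>i = 1..DIM('v). (v \<bullet> u i) *\<^sub>R u i) \<bullet> w" by (simp only: u_expand)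
  also have "\<dots> = (\<Sum>i = 1..DIM('v). (v \<bullet> u i) * (w \<bullet> u i))"
    unfolding inner_sum_left inner_scaleR_left by (simp add: inner_commute)
  finally show ?thesis .
qed

lemma norm_sq_expand: "(norm v)\<^sup>2 = (\<Sum>i = 1..DIM('v). (v \<bullet> u i)\<^sup>2)"
  unfolding power2_norm_eq_inner inner_expand[of v v] by (simp add: power2_eq_square)

lemma abs_inner_u: "i \<in> {1..DIM('v)} \<Longrightarrow> \<bar>v \<bullet> u i\<bar> \<le> norm v"
  using Cauchy_Schwarz_ineq2[of v "u i"] orthonormal_basis[of i i] by (simp add: norm_eq_sqrt_inner)

lemma d_ge: "i \<in> {1..DIM('v)} \<Longrightarrow> d i \<ge> 1"
  using d_ge_1 mono_onD[OF d_mono, of 1 i] by fastforce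

lemma Log_dil_inner: "i \<in> {1..DIM('v)} \<Longrightarrow> Log (dil l x) \<bullet> u i = l powr d i * (Log x \<bullet> u i)"
  unfolding dilation_def Log_Exp by (rule inner_u_sum)

lemma Log_eqI: "(\<And>i. i \<in> {1..DIM('v)} \<Longrightarrow> Log x \<bullet> u i = Log y \<bullet> u i) \<Longrightarrow> x = y"
  by (metis (no_types, lifting) Exp_Log sum.cong u_expand)

lemma dil_dil: "l \<ge> 0 \<Longrightarrow> k \<ge> 0 \<Longrightarrow> dil l (dil k x) = dil (l * k) x"
  by (rule Log_eqI) (simp add: Log_dil_inner powr_mult)

lemma dil_1 [simp]: "dil 1 x = x"
  by (rule Log_eqI) (simp add: Log_dil_inner)

lemma dil_mult: "l > 0 \<Longrightarrow> dil l (x \<otimes> y) = dil l x \<otimes> dil l y"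
  using dilation_automorphism[of l] hom_mult[of "dil l" G G x y] by (simp add: iso_def)

lemma dil_one [simp]: "dil l \<one> = \<one>"
  by (rule Log_eqI) (simp add: Log_dil_inner Log_one)

lemma dil_inv: "l > 0 \<Longrightarrow> dil l (inv x) = inv (dil l x)"
  by (metis UNIV_I carrier_UNIV dil_mult dil_one inv_equality l_inv)

lemma continuous_on_dil [continuous_intros]:
  assumes "continuous_on S f"
  shows "continuous_on S (\<lambda>x. dil l (f x))"
  unfolding dilation_def
  using assms by (intro continuous_on_compose2[OF continuous_Exp] continuous_intros
      continuous_on_compose2[OF continuous_Log]) auto

definition dbump :: "real \<Rightarrow> 'g \<Rightarrow> real" where
  "dbump l x = bump (Log (dil l x))"

lemma dbump_nonneg: "0 \<le> dbump l x" and dbump_le_1: "dbump l x \<le> 1" and dbump_one: "dbump l \<one> = 0"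
  by (simp_all add: dbump_def bump_nonneg bump_le_1 bump_0 Log_one)

lemma dbump_eq_1_iff: "dbump l x = 1 \<longleftrightarrow> norm (Log (dil l x)) \<ge> 1"
  by (simp add: dbump_def bump_eq_1_iff)

lemma continuous_dbump: "continuous_on UNIV (dbump l)"
  unfolding dbump_def
  by (intro continuous_on_compose2[OF continuous_bump] continuous_on_compose2[OF continuous_Log]
      continuous_intros) auto

text \<open>Off \<open>U\<close> the bound is part of the definition; the rest of the complement of
  \<open>V\<close> lies in a compact set that avoids the identity, where \<open>\<theta>\<close>
  attains a positive minimum.\<close>

lemma scaling_function_lower:
  assumes \<xi>: "local_coordinates G Exp u U \<xi>" and \<theta>: "scaling_function G u U \<xi> \<theta>"
    and V: "open V" "\<one> \<in> V"
  obtains c where "c > 0" "\<And>x. x \<notin> V \<Longrightarrow> \<theta> x \<ge> c"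
proof -
  obtain c1 where c1: "c1 > 0" "\<And>x. x \<notin> U \<Longrightarrow> \<theta> x > c1"
    using \<theta> unfolding scaling_function_def by blast
  have cont: "continuous_on UNIV \<theta>" and pos: "\<And>x. x \<noteq> \<one> \<Longrightarrow> \<theta> x > 0"
    using \<theta> unfolding scaling_function_def by auto
  have K: "compact (closure U \<inter> - V)"
    using \<xi> V by (intro compact_Int_closed) (auto simp: local_coordinates_def)
  show ?thesis
  proof (cases "closure U \<inter> - V = {}")
    case True
    then show ?thesis using c1 closure_subset[of U] by (intro that[of c1]) (auto intro: less_imp_le)
  next
    case False
    obtain y where y: "y \<in> closure U \<inter> - V" "\<And>x. x \<in> closure U \<inter> - V \<Longrightarrow> \<theta> y \<le> \<theta> x"
      using continuous_attains_inf[OF K False continuous_on_subset[OF cont subset_UNIV]] by blast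
    have "\<theta> y > 0" using y(1) V by (intro pos) auto
    show ?thesis
    proof (rule that[of "min c1 (\<theta> y)"])
      show "min c1 (\<theta> y) > 0" using \<open>\<theta> y > 0\<close> c1 by simp
      fix x assume "x \<notin> V"
      then show "min c1 (\<theta> y) \<le> \<theta> x"
        using y(2)[of x] c1(2)[of x] closure_subset[of U] by (cases "x \<in> U") auto
    qed
  qed
qed

lemma local_coordinates_bounded:
  assumes \<xi>: "local_coordinates G Exp u U \<xi>"
  obtains B where "B > 0" "\<And>i x. i \<in> {1..DIM('v)} \<Longrightarrow> \<bar>\<xi> i x\<bar> \<le> B"
    and "\<And>i. i \<in> {1..DIM('v)} \<Longrightarrow> continuous_on UNIV (\<xi> i)"
proof -
  have cont: "continuous_on UNIV (\<xi> i)" if "i \<in> {1..DIM('v)}" for i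
  proof -
    have "C_k_map 0 (\<xi> i \<circ> Exp)"
      using \<xi> that unfolding local_coordinates_def smooth_map_def by blast
    then have "continuous_on UNIV (\<lambda>x. (\<xi> i \<circ> Exp) (Log x))"
      by (intro continuous_on_compose2[OF _ continuous_Log]) auto
    then show ?thesis by simp
  qed
  have "\<exists>b. \<forall>x. \<bar>\<xi> i x\<bar> \<le> b" if i: "i \<in> {1..DIM('v)}" for i
  proof -
    have "compact (closure {x. \<xi> i x \<noteq> 0})"
      using \<xi> i unfolding local_coordinates_def by blast
    then have "compact (\<xi> i ` closure {x. \<xi> i x \<noteq> 0})"
      by (rule compact_continuous_image[OF continuous_on_subset[OF cont[OF i] subset_UNIV]])
    then obtain b where b: "\<And>x. x \<in> closure {x. \<xi> i x \<noteq> 0} \<Longrightarrow> \<bar>\<xi> i x\<bar> \<le> b" and "b > 0"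
      using compact_imp_bounded bounded_pos by (metis image_eqI real_norm_def)
    then have "\<bar>\<xi> i x\<bar> \<le> b" for x
      using closure_subset[of "{x. \<xi> i x \<noteq> 0}"] by (cases "\<xi> i x = 0") auto
    then show ?thesis by blast
  qed
  then obtain b where b: "\<And>i x. i \<in> {1..DIM('v)} \<Longrightarrow> \<bar>\<xi> i x\<bar> \<le> b i" by metis
  have "\<bar>\<xi> i x\<bar> \<le> 1 + (\<Sum>i = 1..DIM('v). \<bar>b i\<bar>)" if i: "i \<in> {1..DIM('v)}" for i x
    using b[OF i, of x] member_le_sum[of i "{1..DIM('v)}" "\<lambda>i. \<bar>b i\<bar>"] i by fastforce
  then show ?thesis using cont by (intro that[of "1 + (\<Sum>i = 1..DIM('v). \<bar>b i\<bar>)"]) (auto intro: add_pos_nonneg sum_nonneg)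
qed

text \<open>Let \<open>w\<close> be the chart vector of \<open>dil l y\<close>. Off
  \<open>V\<close>, a lower bound of \<open>\<theta>\<close> absorbs everything. On \<open>V\<close>
  with \<open>w\<close> in the unit ball, the Taylor expansion applies. On \<open>V\<close> with
  \<open>w\<close> outside it, the trivial bound \<open>1\<close> is paid for by some coordinate of
  \<open>w\<close> that is not small. The bound is one-sided since only upward drift has to be
  controlled.\<close>

lemma dbump_increment:
  assumes \<xi>: "local_coordinates G Exp u U \<xi>" and \<theta>: "scaling_function G u U \<xi> \<theta>"
    and near: "\<forall>\<^sub>F x in nhds \<one>. \<theta> x = (\<Sum>i = 1..DIM('v). \<bar>\<xi> i x\<bar> powr q i)"
    and q: "\<And>i. i \<in> {1..DIM('v)} \<Longrightarrow> 0 < q i \<and> q i \<le> 2"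
    and \<kappa>: "\<And>i. i \<in> {1..DIM('v)} \<Longrightarrow> q i * d i \<le> \<kappa>"
  obtains C where "C > 0"
    "\<And>l x. l \<ge> 1 \<Longrightarrow> \<exists>\<beta>. (\<forall>i\<in>{1..DIM('v)}. \<bar>\<beta> i\<bar> \<le> C * l powr \<kappa>) \<and>
       (\<forall>y. dbump l (x \<otimes> y) - dbump l x \<le> (\<Sum>i = 1..DIM('v). \<beta> i * \<xi> i y) + C * l powr \<kappa> * \<theta> y)"
proof -
  let ?I = "{1..DIM('v)}"
  obtain V0 where V0: "open V0" "\<one> \<in> V0" "\<And>x. x \<in> V0 \<Longrightarrow> \<theta> x = (\<Sum>i\<in>?I. \<bar>\<xi> i x\<bar> powr q i)"
    using near unfolding eventually_nhds by blast
  have U: "open U" "\<one> \<in> U" "\<And>x. x \<in> U \<Longrightarrow> Log x = (\<Sum>i\<in>?I. \<xi> i x *\<^sub>R u i)"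
    using \<xi> by (auto simp: local_coordinates_def)
  define V where "V = V0 \<inter> U"
  have V: "open V" "\<one> \<in> V" using V0 U by (auto simp: V_def)
  obtain c where c: "c > 0" "\<And>x. x \<notin> V \<Longrightarrow> \<theta> x \<ge> c"
    using scaling_function_lower[OF \<xi> \<theta> V] by blast
  have \<theta>_nonneg: "\<theta> x \<ge> 0" for x
    using \<theta> unfolding scaling_function_def by (metis less_eq_real_def)
  obtain B where B: "B > 0" "\<And>i x. i \<in> ?I \<Longrightarrow> \<bar>\<xi> i x\<bar> \<le> B"
    using local_coordinates_bounded[OF \<xi>] by metis
  obtain C0 where C0: "C0 > 0"
    "\<And>v. \<exists>b. norm b \<le> C0 \<and>
       (\<forall>w. norm w \<le> 1 \<longrightarrow> \<bar>bump (chart_mult (v, w)) - bump v - b \<bullet> w\<bar> \<le> C0 * (norm w)\<^sup>2)"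
    using bump_taylor by blast
  define m where "m = real (DIM('v))"
  have m: "m \<ge> 1" using DIM_positive[where 'a = 'v] by (simp add: m_def Suc_leI)
  \<comment> \<open>\<open>C0\<close> bounds the coefficients \<open>\<beta>\<close>, the quotient
    by \<open>c\<close> serves \<open>y\<close> off \<open>V\<close>, and the remaining terms cover
    \<open>2 * C0\<close> for small \<open>w\<close> and \<open>m + C0 * (m\<^sup>2 + 1)\<close> for
    large \<open>w\<close>.\<close>
  define C where "C = C0 + (1 + m * C0 * B) / c + m + C0 * (m\<^sup>2 + 2)"
  have C_ge: "C \<ge> C0" "C \<ge> (1 + m * C0 * B) / c" "C \<ge> 2 * C0" "C \<ge> m + C0 * (m\<^sup>2 + 1)"
    using C0 m B(1) c(1) by (auto simp: C_def algebra_simps)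
  show ?thesis
  proof (rule that[of C])
    show "C > 0" using C_ge C0 by simp
    fix l :: real and x assume l: "l \<ge> 1"
    define L where "L = l powr \<kappa>"
    obtain b where b: "norm b \<le> C0"
      "\<And>w. norm w \<le> 1 \<Longrightarrow> \<bar>bump (chart_mult (Log (dil l x), w)) - bump (Log (dil l x)) - b \<bullet> w\<bar> \<le> C0 * (norm w)\<^sup>2"
      using C0(2)[of "Log (dil l x)"] by blast
    \<comment> \<open>A linear term is kept only if \<open>q i > 1\<close>, when
      \<open>d i \<le> q i * d i \<le> \<kappa>\<close> bounds its coefficient. If
      \<open>q i \<le> 1\<close>, a coordinate of modulus at most \<open>1\<close> is dominated by
      its power \<open>q i\<close> and joins the \<open>\<theta>\<close> term.\<close>
    define \<beta> where "\<beta> i = (if q i > 1 then (b \<bullet> u i) * l powr d i else 0)" for i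
    have bi: "\<bar>b \<bullet> u i\<bar> \<le> C0" if "i \<in> ?I" for i using abs_inner_u[OF that, of b] b(1) by simp
    have "\<kappa> \<ge> 0"
    proof -
      have "1 \<in> ?I" using DIM_positive[where 'a = 'v] by (simp add: Suc_leI)
      then show ?thesis using \<kappa>[of 1] q[of 1] d_ge[of 1] by (smt (verit) mult_nonneg_nonneg)
    qed
    then have L1: "L \<ge> 1" using l by (simp add: L_def ge_one_powr_ge_zero)
    have ld: "l powr d i \<le> L" if "i \<in> ?I" "q i > 1" for i
    proof -
      have "1 * d i \<le> q i * d i" using that d_ge[OF that(1)] by (intro mult_right_mono) auto
      then have "d i \<le> \<kappa>" using \<kappa>[OF that(1)] by simp
      then show ?thesis using l by (simp add: L_def powr_mono)
    qed
    have \<beta>_le: "\<bar>\<beta> i\<bar> \<le> C0 * L" if "i \<in> ?I" for i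
      using bi[OF that] ld[OF that] C0 L1 by (auto simp: \<beta>_def abs_mult intro!: mult_mono)
    show "\<exists>\<beta>. (\<forall>i\<in>?I. \<bar>\<beta> i\<bar> \<le> C * l powr \<kappa>) \<and>
       (\<forall>y. dbump l (x \<otimes> y) - dbump l x \<le> (\<Sum>i\<in>?I. \<beta> i * \<xi> i y) + C * l powr \<kappa> * \<theta> y)"
      unfolding L_def[symmetric]
    proof (intro exI[of _ \<beta>] conjI ballI allI)
      fix i assume "i \<in> ?I"
      then have "\<bar>\<beta> i\<bar> \<le> C0 * L" by (rule \<beta>_le)
      also have "\<dots> \<le> C * L" using C_ge L1 by (intro mult_right_mono) auto
      finally show "\<bar>\<beta> i\<bar> \<le> C * L" .
    next
      fix y
      have le1: "dbump l (x \<otimes> y) - dbump l x \<le> 1"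
        using dbump_le_1[of l "x \<otimes> y"] dbump_nonneg[of l x] by simp
      show "dbump l (x \<otimes> y) - dbump l x \<le> (\<Sum>i\<in>?I. \<beta> i * \<xi> i y) + C * L * \<theta> y"
      proof (cases "y \<in> V")
        case False
        have "- (\<Sum>i\<in>?I. \<beta> i * \<xi> i y) \<le> (\<Sum>i\<in>?I. \<bar>\<beta> i * \<xi> i y\<bar>)"
          using sum_abs[of "\<lambda>i. \<beta> i * \<xi> i y" ?I] by linarith
        also have "\<dots> \<le> (\<Sum>i\<in>?I. C0 * L * B)"
          using \<beta>_le B(2) C0 L1 by (intro sum_mono) (auto simp: abs_mult intro!: mult_mono)
        also have "\<dots> = m * C0 * B * L" by (simp add: m_def)
        finally have "1 - (\<Sum>i\<in>?I. \<beta> i * \<xi> i y) \<le> (1 + m * C0 * B) * L"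
          using L1 by (simp add: algebra_simps)
        also have "\<dots> = ((1 + m * C0 * B) / c) * L * c" using c by simp
        also have "\<dots> \<le> C * L * \<theta> y"
          using C_ge c(2)[OF False] c(1) L1 C0 B(1) m by (intro mult_mono) auto
        finally show ?thesis using le1 by linarith
      next
        case True
        define w where "w = Log (dil l y)"
        have Logy: "Log y = (\<Sum>i\<in>?I. \<xi> i y *\<^sub>R u i)" using U(3)[of y] True by (simp add: V_def)
        have "Log y \<bullet> u i = \<xi> i y" if "i \<in> ?I" for i
          unfolding Logy by (rule inner_u_sum[OF that])
        then have wi: "w \<bullet> u i = l powr d i * \<xi> i y" if "i \<in> ?I" for i
          using that by (simp add: w_def Log_dil_inner)
        define Q where "Q = (\<Sum>i\<in>?I. \<bar>w \<bullet> u i\<bar> powr q i)"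
        have Qi: "\<bar>w \<bullet> u i\<bar> powr q i \<le> Q" if "i \<in> ?I" for i
          unfolding Q_def using that by (intro member_le_sum) auto
        have Q0: "Q \<ge> 0" by (auto simp: Q_def intro: sum_nonneg)
        have "Q \<le> (\<Sum>i\<in>?I. L * \<bar>\<xi> i y\<bar> powr q i)"
          unfolding Q_def
        proof (rule sum_mono)
          fix i assume i: "i \<in> ?I"
          have "\<bar>w \<bullet> u i\<bar> powr q i = l powr (q i * d i) * \<bar>\<xi> i y\<bar> powr q i"
            by (simp add: wi[OF i] abs_mult powr_mult powr_powr mult.commute)
          also have "l powr (q i * d i) \<le> L" using l \<kappa>[OF i] by (simp add: L_def powr_mono)
          finally show "\<bar>w \<bullet> u i\<bar> powr q i \<le> L * \<bar>\<xi> i y\<bar> powr q i" by (simp add: mult_right_mono)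
        qed
        also have "\<dots> = L * \<theta> y" using V0(3)[of y] True by (simp add: V_def sum_distrib_left)
        finally have Q\<theta>: "Q \<le> L * \<theta> y" .
        have \<beta>w: "\<beta> i * \<xi> i y = (if q i > 1 then (b \<bullet> u i) * (w \<bullet> u i) else 0)" if "i \<in> ?I" for i
          by (simp add: \<beta>_def wi[OF that])
        show ?thesis
        proof (cases "norm w \<le> 1")
          case True
          have wle: "\<bar>w \<bullet> u i\<bar> \<le> 1" if "i \<in> ?I" for i using abs_inner_u[OF that, of w] True by simp
          have pw: "\<bar>w \<bullet> u i\<bar> powr a \<le> \<bar>w \<bullet> u i\<bar> powr q i" if "i \<in> ?I" "q i \<le> a" for i a
            using wle[OF that(1)] that(2) by (cases "w \<bullet> u i = 0") (auto intro: powr_mono')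
          \<comment> \<open>As \<open>q i \<le> 2\<close> and the coordinates of \<open>w\<close>
            have modulus at most \<open>1\<close>, the power \<open>q i\<close> dominates the
            square.\<close>
          have "(norm w)\<^sup>2 \<le> Q"
            unfolding norm_sq_expand Q_def
          proof (rule sum_mono)
            fix i assume i: "i \<in> ?I"
            show "(w \<bullet> u i)\<^sup>2 \<le> \<bar>w \<bullet> u i\<bar> powr q i"
              using pw[OF i, of 2] q[OF i] by (cases "w \<bullet> u i = 0") (auto simp: powr_numeral)
          qed
          have "dil l (x \<otimes> y) = dil l x \<otimes> dil l y" using l by (intro dil_mult) simp
          then have "dbump l (x \<otimes> y) = bump (chart_mult (Log (dil l x), w))"
            by (simp add: dbump_def chart_mult_def w_def)
          then have "dbump l (x \<otimes> y) - dbump l x \<le> b \<bullet> w + C0 * (norm w)\<^sup>2"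
            using b(2)[OF True] by (simp add: dbump_def abs_le_iff)
          also have "\<dots> \<le> b \<bullet> w + C0 * Q" using C0 \<open>(norm w)\<^sup>2 \<le> Q\<close> by simp
          also have "b \<bullet> w \<le> (\<Sum>i\<in>?I. \<beta> i * \<xi> i y + C0 * \<bar>w \<bullet> u i\<bar> powr q i)"
            unfolding inner_expand[of b w]
          proof (rule sum_mono)
            fix i assume i: "i \<in> ?I"
            show "(b \<bullet> u i) * (w \<bullet> u i) \<le> \<beta> i * \<xi> i y + C0 * \<bar>w \<bullet> u i\<bar> powr q i"
            proof (cases "q i > 1")
              case True
              then show ?thesis using C0 by (simp add: \<beta>w[OF i])
            next
              case False
              have "(b \<bullet> u i) * (w \<bullet> u i) \<le> \<bar>b \<bullet> u i\<bar> * \<bar>w \<bullet> u i\<bar>" by (metis abs_ge_self abs_mult)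
              also have "\<dots> \<le> C0 * \<bar>w \<bullet> u i\<bar> powr 1" using bi[OF i] by (intro mult_mono) auto
              also have "\<dots> \<le> C0 * \<bar>w \<bullet> u i\<bar> powr q i"
                using C0 False by (intro mult_left_mono pw[OF i]) auto
              finally show ?thesis using False by (simp add: \<beta>w[OF i])
            qed
          qed
          also have "\<dots> = (\<Sum>i\<in>?I. \<beta> i * \<xi> i y) + C0 * Q"
            by (simp add: sum.distrib sum_distrib_left Q_def)
          finally have "dbump l (x \<otimes> y) - dbump l x \<le> (\<Sum>i\<in>?I. \<beta> i * \<xi> i y) + 2 * C0 * Q" by simp
          also have "2 * C0 * Q \<le> C * (L * \<theta> y)" using C_ge Q\<theta> Q0 C0 by (intro mult_mono) auto
          finally show ?thesis by (simp add: mult.assoc)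
        next
          case False
          \<comment> \<open>If all \<open>m\<close> powers were below \<open>1 / m\<close>, then so
            would be all squared coordinates, again by \<open>q i \<le> 2\<close>, and
            \<open>w\<close> would lie in the unit ball.\<close>
          have "1 \<le> m * Q"
          proof (rule ccontr)
            assume "\<not> 1 \<le> m * Q"
            then have Q: "Q < 1 / m" using m by (simp add: field_simps)
            have "(norm w)\<^sup>2 \<le> (\<Sum>i\<in>?I. 1 / m)"
              unfolding norm_sq_expand
            proof (rule sum_mono)
              fix i assume i: "i \<in> ?I"
              have "\<bar>w \<bullet> u i\<bar> powr q i < 1 / m" using Qi[OF i] Q by simp
              moreover have "1 / m \<le> 1" using m by simp
              ultimately have *: "\<bar>w \<bullet> u i\<bar> powr q i < 1" by simp
              have w1: "\<bar>w \<bullet> u i\<bar> \<le> 1"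
                using * ge_one_powr_ge_zero[of "\<bar>w \<bullet> u i\<bar>" "q i"] q[OF i] by fastforce
              have "(w \<bullet> u i)\<^sup>2 \<le> \<bar>w \<bullet> u i\<bar> powr q i"
                using w1 q[OF i] powr_mono'[of "q i" 2 "\<bar>w \<bullet> u i\<bar>"]
                by (cases "w \<bullet> u i = 0") (auto simp: powr_numeral)
              then show "(w \<bullet> u i)\<^sup>2 \<le> 1 / m" using Qi[OF i] Q by simp
            qed
            also have "\<dots> = 1" using m by (simp add: m_def)
            finally show False using False by (simp add: power_le_one_iff abs_square_le_1)
          qed
          have "- (\<Sum>i\<in>?I. \<beta> i * \<xi> i y) \<le> (\<Sum>i\<in>?I. C0 * (1 + \<bar>w \<bullet> u i\<bar> powr q i))"
            unfolding sum_negf[symmetric]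
          proof (rule sum_mono)
            fix i assume i: "i \<in> ?I"
            show "- (\<beta> i * \<xi> i y) \<le> C0 * (1 + \<bar>w \<bullet> u i\<bar> powr q i)"
            proof (cases "q i > 1")
              case True
              have "\<bar>w \<bullet> u i\<bar> \<le> 1 + \<bar>w \<bullet> u i\<bar> powr q i"
              proof (cases "\<bar>w \<bullet> u i\<bar> \<le> 1")
                case False
                then have "\<bar>w \<bullet> u i\<bar> powr 1 \<le> \<bar>w \<bullet> u i\<bar> powr q i" using True by (intro powr_mono) auto
                then show ?thesis by simp
              qed (use powr_ge_zero in \<open>simp add: add_increasing2\<close>)
              then have "\<bar>b \<bullet> u i\<bar> * \<bar>w \<bullet> u i\<bar> \<le> C0 * (1 + \<bar>w \<bullet> u i\<bar> powr q i)"
                using bi[OF i] C0 by (intro mult_mono) auto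
              moreover have "- ((b \<bullet> u i) * (w \<bullet> u i)) \<le> \<bar>b \<bullet> u i\<bar> * \<bar>w \<bullet> u i\<bar>"
                by (metis abs_ge_minus_self abs_mult)
              ultimately show ?thesis using True by (simp add: \<beta>w[OF i])
            next
              case False
              then show ?thesis using C0 by (simp add: \<beta>w[OF i])
            qed
          qed
          also have "\<dots> = C0 * (m + Q)" by (simp add: sum.distrib sum_distrib_left[symmetric] Q_def m_def)
          also have "\<dots> \<le> C0 * (m * (m * Q) + Q)"
            using C0 mult_left_mono[OF \<open>1 \<le> m * Q\<close>, of m] m by (intro mult_left_mono) auto
          finally have "1 - (\<Sum>i\<in>?I. \<beta> i * \<xi> i y) \<le> m * Q + C0 * (m * (m * Q) + Q)"
            using \<open>1 \<le> m * Q\<close> by linarith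
          also have "\<dots> = (m + C0 * (m\<^sup>2 + 1)) * Q" by (simp add: algebra_simps power2_eq_square)
          also have "\<dots> \<le> C * (L * \<theta> y)" using C_ge Q\<theta> Q0 C0 by (intro mult_mono) auto
          finally show ?thesis using le1 by (simp add: mult.assoc)
        qed
      qed
    qed
  qed
qed

end

section \<open>Homogeneous norms\<close>

context homogeneous_group
begin

lemma norm_Log_dil_ge:
  assumes "l \<ge> 1" shows "l * norm (Log x) \<le> norm (Log (dil l x))"
proof (rule power2_le_imp_le)
  have "(l * norm (Log x))\<^sup>2 = (\<Sum>i = 1..DIM('v). l\<^sup>2 * (Log x \<bullet> u i)\<^sup>2)"
    by (simp add: power_mult_distrib norm_sq_expand sum_distrib_left)
  also have "\<dots> \<le> (\<Sum>i = 1..DIM('v). (Log (dil l x) \<bullet> u i)\<^sup>2)"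
  proof (rule sum_mono)
    fix i assume i: "i \<in> {1..DIM('v)}"
    have "l powr 1 \<le> l powr d i" using assms d_ge[OF i] by (intro powr_mono) auto
    then have "l\<^sup>2 \<le> (l powr d i)\<^sup>2" using assms by (intro power_mono) auto
    then show "l\<^sup>2 * (Log x \<bullet> u i)\<^sup>2 \<le> (Log (dil l x) \<bullet> u i)\<^sup>2"
      by (simp add: Log_dil_inner[OF i] power_mult_distrib mult_right_mono)
  qed
  finally show "(l * norm (Log x))\<^sup>2 \<le> (norm (Log (dil l x)))\<^sup>2" by (simp add: norm_sq_expand)
qed simp

lemma norm_Log_dil_le:
  assumes "0 < l" "l \<le> 1" shows "norm (Log (dil l x)) \<le> l * norm (Log x)"
proof -
  have "(1 / l) * norm (Log (dil l x)) \<le> norm (Log (dil (1 / l) (dil l x)))"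
    using assms by (intro norm_Log_dil_ge) auto
  then show ?thesis using assms by (simp add: dil_dil field_simps)
qed

text \<open>Homogeneous polar coordinates. At least linear growth of \<open>Log\<close> under
  dilation makes the norm at most \<open>1\<close> at the factor \<open>a\<close> and at least
  \<open>1\<close> at \<open>b\<close>; the intermediate value theorem does the rest.\<close>

lemma exists_unit_rescaling:
  assumes "x \<noteq> \<one>"
  obtains l where "l > 0" "norm (Log (dil l x)) = 1"
proof -
  define n where "n = norm (Log x)"
  have n: "n > 0" using assms by (simp add: n_def Log_eq_0_iff)
  define a where "a = 1 / max 1 n"
  define b where "b = max 1 (1 / n)"
  have a: "0 < a" "a \<le> 1" "a * n \<le> 1" using n by (auto simp: a_def field_simps max_def)
  have b: "b \<ge> 1" "b * n \<ge> 1" using n by (auto simp: b_def field_simps max_def)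
  have "continuous_on {a..b} (\<lambda>l. norm (Log (dil l x)))"
    unfolding dilation_def Log_Exp using a by (intro continuous_intros) auto
  moreover have "norm (Log (dil a x)) \<le> 1" using norm_Log_dil_le[OF a(1,2), of x] a(3) n_def by simp
  moreover have "1 \<le> norm (Log (dil b x))" using norm_Log_dil_ge[OF b(1), of x] b(2) n_def by simp
  ultimately obtain l where "a \<le> l" "l \<le> b" "norm (Log (dil l x)) = 1"
    using IVT'[of "\<lambda>l. norm (Log (dil l x))" a 1 b] a b by auto
  then show ?thesis using a by (intro that[of l]) auto
qed

end

locale normed_homogeneous_group = homogeneous_group G Exp u d
  for G :: "('g::{second_countable_topology, t2_space}) monoid" (structure)
  and Exp :: "'v::euclidean_space \<Rightarrow> 'g"
  and u :: "nat \<Rightarrow> 'v"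
  and d :: "nat \<Rightarrow> real" +
  fixes N :: "'g \<Rightarrow> real"
  assumes norm_N: "subadditive_homogeneous_norm G Exp u d N"
begin

lemma continuous_N: "continuous_on UNIV N"
  and N_nonneg: "N x \<ge> 0"
  and N_eq_0_iff: "N x = 0 \<longleftrightarrow> x = \<one>"
  and N_dil: "l > 0 \<Longrightarrow> N (dil l x) = l * N x"
  and N_mult: "N (x \<otimes> y) \<le> N x + N y"
  using norm_N unfolding subadditive_homogeneous_norm_def by blast+

lemma N_one [simp]: "N \<one> = 0"
  by (simp add: N_eq_0_iff)

lemma continuous_on_N [continuous_intros]: "continuous_on S f \<Longrightarrow> continuous_on S (\<lambda>x. N (f x))"
  using continuous_on_compose2[OF continuous_N] by blast

lemma N_lower_sphere:
  obtains c where "c > 0" "\<And>x. norm (Log x) = 1 \<Longrightarrow> N x \<ge> c"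
proof -
  have c: "compact (sphere (0::'v) 1)" "sphere (0::'v) 1 \<noteq> {}" by auto
  have "continuous_on (sphere 0 1) (\<lambda>v. N (Exp v))"
    by (intro continuous_on_N continuous_on_subset[OF continuous_Exp subset_UNIV])
  then obtain v where v: "v \<in> sphere 0 1" "\<And>w. w \<in> sphere 0 1 \<Longrightarrow> N (Exp v) \<le> N (Exp w)"
    using continuous_attains_inf[OF c] by blast
  have "Exp v \<noteq> \<one>" using v(1) Log_Exp[of v] Log_one by force
  then have "N (Exp v) > 0" using N_nonneg[of "Exp v"] N_eq_0_iff[of "Exp v"] by linarith
  moreover have "N x \<ge> N (Exp v)" if "norm (Log x) = 1" for x using v(2)[of "Log x"] that by simp
  ultimately show ?thesis using that by blast
qed

lemma N_upper_ball:
  obtains C where "C > 0" "\<And>x. norm (Log x) \<le> 1 \<Longrightarrow> N x \<le> C" "\<And>x. norm (Log x) \<le> 1 \<Longrightarrow> N (inv x) \<le> C"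
proof -
  have "continuous_on (cball 0 1) (\<lambda>v. N (Exp v) + N (inv (Exp v)))"
    by (intro continuous_intros continuous_on_subset[OF continuous_Exp subset_UNIV])
  then have "\<exists>v\<in>cball 0 1. \<forall>w\<in>cball 0 1. N (Exp w) + N (inv (Exp w)) \<le> N (Exp v) + N (inv (Exp v))"
    by (rule continuous_attains_sup[rotated 2]) auto
  then obtain v where "\<forall>w\<in>cball 0 1. N (Exp w) + N (inv (Exp w)) \<le> N (Exp v) + N (inv (Exp v))"
    by blast
  note v = bspec[OF this]
  define C where "C = 1 + (N (Exp v) + N (inv (Exp v)))"
  have "N x + N (inv x) \<le> C" if "norm (Log x) \<le> 1" for x using v[of "Log x"] that by (simp add: C_def)
  then have "N x \<le> C" "N (inv x) \<le> C" if "norm (Log x) \<le> 1" for x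
    using that N_nonneg[of x] N_nonneg[of "inv x"] by (smt (verit))+
  moreover have "C > 0" using N_nonneg[of "Exp v"] N_nonneg[of "inv (Exp v)"] by (simp add: C_def)
  ultimately show ?thesis using that by blast
qed

text \<open>Substitute for symmetry of \<open>N\<close>. Both sides scale alike under dilation, so
  it is enough to compare them on the compact unit sphere of the chart.\<close>

lemma N_inv_le:
  obtains C where "C \<ge> 1" "\<And>x. N (inv x) \<le> C * N x"
proof -
  obtain c where c: "c > 0" "\<And>x. norm (Log x) = 1 \<Longrightarrow> N x \<ge> c" using N_lower_sphere by blast
  obtain C where C: "C > 0" "\<And>x. norm (Log x) \<le> 1 \<Longrightarrow> N (inv x) \<le> C" using N_upper_ball by metis
  show ?thesis
  proof (rule that[of "max 1 (C / c)"])
    fix x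
    show "N (inv x) \<le> max 1 (C / c) * N x"
    proof (cases "x = \<one>")
      case False
      then obtain l where l: "l > 0" "norm (Log (dil l x)) = 1" using exists_unit_rescaling by blast
      have "l * N (inv x) \<le> C" using C(2)[of "dil l x"] l by (simp add: dil_inv[symmetric] N_dil)
      also have "C = C / c * c" using c by simp
      also have "\<dots> \<le> C / c * (l * N x)"
        using c(2)[OF l(2)] C(1) c(1) l(1) by (intro mult_left_mono) (auto simp: N_dil)
      finally have "l * N (inv x) \<le> l * (C / c * N x)" by (simp add: algebra_simps)
      then have "N (inv x) \<le> C / c * N x" by (rule mult_left_le_imp_le[OF _ l(1)])
      also have "\<dots> \<le> max 1 (C / c) * N x" using N_nonneg by (intro mult_right_mono) auto
      finally show ?thesis .
    qed simp
  qed simp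
qed

text \<open>Let the dilation by \<open>l\<close> move \<open>x\<close> to the unit sphere, so that
  \<open>c \<le> l * N x\<close>. If \<open>N x \<le> c\<close>, this forces
  \<open>l \<ge> 1\<close>, where \<open>Log\<close> grows at least linearly in \<open>l\<close>.
  The estimate links small values of \<open>N\<close> to the topology of the group.\<close>

lemma norm_Log_le_N:
  obtains c where "c > 0" "\<And>x. N x \<le> c \<Longrightarrow> norm (Log x) \<le> N x / c"
proof -
  obtain c where c: "c > 0" "\<And>x. norm (Log x) = 1 \<Longrightarrow> N x \<ge> c" using N_lower_sphere by blast
  have "norm (Log x) \<le> N x / c" if "N x \<le> c" for x
  proof (cases "x = \<one>")
    case False
    then obtain l where l: "l > 0" "norm (Log (dil l x)) = 1" using exists_unit_rescaling by blast
    have lc: "c \<le> l * N x" using c(2)[OF l(2)] l(1) by (simp add: N_dil)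
    also have "\<dots> \<le> l * c" using that l by simp
    finally have "1 \<le> l" using c by simp
    then have "l * norm (Log x) \<le> 1" using norm_Log_dil_ge[of l x] l by simp
    then have "c * (l * norm (Log x)) \<le> l * N x" using lc c(1) mult_left_le[of "l * norm (Log x)" c] by linarith
    then have "l * (c * norm (Log x)) \<le> l * N x" by (simp add: algebra_simps)
    then show ?thesis using l(1) c(1) by (simp add: field_simps)
  qed (simp add: Log_one)
  then show ?thesis using c that by blast
qed

text \<open>A small ball lies in the \<open>Exp\<close> image of a compact ball, and dilations carry
  it onto the others.\<close>

lemma compact_N_ball: "compact {x. N x \<le> R}"
proof -
  obtain c where c: "c > 0" "\<And>x. N x \<le> c \<Longrightarrow> norm (Log x) \<le> N x / c" using norm_Log_le_N by blast
  have closed: "closed {x. N x \<le> r}" for r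
    by (intro closed_Collect_le continuous_N continuous_on_const)
  have "{x. N x \<le> c} \<subseteq> Exp ` cball 0 1"
  proof
    fix x assume "x \<in> {x. N x \<le> c}"
    then have "norm (Log x) \<le> N x / c" "N x / c \<le> 1" using c by auto
    then show "x \<in> Exp ` cball 0 1" by (intro image_eqI[of _ _ "Log x"]) auto
  qed
  moreover have "compact (Exp ` cball 0 1)"
    by (rule compact_continuous_image[OF continuous_on_subset[OF continuous_Exp subset_UNIV] compact_cball])
  ultimately have "compact {x. N x \<le> c}"
    using closed compact_Int_closed by (metis inf.absorb_iff2)
  then have K: "compact (dil (max 1 R / c) ` {x. N x \<le> c})"
    by (rule compact_continuous_image[rotated]) (intro continuous_intros)
  have "{x. N x \<le> R} \<subseteq> dil (max 1 R / c) ` {x. N x \<le> c}"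
  proof
    fix x assume "x \<in> {x. N x \<le> R}"
    then have "c * N x \<le> c * max 1 R" using c by simp
    then have "N (dil (c / max 1 R) x) \<le> c" using c by (subst N_dil) (auto simp: field_simps)
    moreover have "x = dil (max 1 R / c) (dil (c / max 1 R) x)" using c by (subst dil_dil) auto
    ultimately show "x \<in> dil (max 1 R / c) ` {x. N x \<le> c}" by blast
  qed
  then show ?thesis using K closed compact_Int_closed by (metis inf.absorb_iff2)
qed

text \<open>The symmetrised \<open>group_dist\<close>. By \<open>N_inv_le\<close> it is at most a
  constant times \<open>group_dist\<close>, so it yields the same Skorokhod topology.\<close>

definition rho :: "'g \<Rightarrow> 'g \<Rightarrow> real" where
  "rho x y = N (inv x \<otimes> y) + N (inv y \<otimes> x)"

lemma continuous_on_rho [continuous_intros]: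
  "continuous_on S f \<Longrightarrow> continuous_on S g \<Longrightarrow> continuous_on S (\<lambda>x. rho (f x) (g x))"
  unfolding rho_def by (intro continuous_intros)

lemma group_dist_triangle: "group_dist G N x z \<le> group_dist G N x y + group_dist G N y z"
proof -
  have "y \<otimes> (inv y \<otimes> z) = z" by (simp add: m_assoc[symmetric])
  then have "inv x \<otimes> z = (inv x \<otimes> y) \<otimes> (inv y \<otimes> z)" by (simp add: m_assoc)
  then show ?thesis unfolding group_dist_def by (metis N_mult)
qed

lemma rho_group_dist: "rho x y = group_dist G N x y + group_dist G N y x"
  by (simp add: rho_def group_dist_def)

sublocale paths: metrised_paths G rho
proof (rule metrised_paths.intro)
  show "Metric_space UNIV rho"
  proof
    fix x y z :: 'g
    show "0 \<le> rho x y" by (simp add: rho_def N_nonneg)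
    show "rho x y = rho y x" by (simp add: rho_def)
    show "rho x z \<le> rho x y + rho y z"
      using group_dist_triangle[of x z y] group_dist_triangle[of z x y] by (simp add: rho_group_dist)
    have "inv x \<otimes> y = \<one> \<longleftrightarrow> x = y"
      by (metis UNIV_I carrier_UNIV inv_closed inv_equality inv_inv l_inv)
    then show "rho x y = 0 \<longleftrightarrow> x = y"
      unfolding rho_def using N_nonneg[of "inv x \<otimes> y"] N_nonneg[of "inv y \<otimes> x"] N_eq_0_iff[of "inv x \<otimes> y"]
      by (auto simp: add_nonneg_eq_0_iff)
  qed
  fix W :: "'g set"
  show "open W \<longleftrightarrow> (\<forall>x\<in>W. \<exists>r>0. \<forall>y. rho x y < r \<longrightarrow> y \<in> W)"
  proof
    assume W: "open W"
    obtain c where c: "c > 0" "\<And>x. N x \<le> c \<Longrightarrow> norm (Log x) \<le> N x / c" using norm_Log_le_N by blast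
    show "\<forall>x\<in>W. \<exists>r>0. \<forall>y. rho x y < r \<longrightarrow> y \<in> W"
    proof
      fix x assume x: "x \<in> W"
      have "open ((\<lambda>v. x \<otimes> Exp v) -` W)"
        by (intro open_vimage W continuous_intros continuous_Exp)
      moreover have "0 \<in> (\<lambda>v. x \<otimes> Exp v) -` W" using x by (simp add: Exp_0)
      ultimately obtain e where e0: "e > 0" "ball 0 e \<subseteq> (\<lambda>v. x \<otimes> Exp v) -` W"
        using open_contains_ball by blast
      have e: "e > 0" "\<And>v. norm v < e \<Longrightarrow> x \<otimes> Exp v \<in> W"
        using e0(1) subsetD[OF e0(2)] by simp_all
      show "\<exists>r>0. \<forall>y. rho x y < r \<longrightarrow> y \<in> W"
      proof (intro exI[of _ "min c (c * e)"] conjI allI impI)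
        show "0 < min c (c * e)" using c e by simp
        fix y assume "rho x y < min c (c * e)"
        then have "N (inv x \<otimes> y) < min c (c * e)" using N_nonneg[of "inv y \<otimes> x"] by (simp add: rho_def)
        then have "norm (Log (inv x \<otimes> y)) \<le> N (inv x \<otimes> y) / c" "N (inv x \<otimes> y) / c < e"
          using c by (auto simp: divide_less_eq mult.commute)
        then have "norm (Log (inv x \<otimes> y)) < e" by linarith
        then have "x \<otimes> Exp (Log (inv x \<otimes> y)) \<in> W" by (rule e(2))
        then show "y \<in> W" by (simp add: m_assoc[symmetric])
      qed
    qed
  next
    assume *: "\<forall>x\<in>W. \<exists>r>0. \<forall>y. rho x y < r \<longrightarrow> y \<in> W"
    show "open W"
      unfolding open_subopen[of W]
    proof
      fix x assume "x \<in> W"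
      then obtain r where r: "r > 0" "\<forall>y. rho x y < r \<longrightarrow> y \<in> W" using * by blast
      have "open {y. rho x y < r}" by (intro open_Collect_less continuous_intros continuous_on_id)
      moreover have "rho x x < r" using r by (simp add: rho_def)
      ultimately show "\<exists>T. open T \<and> x \<in> T \<and> T \<subseteq> W" using r(2) by blast
    qed
  qed
qed

lemma skorokhod_ball_le_mball:
  assumes "r > 0"
  obtains s where "s > 0" "\<And>x. x \<in> cadlag_paths G \<Longrightarrow> skorokhod_ball G N x s \<subseteq> paths.sk.mball x r"
proof -
  obtain C where C: "C \<ge> 1" "\<And>x. N (inv x) \<le> C * N x" using N_inv_le by blast
  have C1: "1 + C > 0" using C(1) by simp
  \<comment> \<open>\<open>rho\<close> is at most \<open>1 + C\<close> times
    \<open>group_dist\<close>; the factor \<open>1 / 2\<close> turns the non-strict closeness into a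
    distance strictly below \<open>r\<close>.\<close>
  define s where "s = r / 2 / (1 + C)"
  have "(1 + C) * s = r / 2"
    unfolding s_def using C1 by (metis less_irrefl nonzero_mult_div_cancel_left times_divide_eq_right)
  then have s: "s > 0" "(1 + C) * s < r" using assms C1 by (simp_all add: s_def)
  show ?thesis
  proof (rule that[OF s(1)], rule subsetI)
    fix x y assume x: "x \<in> cadlag_paths G" and "y \<in> skorokhod_ball G N x s"
    then obtain l where y: "y \<in> cadlag_paths G" and l: "l \<in> time_changes"
      "\<And>t. t \<in> {0..1} \<Longrightarrow> \<bar>l t - t\<bar> < s \<and> group_dist G N (x t) (y (l t)) < s"
      unfolding skorokhod_ball_def by blast
    have "rho a b \<le> (1 + C) * group_dist G N a b" for a b
      using C(2)[of "inv a \<otimes> b"] by (simp add: rho_def group_dist_def inv_mult_group algebra_simps)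
    then have "rho (x t) (y (l t)) \<le> (1 + C) * s" if "t \<in> {0..1}" for t
      using l(2)[OF that] C(1) mult_left_mono[of "group_dist G N (x t) (y (l t))" s "1 + C"]
      by (smt (verit))
    moreover have "\<bar>l t - t\<bar> \<le> (1 + C) * s" if "t \<in> {0..1}" for t
      using l(2)[OF that] C(1) s(1) by (simp add: algebra_simps) (smt (verit) mult_pos_pos)
    ultimately have "paths.sk_close x y ((1 + C) * s)"
      unfolding paths.sk_close_def using l(1) by (intro bexI[of _ l]) auto
    then have "paths.sk_dist x y \<le> (1 + C) * s" using s(1) C(1) by (intro paths.sk_dist_le) auto
    then show "y \<in> paths.sk.mball x r" using x y s by simp
  qed
qed

text \<open>The radius is capped at \<open>1\<close>, where \<open>sk_dist\<close> is truncated: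
  only a distance below \<open>1\<close> yields a time change.\<close>

lemma mball_le_skorokhod_ball:
  assumes "r > 0"
  shows "paths.sk.mball x (min r 1) \<subseteq> skorokhod_ball G N x r"
proof
  fix y assume "y \<in> paths.sk.mball x (min r 1)"
  then have y: "y \<in> cadlag_paths G" and "paths.sk_dist x y < min r 1" by auto
  then obtain s where s: "s < min r 1" "paths.sk_close x y s"
    using paths.sk_dist_less[of x y "min r 1"] by auto
  then obtain l where l: "l \<in> time_changes"
    "\<And>t. t \<in> {0..1} \<Longrightarrow> \<bar>l t - t\<bar> \<le> s \<and> rho (x t) (y (l t)) \<le> s"
    unfolding paths.sk_close_def by blast
  have "group_dist G N (x t) (y (l t)) \<le> rho (x t) (y (l t))" for t
    by (simp add: rho_group_dist group_dist_def N_nonneg)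
  then have "\<bar>l t - t\<bar> < r \<and> group_dist G N (x t) (y (l t)) < r" if "t \<in> {0..1}" for t
    using l(2)[OF that] s(1) by (meson le_less_trans min_less_iff_conj order_trans)
  then show "y \<in> skorokhod_ball G N x r" unfolding skorokhod_ball_def using y l(1) by blast
qed

lemma skorokhod_topology_eq: "skorokhod_topology G N = paths.sk.mtopology"
  unfolding topology_eq openin_skorokhod_topology paths.sk.openin_mtopology
proof (intro allI iffI; elim conjE; intro conjI)
  fix W assume W: "W \<subseteq> cadlag_paths G"
  show "\<forall>x. x \<in> W \<longrightarrow> (\<exists>r>0. paths.sk.mball x r \<subseteq> W)"
    if *: "\<forall>x\<in>W. \<exists>r>0. skorokhod_ball G N x r \<subseteq> W"
  proof (intro allI impI)
    fix x assume "x \<in> W"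
    then obtain r where "r > 0" "skorokhod_ball G N x r \<subseteq> W" using * by blast
    then show "\<exists>r>0. paths.sk.mball x r \<subseteq> W"
      using mball_le_skorokhod_ball[of r x] by (intro exI[of _ "min r 1"]) auto
  qed
  show "\<forall>x\<in>W. \<exists>r>0. skorokhod_ball G N x r \<subseteq> W"
    if *: "\<forall>x. x \<in> W \<longrightarrow> (\<exists>r>0. paths.sk.mball x r \<subseteq> W)"
  proof
    fix x assume x: "x \<in> W"
    then obtain r where r: "r > 0" "paths.sk.mball x r \<subseteq> W" using * by blast
    obtain s where "s > 0" "\<And>x. x \<in> cadlag_paths G \<Longrightarrow> skorokhod_ball G N x s \<subseteq> paths.sk.mball x r"
      using skorokhod_ball_le_mball[OF r(1)] by blast
    then show "\<exists>r>0. skorokhod_ball G N x r \<subseteq> W" using r(2) W x by blast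
  qed
qed

lemma dbump_less_1:
  obtains C where "C > 0"
    "\<And>l x. l > 0 \<Longrightarrow> dbump l x < 1 \<Longrightarrow> N x \<le> C / l"
    "\<And>l x. l > 0 \<Longrightarrow> dbump l x < 1 \<Longrightarrow> N (inv x) \<le> C / l"
proof -
  obtain C where C: "C > 0" "\<And>x. norm (Log x) \<le> 1 \<Longrightarrow> N x \<le> C" "\<And>x. norm (Log x) \<le> 1 \<Longrightarrow> N (inv x) \<le> C"
    using N_upper_ball by blast
  have "N x \<le> C / l" "N (inv x) \<le> C / l" if "l > 0" "dbump l x < 1" for l x
  proof -
    have "norm (Log (dil l x)) \<le> 1" using that(2) dbump_eq_1_iff[of l x] by linarith
    from C(2)[OF this] C(3)[OF this] that(1) show "N x \<le> C / l" "N (inv x) \<le> C / l"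
      by (simp_all add: N_dil dil_inv[symmetric] field_simps)
  qed
  then show ?thesis using C(1) that by blast
qed

end

section \<open>The chain of exits from a dilated ball\<close>

locale iid_steps = prob_space M
  for M :: "'w measure" +
  fixes X :: "nat \<Rightarrow> 'w \<Rightarrow> 'g::{second_countable_topology, t2_space}" and n :: nat
  assumes indep: "indep_vars (\<lambda>_. borel) X {1..n}"
    and ident: "k \<in> {1..n} \<Longrightarrow> distr M borel (X k) = distr M borel (X 1)"
begin

lemma X_measurable: "k \<in> {1..n} \<Longrightarrow> X k \<in> borel_measurable M"
  using indep unfolding indep_vars_def by blast

lemma history_measurable:
  "A \<subseteq> {1..n} \<Longrightarrow> (\<lambda>\<omega>. restrict (\<lambda>i. X i \<omega>) A) \<in> measurable M (PiM A (\<lambda>_. borel))"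
  using X_measurable by (intro measurable_restrict) auto

lemma indep_histories:
  assumes "A \<inter> B = {}" "A \<subseteq> {1..n}" "B \<subseteq> {1..n}"
    and F: "F \<in> measurable (PiM A (\<lambda>_. borel)) S" and H: "H \<in> measurable (PiM B (\<lambda>_. borel)) T"
  shows "indep_var S (\<lambda>\<omega>. F (restrict (\<lambda>i. X i \<omega>) A)) T (\<lambda>\<omega>. H (restrict (\<lambda>i. X i \<omega>) B))"
  using indep_var_compose[OF indep_var_restrict[OF indep assms(1-3)] F H] by (simp add: o_def)

text \<open>Plays the role of conditioning on the past. The history on \<open>A\<close> and step
  \<open>k\<close> are independent, so their joint law is a product and the step can be integrated
  with the history held fixed.\<close>

lemma nn_integral_next_step:
  assumes A: "A \<subseteq> {1..n}" and k: "k \<in> {1..n}" "k \<notin> A"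
    and F: "F \<in> measurable (PiM A (\<lambda>_. borel)) S"
    and g [measurable]: "g \<in> borel_measurable (S \<Otimes>\<^sub>M borel)"
    and a [measurable]: "a \<in> borel_measurable S"
    and le: "\<And>s. s \<in> space S \<Longrightarrow> (\<integral>\<^sup>+y. g (s, y) \<partial>distr M borel (X 1)) \<le> a s"
  shows "(\<integral>\<^sup>+\<omega>. g (F (restrict (\<lambda>i. X i \<omega>) A), X k \<omega>) \<partial>M) \<le> (\<integral>\<^sup>+\<omega>. a (F (restrict (\<lambda>i. X i \<omega>) A)) \<partial>M)"
proof -
  let ?PA = "PiM A (\<lambda>_. borel :: 'g measure)" and ?PB = "PiM {k} (\<lambda>_. borel :: 'g measure)"
  let ?Y = "\<lambda>\<omega>. restrict (\<lambda>i. X i \<omega>) A" and ?Z = "\<lambda>\<omega>. restrict (\<lambda>i. X i \<omega>) {k}"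
  have "indep_var ?PA ?Y ?PB ?Z"
    using A k by (intro indep_var_restrict[OF indep]) auto
  then have Y [measurable]: "?Y \<in> measurable M ?PA" and Z [measurable]: "?Z \<in> measurable M ?PB"
    and prod: "distr M ?PA ?Y \<Otimes>\<^sub>M distr M ?PB ?Z = distr M (?PA \<Otimes>\<^sub>M ?PB) (\<lambda>\<omega>. (?Y \<omega>, ?Z \<omega>))"
    using indep_var_distribution_eq by blast+
  have Xk [measurable]: "X k \<in> borel_measurable M" using k by (intro X_measurable)
  have [measurable]: "(\<lambda>h. h k) \<in> measurable ?PB borel" by (rule measurable_component_singleton) simp
  note F [measurable]
  have G [measurable]: "(\<lambda>z. g (F (fst z), snd z k)) \<in> borel_measurable (?PA \<Otimes>\<^sub>M ?PB)" by measurable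
  interpret D: prob_space "distr M ?PB ?Z" by (rule prob_space_distr[OF Z])
  have "(\<integral>\<^sup>+\<omega>. g (F (?Y \<omega>), X k \<omega>) \<partial>M) =
      (\<integral>\<^sup>+z. g (F (fst z), snd z k) \<partial>distr M (?PA \<Otimes>\<^sub>M ?PB) (\<lambda>\<omega>. (?Y \<omega>, ?Z \<omega>)))"
    by (subst nn_integral_distr) (auto intro: G)
  also have "\<dots> = (\<integral>\<^sup>+f. (\<integral>\<^sup>+h. g (F f, h k) \<partial>distr M ?PB ?Z) \<partial>distr M ?PA ?Y)"
    unfolding prod[symmetric] by (subst D.nn_integral_fst[symmetric]) (auto intro: G)
  also have "\<dots> \<le> (\<integral>\<^sup>+f. a (F f) \<partial>distr M ?PA ?Y)"
  proof (rule nn_integral_mono)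
    fix f assume "f \<in> space (distr M ?PA ?Y)"
    then have Ff: "F f \<in> space S" using measurable_space[OF F] by simp
    have "(\<integral>\<^sup>+h. g (F f, h k) \<partial>distr M ?PB ?Z) = (\<integral>\<^sup>+\<omega>. g (F f, X k \<omega>) \<partial>M)"
      using Ff by (subst nn_integral_distr) auto
    also have "\<dots> = (\<integral>\<^sup>+y. g (F f, y) \<partial>distr M borel (X k))"
      using Ff by (subst nn_integral_distr) auto
    finally show "(\<integral>\<^sup>+h. g (F f, h k) \<partial>distr M ?PB ?Z) \<le> a (F f)"
      using le[OF Ff] ident[OF k(1)] by simp
  qed
  also have "\<dots> = (\<integral>\<^sup>+\<omega>. a (F (?Y \<omega>)) \<partial>M)" by (subst nn_integral_distr) auto
  finally show ?thesis .
qed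

lemma prob_ge_le_nn_integral:
  assumes [measurable]: "f \<in> borel_measurable M" and "r > 0"
    and le: "(\<integral>\<^sup>+\<omega>. ennreal (f \<omega>) \<partial>M) \<le> ennreal b" and b: "b \<ge> 0"
  shows "prob {\<omega> \<in> space M. f \<omega> \<ge> r} \<le> b / r"
proof -
  have "emeasure M {\<omega> \<in> space M. f \<omega> \<ge> r} \<le> emeasure M {\<omega> \<in> space M. 1 \<le> ennreal (1 / r) * ennreal (f \<omega>)}"
  proof (rule emeasure_mono)
    show "{\<omega> \<in> space M. f \<omega> \<ge> r} \<subseteq> {\<omega> \<in> space M. 1 \<le> ennreal (1 / r) * ennreal (f \<omega>)}"
      using \<open>r > 0\<close> by (auto simp: ennreal_mult[symmetric] ennreal_1[symmetric] simp del: ennreal_1 intro!: ennreal_leI)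
  qed measurable
  also have "\<dots> \<le> ennreal (1 / r) * (\<integral>\<^sup>+\<omega>. ennreal (f \<omega>) * indicator (space M) \<omega> \<partial>M)"
    by (rule nn_integral_Markov_inequality) measurable
  also have "\<dots> = ennreal (1 / r) * (\<integral>\<^sup>+\<omega>. ennreal (f \<omega>) \<partial>M)"
    by (intro arg_cong2[where f = "(*)"] nn_integral_cong) auto
  also have "\<dots> \<le> ennreal (1 / r) * ennreal b" using le by (rule mult_left_mono) simp
  also have "\<dots> = ennreal (b / r)" using \<open>r > 0\<close> b by (simp add: ennreal_mult[symmetric])
  finally show ?thesis using \<open>r > 0\<close> b by (simp add: emeasure_eq_measure)
qed

end

section \<open>The restart chain along a fixed sequence of steps\<close>

context normed_homogeneous_group
begin

type_synonym 'a chain_state = "'a \<times> nat \<times> nat \<times> nat"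

text \<open>
  The state records the displacement since the last reset, the number of resets, the number of
  steps since the last reset, and the number of resets that came at most \<open>L\<close> steps after the
  previous one. A reset happens when the displacement leaves the unit ball dilated by \<open>1 / l\<close>.
\<close>

definition chain_step :: "real \<Rightarrow> nat \<Rightarrow> 'g chain_state \<Rightarrow> 'g \<Rightarrow> 'g chain_state" where
  "chain_step l L = (\<lambda>(D, c, a, s) y.
     if dbump l (D \<otimes> y) = 1 then (\<one>, Suc c, 0, if a < L then Suc s else s)
     else (D \<otimes> y, c, Suc a, s))"

text \<open>The offset \<open>k\<close> starts a fresh chain after step \<open>k\<close>, for use on
  blocks of the walk and on the window before time \<open>1\<close>.\<close>

primrec chain :: "real \<Rightarrow> nat \<Rightarrow> (nat \<Rightarrow> 'g) \<Rightarrow> nat \<Rightarrow> nat \<Rightarrow> 'g chain_state" where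
  "chain l L x k 0 = (\<one>, 0, 0, 0)"
| "chain l L x k (Suc j) = chain_step l L (chain l L x k j) (x (Suc (k + j)))"

definition disp where "disp l L x k j = fst (chain l L x k j)"
definition resets where "resets l L x k j = fst (snd (chain l L x k j))"
definition age where "age l L x k j = fst (snd (snd (chain l L x k j)))"
definition shorts where "shorts l L x k j = snd (snd (snd (chain l L x k j)))"

lemma chain_0 [simp]:
  "disp l L x k 0 = \<one>" "resets l L x k 0 = 0" "age l L x k 0 = 0" "shorts l L x k 0 = 0"
  by (simp_all add: disp_def resets_def age_def shorts_def)

lemma chain_Suc:
  "disp l L x k (Suc j) = (if dbump l (disp l L x k j \<otimes> x (Suc (k + j))) = 1 then \<one>
     else disp l L x k j \<otimes> x (Suc (k + j)))"
  "resets l L x k (Suc j) = (if dbump l (disp l L x k j \<otimes> x (Suc (k + j))) = 1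
     then Suc (resets l L x k j) else resets l L x k j)"
  "age l L x k (Suc j) = (if dbump l (disp l L x k j \<otimes> x (Suc (k + j))) = 1
     then 0 else Suc (age l L x k j))"
  "shorts l L x k (Suc j) = (if dbump l (disp l L x k j \<otimes> x (Suc (k + j))) = 1 \<and> age l L x k j < L
     then Suc (shorts l L x k j) else shorts l L x k j)"
  by (auto simp: disp_def resets_def age_def shorts_def chain_step_def split: prod.split)

lemma resets_mono: "i \<le> j \<Longrightarrow> resets l L x k i \<le> resets l L x k j"
  by (rule lift_Suc_mono_le[of "resets l L x k"]) (simp_all add: chain_Suc)

lemma shorts_mono: "i \<le> j \<Longrightarrow> shorts l L x k i \<le> shorts l L x k j"
  by (rule lift_Suc_mono_le[of "shorts l L x k"]) (simp_all add: chain_Suc)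

lemma resets_le: "resets l L x k j \<le> j"
  by (induction j) (simp_all add: chain_Suc)

lemma dbump_disp: "dbump l (disp l L x k j) < 1"
  using dbump_le_1[of l] by (cases j) (auto simp: chain_Suc dbump_one less_le)

lemma disp_no_reset:
  assumes "i \<le> j" "resets l L x k i = resets l L x k j"
  shows "disp l L x k j =
    disp l L x k i \<otimes> (inv (partial_product G x (k + i)) \<otimes> partial_product G x (k + j))"
  using assms
proof (induction j rule: dec_induct)
  case base
  then show ?case by simp
next
  case (step j)
  have "resets l L x k i \<le> resets l L x k j" using step.hyps(1) by (rule resets_mono)
  moreover have "resets l L x k j \<le> resets l L x k (Suc j)" by (rule resets_mono) simp
  ultimately have eq: "resets l L x k j = resets l L x k (Suc j)" "resets l L x k i = resets l L x k j"
    using step.prems by linarith+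
  then have "disp l L x k (Suc j) = disp l L x k j \<otimes> x (Suc (k + j))"
    by (auto simp: chain_Suc split: if_splits)
  then show ?case using step.IH[OF eq(2)] by (simp add: m_assoc)
qed

text \<open>Without a reset in between, both displacements are taken from the same restarting point
  and both lie in the dilated unit ball. The factor \<open>4\<close> counts the two displacements
  and their inverses.\<close>

lemma N_no_reset:
  obtains C where "C > 0"
    "\<And>l L x k i j. l > 0 \<Longrightarrow> i \<le> j \<Longrightarrow> resets l L x k i = resets l L x k j \<Longrightarrow>
       rho (partial_product G x (k + i)) (partial_product G x (k + j)) \<le> C / l"
proof -
  obtain C where C: "C > 0"
    "\<And>l x. l > 0 \<Longrightarrow> dbump l x < 1 \<Longrightarrow> N x \<le> C / l"
    "\<And>l x. l > 0 \<Longrightarrow> dbump l x < 1 \<Longrightarrow> N (inv x) \<le> C / l"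
    using dbump_less_1 by blast
  show ?thesis
  proof (rule that[of "4 * C"])
    fix l :: real and L :: nat and x k i j
    assume l: "l > 0" and ij: "i \<le> j" "resets l L x k i = resets l L x k j"
    let ?a = "disp l L x k i" and ?b = "disp l L x k j"
    let ?s = "partial_product G x (k + i)" and ?t = "partial_product G x (k + j)"
    have *: "inv ?a \<otimes> ?b = inv ?s \<otimes> ?t"
      using disp_no_reset[OF ij] by (simp add: m_assoc[symmetric])
    then have **: "inv ?b \<otimes> ?a = inv ?t \<otimes> ?s"
      by (metis UNIV_I carrier_UNIV inv_closed inv_inv inv_mult_group)
    have "rho ?s ?t \<le> (N (inv ?a) + N ?b) + (N (inv ?b) + N ?a)"
      unfolding rho_def *[symmetric] **[symmetric] by (intro add_mono N_mult)
    also have "\<dots> \<le> (C / l + C / l) + (C / l + C / l)"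
      using l by (intro add_mono C dbump_disp)
    finally show "rho ?s ?t \<le> 4 * C / l" by simp
  qed (use C in simp)
qed

definition reset_times :: "real \<Rightarrow> nat \<Rightarrow> (nat \<Rightarrow> 'g) \<Rightarrow> nat set" where
  "reset_times l L x = {k. k > 0 \<and> resets l L x 0 k \<noteq> resets l L x 0 (k - 1)}"

lemma age_le:
  assumes "k \<le> j" "k = 0 \<or> k \<in> reset_times l L x"
  shows "age l L x 0 j \<le> j - k"
  using assms(1)
proof (induction j rule: dec_induct)
  case base
  then show ?case using assms(2) by (cases k) (auto simp: reset_times_def chain_Suc split: if_splits)
next
  case (step j)
  then show ?case by (auto simp: chain_Suc)
qed

text \<open>The age just before a reset does not count the resetting step, hence the strict
  inequality. Since the age starts at \<open>0\<close>, the start acts as a reset, and an early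
  first reset is recorded as short too.\<close>

lemma reset_gap:
  assumes "shorts l L x 0 n = 0" "k < k'" "k' \<le> n" "k = 0 \<or> k \<in> reset_times l L x" "k' \<in> reset_times l L x"
  shows "L < k' - k"
proof -
  obtain j where j: "k' = Suc j" using assms(2) by (cases k') auto
  have "shorts l L x 0 (Suc j) = 0" using shorts_mono[of k' n l L x 0] assms(1,3) j by simp
  then have "L \<le> age l L x 0 j"
    using assms(5) by (auto simp: j reset_times_def chain_Suc split: if_splits)
  also have "\<dots> \<le> j - k" using assms j by (intro age_le) auto
  finally show ?thesis using j assms(2) by simp
qed

lemma no_reset_between:
  assumes "i \<le> j" "\<And>k. i < k \<Longrightarrow> k \<le> j \<Longrightarrow> k \<notin> reset_times l L x"
  shows "resets l L x 0 i = resets l L x 0 j"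
  using assms
proof (induction j rule: dec_induct)
  case (step j)
  then have "resets l L x 0 i = resets l L x 0 j" "Suc j \<notin> reset_times l L x" by auto
  then show ?case by (simp add: reset_times_def)
qed simp

section \<open>Measurability of the chain\<close>

lemma chain_restrict:
  "{Suc k..k + j} \<subseteq> A \<Longrightarrow> chain l L (restrict x A) k j = chain l L x k j"
proof (induction j)
  case (Suc j)
  have "{Suc k..k + j} \<subseteq> A" "Suc (k + j) \<in> A" using Suc.prems by auto
  then show ?case using Suc.IH by simp
qed simp

lemma continuous_mult_pair: "continuous_on UNIV (\<lambda>z. fst z \<otimes> snd z)"
  by (intro continuous_intros)

lemma borel_measurable_mult_group [measurable (raw)]:
  assumes "f \<in> borel_measurable M" "g \<in> borel_measurable M"
  shows "(\<lambda>x. f x \<otimes> g x) \<in> borel_measurable M"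
  using borel_measurable_continuous_Pair[OF assms, of "(\<otimes>)"] continuous_mult_pair by simp

lemma borel_measurable_dbump [measurable (raw)]:
  assumes "f \<in> borel_measurable M"
  shows "(\<lambda>x. dbump l (f x)) \<in> borel_measurable M"
  using measurable_compose[OF assms borel_measurable_continuous_onI[OF continuous_dbump]] .

abbreviation state_space :: "'g chain_state measure" where
  "state_space \<equiv> borel \<Otimes>\<^sub>M count_space UNIV \<Otimes>\<^sub>M count_space UNIV \<Otimes>\<^sub>M count_space UNIV"

lemma chain_step_measurable [measurable]:
  "(\<lambda>(s, y). chain_step l L s y) \<in> measurable (state_space \<Otimes>\<^sub>M borel) state_space"
  unfolding chain_step_def case_prod_beta' by measurable

lemma chain_measurable:
  "{Suc k..k + j} \<subseteq> A \<Longrightarrow> (\<lambda>x. chain l L x k j) \<in> measurable (PiM A (\<lambda>_. borel)) state_space"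
proof (induction j)
  case 0
  then show ?case by simp
next
  case (Suc j)
  have "{Suc k..k + j} \<subseteq> A" using Suc.prems by (auto simp: subset_iff)
  then have [measurable]: "(\<lambda>x. chain l L x k j) \<in> measurable (PiM A (\<lambda>_. borel)) state_space"
    by (rule Suc.IH)
  have [measurable]: "(\<lambda>x. x (Suc (k + j))) \<in> measurable (PiM A (\<lambda>_. borel)) borel"
    using Suc.prems by (intro measurable_component_singleton) auto
  have "(\<lambda>x. (\<lambda>(s, y). chain_step l L s y) (chain l L x k j, x (Suc (k + j)))) \<in>
      measurable (PiM A (\<lambda>_. borel)) state_space"
    by measurable
  then show ?case by simp
qed

end

section \<open>Expected number of restarts and probability of short gaps\<close>

locale homogeneous_walk = normed_homogeneous_group G Exp u d N + iid_steps M X n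
  for G :: "('g::{second_countable_topology, t2_space}) monoid" (structure)
  and Exp :: "'v::euclidean_space \<Rightarrow> 'g"
  and u :: "nat \<Rightarrow> 'v"
  and d :: "nat \<Rightarrow> real"
  and N :: "'g \<Rightarrow> real"
  and M :: "'w measure"
  and X :: "nat \<Rightarrow> 'w \<Rightarrow> 'g"
  and n :: nat
begin

definition drift_bound :: "real \<Rightarrow> real \<Rightarrow> bool" where
  "drift_bound l c \<longleftrightarrow> c \<ge> 0 \<and> (\<forall>x. (\<integral>\<omega>. dbump l (x \<otimes> X 1 \<omega>) \<partial>M) \<le> dbump l x + c)"

lemma chain_rv:
  assumes "k + j \<le> n"
  shows "(\<lambda>\<omega>. chain l L (\<lambda>i. X i \<omega>) k j) \<in> measurable M state_space"
proof -
  have A: "{Suc k..k + j} \<subseteq> {1..n}" using assms by auto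
  have "(\<lambda>\<omega>. chain l L (restrict (\<lambda>i. X i \<omega>) {Suc k..k + j}) k j) \<in> measurable M state_space"
    by (rule measurable_compose[OF history_measurable[OF A] chain_measurable]) simp
  then show ?thesis by (simp add: chain_restrict)
qed

text \<open>A supermartingale argument: if one step raises the mean of \<open>\<Psi>\<close> by at
  most \<open>e\<close>, then \<open>j\<close> steps raise it by at most \<open>j * e\<close>. The
  step bound is affine in \<open>dbump\<close> at the tentative displacement because that is the
  function whose mean \<open>drift_bound\<close> controls.\<close>

lemma nn_integral_chain:
  assumes \<Psi>: "\<Psi> \<in> borel_measurable state_space" "\<And>s. \<Psi> s \<ge> 0"
    and drift: "drift_bound l c" and e: "e \<ge> 0"
    and step: "\<And>s y. \<Psi> (chain_step l L s y) \<le> \<alpha> s + \<beta> s * dbump l (fst s \<otimes> y)"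
    and \<beta>: "\<And>s. \<beta> s \<ge> 0"
    and le: "\<And>s. \<alpha> s + \<beta> s * (dbump l (fst s) + c) \<le> \<Psi> s + e"
    and kj: "k + j \<le> n"
  shows "(\<integral>\<^sup>+\<omega>. ennreal (\<Psi> (chain l L (\<lambda>i. X i \<omega>) k j)) \<partial>M) \<le> ennreal (\<Psi> (\<one>, 0, 0, 0) + real j * e)"
  using kj
proof (induction j)
  case 0
  then show ?case by (simp add: emeasure_space_1)
next
  case (Suc j)
  note [measurable] = \<Psi>(1)
  have X1 [measurable]: "X 1 \<in> borel_measurable M" using Suc.prems by (intro X_measurable) auto
  interpret D: prob_space "distr M borel (X 1)" by (rule prob_space_distr) measurable
  let ?A = "{Suc k..k + j}"
  have A: "?A \<subseteq> {1..n}" using Suc.prems by auto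
  have one: "(\<integral>\<^sup>+y. ennreal (\<Psi> (chain_step l L s y)) \<partial>distr M borel (X 1)) \<le> ennreal (\<Psi> s + e)" for s
  proof -
    have int1: "integrable (distr M borel (X 1)) (\<lambda>y. dbump l (fst s \<otimes> y))"
      by (rule D.integrable_const_bound[where B = 1]) (auto simp: dbump_nonneg dbump_le_1)
    have int2: "integrable (distr M borel (X 1)) (\<lambda>y. \<alpha> s)" by (rule D.integrable_const)
    have int: "integrable (distr M borel (X 1)) (\<lambda>y. \<alpha> s + \<beta> s * dbump l (fst s \<otimes> y))"
      by (intro Bochner_Integration.integrable_add integrable_mult_right int1 int2)
    have "(\<integral>\<^sup>+y. ennreal (\<Psi> (chain_step l L s y)) \<partial>distr M borel (X 1)) \<le>
        (\<integral>\<^sup>+y. ennreal (\<alpha> s + \<beta> s * dbump l (fst s \<otimes> y)) \<partial>distr M borel (X 1))"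
      by (intro nn_integral_mono ennreal_leI step)
    also have "\<dots> = ennreal (\<integral>y. \<alpha> s + \<beta> s * dbump l (fst s \<otimes> y) \<partial>distr M borel (X 1))"
      by (intro nn_integral_eq_integral int AE_I2 order_trans[OF \<Psi>(2) step])
    also have "(\<integral>y. \<alpha> s + \<beta> s * dbump l (fst s \<otimes> y) \<partial>distr M borel (X 1)) =
        \<alpha> s + \<beta> s * (\<integral>y. dbump l (fst s \<otimes> y) \<partial>distr M borel (X 1))"
      using D.prob_space by (subst Bochner_Integration.integral_add[OF int2 integrable_mult_right[OF int1]]) simp
    also have "(\<integral>y. dbump l (fst s \<otimes> y) \<partial>distr M borel (X 1)) = (\<integral>\<omega>. dbump l (fst s \<otimes> X 1 \<omega>) \<partial>M)"
      by (rule integral_distr) measurable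
    also have "\<alpha> s + \<beta> s * \<dots> \<le> \<alpha> s + \<beta> s * (dbump l (fst s) + c)"
      using drift \<beta> by (intro add_left_mono mult_left_mono) (auto simp: drift_bound_def)
    also have "\<dots> \<le> \<Psi> s + e" by (rule le)
    finally show ?thesis by (simp add: ennreal_leI)
  qed
  have "(\<integral>\<^sup>+\<omega>. ennreal (\<Psi> (chain l L (\<lambda>i. X i \<omega>) k (Suc j))) \<partial>M) =
      (\<integral>\<^sup>+\<omega>. (\<lambda>(s, y). ennreal (\<Psi> (chain_step l L s y)))
        ((\<lambda>x. chain l L x k j) (restrict (\<lambda>i. X i \<omega>) ?A), X (Suc (k + j)) \<omega>) \<partial>M)"
    by (simp add: chain_restrict)
  also have "\<dots> \<le> (\<integral>\<^sup>+\<omega>. ennreal (\<Psi> ((\<lambda>x. chain l L x k j) (restrict (\<lambda>i. X i \<omega>) ?A)) + e) \<partial>M)"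
  proof (rule nn_integral_next_step[OF A, where S = state_space and a = "\<lambda>s. ennreal (\<Psi> s + e)"])
    show "(\<lambda>x. chain l L x k j) \<in> measurable (PiM ?A (\<lambda>_. borel)) state_space"
      by (rule chain_measurable) simp
    have "(\<lambda>z. ennreal (\<Psi> ((\<lambda>(s, y). chain_step l L s y) z))) \<in> borel_measurable (state_space \<Otimes>\<^sub>M borel)"
      by measurable
    then show "(\<lambda>(s, y). ennreal (\<Psi> (chain_step l L s y))) \<in> borel_measurable (state_space \<Otimes>\<^sub>M borel)"
      by (simp add: case_prod_beta')
  qed (use Suc.prems one in auto)
  also have "\<dots> = (\<integral>\<^sup>+\<omega>. ennreal (\<Psi> (chain l L (\<lambda>i. X i \<omega>) k j)) + ennreal e \<partial>M)"
    using \<Psi>(2) e by (simp add: chain_restrict ennreal_plus)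
  also have "\<dots> = (\<integral>\<^sup>+\<omega>. ennreal (\<Psi> (chain l L (\<lambda>i. X i \<omega>) k j)) \<partial>M) + ennreal e"
    using Suc.prems measurable_compose[OF chain_rv \<Psi>(1)]
    by (subst nn_integral_add) (auto simp: emeasure_space_1)
  also have "\<dots> \<le> ennreal (\<Psi> (\<one>, 0, 0, 0) + real j * e) + ennreal e"
    using Suc by (intro add_right_mono) simp
  also have "\<dots> = ennreal (\<Psi> (\<one>, 0, 0, 0) + real (Suc j) * e)"
    using \<Psi>(2) e by (subst ennreal_plus[symmetric]) (auto simp: algebra_simps)
  finally show ?case .
qed

lemma resets_rv [measurable]:
  "k + j \<le> n \<Longrightarrow> (\<lambda>\<omega>. resets l L (\<lambda>i. X i \<omega>) k j) \<in> measurable M (count_space UNIV)"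
  unfolding resets_def using chain_rv[of k j l L] by measurable

lemma shorts_rv [measurable]:
  "k + j \<le> n \<Longrightarrow> (\<lambda>\<omega>. shorts l L (\<lambda>i. X i \<omega>) k j) \<in> measurable M (count_space UNIV)"
  unfolding shorts_def using chain_rv[of k j l L] by measurable

text \<open>A reset lowers \<open>dbump\<close> from \<open>1\<close> to \<open>0\<close> and raises the count by \<open>1\<close>, so the sum of the two has the drift of \<open>dbump\<close>.\<close>

lemma nn_integral_resets:
  assumes "drift_bound l c" "k + j \<le> n"
  shows "(\<integral>\<^sup>+\<omega>. ennreal (real (resets l L (\<lambda>i. X i \<omega>) k j)) \<partial>M) \<le> ennreal (real j * c)"
proof -
  let ?\<Psi> = "\<lambda>s :: 'g chain_state. real (fst (snd s)) + dbump l (fst s)"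
  have "(\<integral>\<^sup>+\<omega>. ennreal (real (resets l L (\<lambda>i. X i \<omega>) k j)) \<partial>M) \<le>
      (\<integral>\<^sup>+\<omega>. ennreal (?\<Psi> (chain l L (\<lambda>i. X i \<omega>) k j)) \<partial>M)"
    by (intro nn_integral_mono ennreal_leI) (simp add: resets_def dbump_nonneg)
  also have "\<dots> \<le> ennreal (?\<Psi> (\<one>, 0, 0, 0) + real j * c)"
  proof (rule nn_integral_chain[where \<alpha> = "\<lambda>s. real (fst (snd s))" and \<beta> = "\<lambda>_. 1", OF _ _ assms(1)])
    show "?\<Psi> \<in> borel_measurable state_space" by measurable
    show "c \<ge> 0" using assms(1) by (simp add: drift_bound_def)
    show "?\<Psi> (chain_step l L s y) \<le> real (fst (snd s)) + 1 * dbump l (fst s \<otimes> y)" for s y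
      by (auto simp: chain_step_def dbump_one split: prod.split)
  qed (use assms dbump_nonneg in \<open>auto intro: add_nonneg_nonneg\<close>)
  finally show ?thesis by (simp add: dbump_one)
qed

lemma prob_resets:
  assumes "drift_bound l c" "k + j \<le> n"
  shows "prob {\<omega> \<in> space M. resets l L (\<lambda>i. X i \<omega>) k j \<noteq> 0} \<le> real j * c"
proof -
  have "prob {\<omega> \<in> space M. real (resets l L (\<lambda>i. X i \<omega>) k j) \<ge> 1} \<le> real j * c / 1"
    using assms nn_integral_resets[OF assms] by (intro prob_ge_le_nn_integral) (auto simp: drift_bound_def)
  moreover have "{\<omega> \<in> space M. real (resets l L (\<lambda>i. X i \<omega>) k j) \<ge> 1} =
      {\<omega> \<in> space M. resets l L (\<lambda>i. X i \<omega>) k j \<noteq> 0}" by auto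
  ultimately show ?thesis by simp
qed

text \<open>
  During the \<open>L\<close> steps after a reset, \<open>dbump + c (L - age)\<close> bounds the conditional probability of
  an early reset; the term \<open>c L dbump\<close> pays for renewing this bound at each reset.
\<close>

lemma prob_shorts:
  assumes drift: "drift_bound l c"
  shows "prob {\<omega> \<in> space M. shorts l L (\<lambda>i. X i \<omega>) 0 n \<noteq> 0} \<le> c * real L + real n * (c\<^sup>2 * real L)"
proof -
  have c: "c \<ge> 0" using drift by (simp add: drift_bound_def)
  define \<Psi> where "\<Psi> = (\<lambda>(D :: 'g, r :: nat, a :: nat, s :: nat). real s + (if a < L then dbump l D + c * (real L - real a) else 0)
    + c * real L * dbump l D :: real)"
  define \<alpha> where "\<alpha> = (\<lambda>(D :: 'g, r :: nat, a :: nat, s :: nat). real s + (if a < L then c * (real L - real a - 1) else 0))"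
  define \<beta> where "\<beta> = (\<lambda>(D :: 'g, r :: nat, a :: nat, s :: nat). (if a < L then 1 else 0) + c * real L)"
  have "(\<integral>\<^sup>+\<omega>. ennreal (real (shorts l L (\<lambda>i. X i \<omega>) 0 n)) \<partial>M) \<le>
      (\<integral>\<^sup>+\<omega>. ennreal (\<Psi> (chain l L (\<lambda>i. X i \<omega>) 0 n)) \<partial>M)"
    using c by (intro nn_integral_mono ennreal_leI) (auto simp: shorts_def \<Psi>_def dbump_nonneg split: prod.split)
  also have "\<dots> \<le> ennreal (\<Psi> (\<one>, 0, 0, 0) + real n * (c\<^sup>2 * real L))"
  proof (rule nn_integral_chain[OF _ _ drift, where \<alpha> = \<alpha> and \<beta> = \<beta>])
    show "\<Psi> \<in> borel_measurable state_space"
      unfolding \<Psi>_def case_prod_beta' by measurable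
    show "\<Psi> s \<ge> 0" for s using c by (auto simp: \<Psi>_def dbump_nonneg split: prod.split)
    show "\<beta> s \<ge> 0" for s using c by (auto simp: \<beta>_def split: prod.split)
    \<comment> \<open>The drift \<open>c\<close> of the first \<open>dbump\<close> is cancelled by
      the loss of \<open>c\<close> in \<open>c * (L - age)\<close>; what remains is the drift
      \<open>c\<close> of the second one, multiplied by its weight \<open>c * L\<close>.\<close>
    show "\<alpha> s + \<beta> s * (dbump l (fst s) + c) \<le> \<Psi> s + c\<^sup>2 * real L" for s
      by (cases s) (auto simp: \<alpha>_def \<beta>_def \<Psi>_def algebra_simps power2_eq_square)
    show "\<Psi> (chain_step l L s y) \<le> \<alpha> s + \<beta> s * dbump l (fst s \<otimes> y)" for s y
    proof -
      obtain D r a t where s: "s = (D, r, a, t)" by (cases s)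
      show ?thesis
      proof (cases "dbump l (D \<otimes> y) = 1")
        case True
        show ?thesis
        proof (cases "a < L")
          case True
          \<comment> \<open>After a short reset the potential is \<open>s + 1 + c * L\<close>, and
            the right-hand side exceeds this by exactly the present term.\<close>
          then have "c * (real L - real a - 1) \<ge> 0" using c by (intro mult_nonneg_nonneg) auto
          then show ?thesis using \<open>dbump l (D \<otimes> y) = 1\<close> True
            by (simp add: s chain_step_def \<Psi>_def \<alpha>_def \<beta>_def dbump_one)
        qed (use True c in \<open>auto simp: s chain_step_def \<Psi>_def \<alpha>_def \<beta>_def dbump_one\<close>)
      next
        case False
        show ?thesis
        proof (cases "Suc a < L")
          case True
          then show ?thesis using False
            by (simp add: s chain_step_def \<Psi>_def \<alpha>_def \<beta>_def algebra_simps)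
        next
          case F: False
          have "c * (real L - real a - 1) \<ge> 0" if "a < L" using c that by (intro mult_nonneg_nonneg) auto
          then show ?thesis using False F dbump_nonneg[of l "D \<otimes> y"]
            by (auto simp: s chain_step_def \<Psi>_def \<alpha>_def \<beta>_def algebra_simps)
        qed
      qed
    qed
  qed (use c in auto)
  also have "\<Psi> (\<one>, 0, 0, 0) = c * real L" by (simp add: \<Psi>_def dbump_one)
  finally have le: "(\<integral>\<^sup>+\<omega>. ennreal (real (shorts l L (\<lambda>i. X i \<omega>) 0 n)) \<partial>M) \<le>
      ennreal (c * real L + real n * (c\<^sup>2 * real L))" .
  have "prob {\<omega> \<in> space M. real (shorts l L (\<lambda>i. X i \<omega>) 0 n) \<ge> 1} \<le> (c * real L + real n * (c\<^sup>2 * real L)) / 1"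
    using c by (intro prob_ge_le_nn_integral le) auto
  moreover have "{\<omega> \<in> space M. real (shorts l L (\<lambda>i. X i \<omega>) 0 n) \<ge> 1} =
      {\<omega> \<in> space M. shorts l L (\<lambda>i. X i \<omega>) 0 n \<noteq> 0}" by auto
  ultimately show ?thesis by simp
qed

end

section \<open>Step paths\<close>

lemma sum_nat_increments_le:
  fixes r :: "nat \<Rightarrow> nat"
  assumes "mono r" "\<And>j. j < m \<Longrightarrow> k j \<le> k (Suc j)"
  shows "(\<Sum>j<m. r (k (Suc j)) - r (k j)) \<le> r (k m)"
  using assms(2)
proof (induction m)
  case (Suc m)
  then have "(\<Sum>j<m. r (k (Suc j)) - r (k j)) \<le> r (k m)" by simp
  moreover have "r (k m) \<le> r (k (Suc m))" using assms(1) Suc.prems by (simp add: monoD)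
  ultimately show ?case by simp
qed simp

lemma partial_product_cong:
  "(\<And>i. 1 \<le> i \<Longrightarrow> i \<le> k \<Longrightarrow> x i = y i) \<Longrightarrow> partial_product G x k = partial_product G y k"
  by (induction k) auto

lemma floor_index:
  assumes "t \<in> {0..1}"
  shows "nat \<lfloor>t * real n\<rfloor> \<le> n"
proof -
  have "t * real n \<le> 1 * real n" using assms by (intro mult_right_mono) auto
  then show ?thesis by linarith
qed

lemma partitionsD:
  assumes "ts \<in> partitions a b"
  shows "ts \<noteq> []" "\<And>j. j < length ts \<Longrightarrow> ts ! j \<in> {a..b}" "\<And>i j. i \<le> j \<Longrightarrow> j < length ts \<Longrightarrow> ts ! i \<le> ts ! j"
proof -
  show ne: "ts \<noteq> []" using assms by (simp add: partitions_def)
  have "sorted ts" using assms by (auto simp: partitions_def intro: sorted_wrt_mono_rel[of _ "(<)"])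
  then show mono: "ts ! i \<le> ts ! j" if "i \<le> j" "j < length ts" for i j
    using that by (simp add: sorted_nth_mono)
  show "ts ! j \<in> {a..b}" if "j < length ts" for j
    using assms mono[of 0 j] mono[of j "length ts - 1"] that
    by (auto simp: partitions_def hd_conv_nth last_conv_nth)
qed

context normed_homogeneous_group
begin

definition path_of :: "nat \<Rightarrow> (nat \<Rightarrow> 'g) \<Rightarrow> real \<Rightarrow> 'g" where
  "path_of n x = (\<lambda>t\<in>{0..1}. partial_product G x (nat \<lfloor>t * real n\<rfloor>))"

lemma random_walk_path_of: "random_walk G Y n \<omega> = path_of n (\<lambda>k. Y n k \<omega>)"
  by (simp add: random_walk_def path_of_def)

lemma path_of_apply: "t \<in> {0..1} \<Longrightarrow> path_of n x t = partial_product G x (nat \<lfloor>t * real n\<rfloor>)"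
  by (simp add: path_of_def)

lemma path_of_0 [simp]: "path_of n x 0 = \<one>"
  by (simp add: path_of_def)

lemma path_of_cong: "(\<And>i. 1 \<le> i \<Longrightarrow> i \<le> n \<Longrightarrow> x i = y i) \<Longrightarrow> path_of n x = path_of n y"
  unfolding path_of_def using floor_index order_trans
  by (intro restrict_ext partial_product_cong) blast

lemma path_of_cadlag: "path_of n x \<in> cadlag_paths G"
  unfolding cadlag_paths_def
proof (intro CollectI conjI ballI)
  show "path_of n x \<in> extensional {0..1}" by (simp add: path_of_def)
  show "path_of n x 0 = \<one>" by simp
next
  fix t :: real assume t: "t \<in> {0..<1}"
  have "eventually (\<lambda>s. path_of n x s = path_of n x t) (at_right t)"
  proof (cases "n = 0")
    case True
    have "eventually (\<lambda>s. s \<in> {t<..<1}) (at_right t)"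
      using t by (intro eventually_at_right_real) simp
    then show ?thesis using t True by (auto elim!: eventually_mono simp: path_of_apply)
  next
    case False
    define b where "b = min 1 ((\<lfloor>t * real n\<rfloor> + 1) / real n)"
    have "t < b" using t False by (auto simp: b_def less_divide_eq)
    then have "eventually (\<lambda>s. s \<in> {t<..<b}) (at_right t)" by (rule eventually_at_right_real)
    then show ?thesis
    proof eventually_elim
      case (elim s)
      then have s: "t < s" "s < 1" "s * real n < \<lfloor>t * real n\<rfloor> + 1"
        using False by (auto simp: b_def less_divide_eq)
      have "t * real n \<le> s * real n" using s by (intro mult_right_mono) auto
      then have "\<lfloor>s * real n\<rfloor> = \<lfloor>t * real n\<rfloor>" using s(3) by (intro floor_unique) linarith+
      then show ?case using t s by (simp add: path_of_apply)
    qed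
  qed
  then show "(path_of n x \<longlongrightarrow> path_of n x t) (at_right t)" by (rule tendsto_eventually)
next
  fix t :: real assume t: "t \<in> {0<..1}"
  \<comment> \<open>The index in force just before \<open>t\<close>; when \<open>t * n\<close> is an
    integer, it is one less than the index at \<open>t\<close>.\<close>
  let ?k = "\<lceil>t * real n\<rceil> - 1"
  have "eventually (\<lambda>s. path_of n x s = partial_product G x (nat ?k)) (at_left t)"
  proof (cases "n = 0")
    case True
    have "eventually (\<lambda>s. s \<in> {0<..<t}) (at_left t)"
      using t by (intro eventually_at_left_real) simp
    then show ?thesis using t True by (auto elim!: eventually_mono simp: path_of_apply)
  next
    case False
    define b where "b = max 0 (?k / real n)"
    have "?k < t * real n" by linarith
    then have "b < t" using t False by (auto simp: b_def divide_less_eq)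
    then have "eventually (\<lambda>s. s \<in> {b<..<t}) (at_left t)" by (rule eventually_at_left_real)
    then show ?thesis
    proof eventually_elim
      case (elim s)
      then have s: "0 < s" "s < t" "?k < s * real n"
        using False by (auto simp: b_def divide_less_eq)
      have "s * real n < t * real n" using s False by (intro mult_strict_right_mono) auto
      then have "\<lfloor>s * real n\<rfloor> = ?k" using s(3) by (intro floor_unique) linarith+
      then show ?case using t s by (simp add: path_of_apply)
    qed
  qed
  then show "\<exists>l. (path_of n x \<longlongrightarrow> l) (at_left t)" by (intro exI tendsto_eventually)
qed

section \<open>Continuity and measurability of the path map\<close>

lemma continuous_on_partial_product:
  fixes x :: "'b::topological_space \<Rightarrow> nat \<Rightarrow> 'g"
  assumes "\<And>i. continuous_on S (\<lambda>z. x z i)"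
  shows "continuous_on S (\<lambda>z. partial_product G (x z) k)"
  by (induction k) (auto intro!: continuous_intros assms)

lemma continuous_on_partial_product_coordinates:
  "continuous_on UNIV (\<lambda>x :: nat \<Rightarrow> 'g. partial_product G x k)"
  by (intro continuous_on_partial_product continuous_on_product_coordinates)

lemma continuous_on_group_dist [continuous_intros]:
  "continuous_on S f \<Longrightarrow> continuous_on S g \<Longrightarrow> continuous_on S (\<lambda>x. group_dist G N (f x) (g x))"
  unfolding group_dist_def by (intro continuous_intros)

lemma group_dist_nonneg: "0 \<le> group_dist G N x y"
  by (simp add: group_dist_def N_nonneg)

lemma group_dist_self [simp]: "group_dist G N x x = 0"
  by (simp add: group_dist_def)

text \<open>Finitely many partial products determine the path, and close ones give uniformly close
  paths, with the identity as time change. Borel measurability of the random path is derived from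
  this continuity on sequence space.\<close>

lemma open_vimage_path_of:
  assumes W: "openin (skorokhod_topology G N) W"
  shows "open (path_of n -` W)"
  unfolding open_subopen[of "path_of n -` W"]
proof
  fix x assume "x \<in> path_of n -` W"
  then obtain r where r: "r > 0" "skorokhod_ball G N (path_of n x) r \<subseteq> W"
    using W unfolding openin_skorokhod_topology by auto
  let ?T = "{y. \<forall>k\<in>{..n}. group_dist G N (partial_product G x k) (partial_product G y k) < r}"
  have "open (\<Inter>k\<in>{..n}. {y. group_dist G N (partial_product G x k) (partial_product G y k) < r})"
    by (intro open_INT ballI open_Collect_less continuous_intros
        continuous_on_partial_product_coordinates) auto
  moreover have "?T = (\<Inter>k\<in>{..n}. {y. group_dist G N (partial_product G x k) (partial_product G y k) < r})"
    by auto
  ultimately have "open ?T" by simp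
  moreover have "x \<in> ?T" using r by simp
  moreover have "?T \<subseteq> path_of n -` W"
  proof
    fix y assume y: "y \<in> ?T"
    have "group_dist G N (path_of n x t) (path_of n y t) < r" if "t \<in> {0..1}" for t
      using y floor_index[OF that, of n] by (simp add: path_of_apply[OF that])
    then have "path_of n y \<in> skorokhod_ball G N (path_of n x) r"
      unfolding skorokhod_ball_def
      by (intro CollectI conjI path_of_cadlag bexI[OF _ time_changes_id] ballI) (simp_all add: r(1))
    then show "y \<in> path_of n -` W" using r(2) by blast
  qed
  ultimately show "\<exists>T. open T \<and> x \<in> T \<and> T \<subseteq> path_of n -` W" by blast
qed

text \<open>The supremum runs over uncountably many partitions, so measurability comes from lower
  semicontinuity: each partition sum is continuous in the steps, and a superlevel set of the
  supremum is a union of open sets.\<close>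

lemma p_variation_path_of_measurable:
  assumes "p > 0"
  shows "(\<lambda>x. p_variation G N p 0 1 (path_of n x)) \<in> borel_measurable borel"
proof -
  define h where "h ts x = (\<Sum>j<length ts - 1. group_dist G N (path_of n x (ts ! j))
      (path_of n x (ts ! Suc j)) powr p) powr (1 / p)" for ts :: "real list" and x
  have path: "continuous_on UNIV (\<lambda>x. path_of n x t)" for t
  proof (cases "t \<in> {0..1}")
    case True
    then show ?thesis
      using continuous_on_partial_product_coordinates[of "nat \<lfloor>t * real n\<rfloor>"] by (simp add: path_of_def)
  next
    case False
    then have "path_of n x t = undefined" for x by (simp only: path_of_def restrict_def if_False)
    then show ?thesis by simp
  qed
  have "continuous_on UNIV (h ts)" for ts
    unfolding h_def using assms
    by (intro continuous_on_powr' continuous_on_sum continuous_on_group_dist path continuous_on_const)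
       (auto simp: group_dist_nonneg sum_nonneg)
  then have op: "open {x. ennreal (h ts x) > a}" for ts a
    by (intro open_Collect_less continuous_on_const continuous_on_ennreal)
  have "(\<lambda>x. SUP ts\<in>partitions 0 1. ennreal (h ts x)) \<in> borel_measurable borel"
  proof (rule borel_measurableI_greater)
    fix a
    have "{x \<in> space borel. a < (SUP ts\<in>partitions 0 1. ennreal (h ts x))} =
        (\<Union>ts\<in>partitions 0 1. {x. ennreal (h ts x) > a})"
      by (auto simp: less_SUP_iff)
    moreover have "open (\<Union>ts\<in>partitions 0 1. {x. ennreal (h ts x) > a})" using op by blast
    ultimately show "{x \<in> space borel. a < (SUP ts\<in>partitions 0 1. ennreal (h ts x))} \<in> sets borel"
      by simp
  qed
  then show ?thesis by (simp add: p_variation_def h_def)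
qed

section \<open>Variation and modulus of a fixed path in terms of restarts\<close>

definition walk_bounded :: "real \<Rightarrow> (nat \<Rightarrow> 'g) \<Rightarrow> nat \<Rightarrow> bool" where
  "walk_bounded R x n \<longleftrightarrow> (\<forall>k\<le>n. N (partial_product G x k) \<le> R)"

text \<open>
  An increment of size in \<open>(C 2\<^sup>-\<^sup>i\<^sup>-\<^sup>1, C 2\<^sup>-\<^sup>i]\<close> forces a reset of the chain at scale \<open>2\<^sup>-\<^sup>i\<^sup>-\<^sup>1\<close>,
  and one larger than \<open>C\<close> a reset at scale \<open>1\<close>.
\<close>

definition variation_bound :: "real \<Rightarrow> real \<Rightarrow> real \<Rightarrow> (nat \<Rightarrow> nat) \<Rightarrow> nat \<Rightarrow> ennreal" where
  "variation_bound p A C r r0 = ennreal (A powr p) * of_nat r0 +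
     (\<Sum>i. ennreal ((C / 2 ^ i) powr p) * of_nat (r i))"

text \<open>Each increment is charged to resets inside its own interval, and the resets over
  consecutive intervals add up to at most those of the whole walk, so the bound does not depend on
  the partition. Increments above \<open>C\<close> are at most \<open>D * R\<close>.\<close>

lemma p_variation_le:
  obtains C D where "C > 0" "D > 0"
    "\<And>p x n R B. p > 0 \<Longrightarrow> B \<ge> 0 \<Longrightarrow> walk_bounded R x n \<Longrightarrow>
       variation_bound p (D * R) C (\<lambda>i. resets (2 ^ Suc i) 0 x 0 n) (resets 1 0 x 0 n) \<le> ennreal B \<Longrightarrow>
       p_variation G N p 0 1 (path_of n x) \<le> ennreal (B powr (1 / p))"
proof -
  obtain C where C: "C > 0"
    "\<And>l L x k i j. l > 0 \<Longrightarrow> i \<le> j \<Longrightarrow> resets l L x k i = resets l L x k j \<Longrightarrow>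
       rho (partial_product G x (k + i)) (partial_product G x (k + j)) \<le> C / l"
    using N_no_reset by blast
  obtain K where K: "K \<ge> 1" "\<And>x. N (inv x) \<le> K * N x" using N_inv_le by blast
  show ?thesis
  proof (rule that[of C "K + 1"])
    show "C > 0" "K + 1 > 0" using C K by auto
    fix p R B :: real and x and n :: nat
    assume p: "p > 0" and B: "B \<ge> 0" and bd: "walk_bounded R x n"
    let ?S = "partial_product G x"
    let ?res = "resets 1 0 x 0" and ?rr = "\<lambda>i. resets (2 ^ Suc i) 0 x 0"
    assume le: "variation_bound p ((K + 1) * R) C (\<lambda>i. ?rr i n) (?res n) \<le> ennreal B"
    have gd_le: "group_dist G N (?S a) (?S b) \<le> (K + 1) * R" if "a \<le> n" "b \<le> n" for a b
    proof -
      have "group_dist G N (?S a) (?S b) \<le> N (inv (?S a)) + N (?S b)"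
        unfolding group_dist_def by (rule N_mult)
      also have "\<dots> \<le> K * N (?S a) + N (?S b)" using K(2) by simp
      also have "\<dots> \<le> K * R + R"
        using bd that K(1) by (intro add_mono mult_left_mono) (auto simp: walk_bounded_def)
      finally show ?thesis by (simp add: algebra_simps)
    qed
    have gd_rho: "group_dist G N y z \<le> rho y z" for y z
      by (simp add: rho_group_dist group_dist_nonneg)
    have jump: "resets l 0 x 0 a < resets l 0 x 0 b"
      if "l > 0" "a \<le> b" "group_dist G N (?S a) (?S b) > C / l" for l a b
    proof (rule ccontr)
      assume "\<not> resets l 0 x 0 a < resets l 0 x 0 b"
      then have "resets l 0 x 0 a = resets l 0 x 0 b" using resets_mono[OF that(2), of l 0 x 0] by simp
      from C(2)[OF that(1,2) this] gd_rho[of "?S a" "?S b"] that(3) show False by simp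
    qed
    have incr: "ennreal (group_dist G N (?S a) (?S b) powr p) \<le>
        variation_bound p ((K + 1) * R) C (\<lambda>i. ?rr i b - ?rr i a) (?res b - ?res a)"
      if ab: "a \<le> b" "b \<le> n" for a b
    proof -
      let ?g = "group_dist G N (?S a) (?S b)"
      consider "?g = 0" | "?g > C" | "0 < ?g" "?g \<le> C" using group_dist_nonneg[of "?S a" "?S b"] by linarith
      then show ?thesis
      proof cases
        case 1
        then show ?thesis by simp
      next
        case 2
        then have "?res a < ?res b" using jump[of 1 a b] ab by simp
        then have "of_nat (?res b - ?res a) \<ge> (1 :: ennreal)"
          by (metis Suc_leI of_nat_1 of_nat_mono One_nat_def zero_less_diff)
        then have "ennreal (?g powr p) * 1 \<le> ennreal (((K + 1) * R) powr p) * of_nat (?res b - ?res a)"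
          using gd_le[of a b] ab p group_dist_nonneg
          by (intro mult_mono ennreal_leI powr_mono2) auto
        then show ?thesis unfolding variation_bound_def by (simp add: add_increasing2)
      next
        case 3
        have "\<exists>j. C / 2 ^ j < ?g"
        proof -
          obtain j where "(1 / 2) ^ j < ?g / C" using real_arch_pow_inv[of "?g / C" "1 / 2"] 3 C(1) by auto
          then show ?thesis using C(1) by (auto simp: field_simps power_divide)
        qed
        then obtain j where j: "C / 2 ^ j < ?g" "\<And>i. i < j \<Longrightarrow> \<not> C / 2 ^ i < ?g"
          using exists_least_iff[of "\<lambda>j. C / 2 ^ j < ?g"] by blast
        \<comment> \<open>The least \<open>j\<close> is not \<open>0\<close> because
          \<open>?g \<le> C\<close>; minimality then gives the upper bound at scale
          \<open>i\<close>.\<close>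
        then obtain i where i: "j = Suc i" using 3(2) by (cases j) auto
        have "?rr i a < ?rr i b" using jump[of "2 ^ Suc i" a b] j(1) ab i by simp
        then have "of_nat (?rr i b - ?rr i a) \<ge> (1 :: ennreal)"
          by (metis Suc_leI of_nat_1 of_nat_mono One_nat_def zero_less_diff)
        moreover have "?g \<le> C / 2 ^ i" using j(2)[of i] i by simp
        ultimately have "ennreal (?g powr p) * 1 \<le> ennreal ((C / 2 ^ i) powr p) * of_nat (?rr i b - ?rr i a)"
          using p 3(1) by (intro mult_mono ennreal_leI powr_mono2) auto
        also have "\<dots> \<le> (\<Sum>i. ennreal ((C / 2 ^ i) powr p) * of_nat (?rr i b - ?rr i a))"
          using sum_le_suminf[OF summableI, of "{i}" "\<lambda>i. ennreal ((C / 2 ^ i) powr p) * of_nat (?rr i b - ?rr i a)"]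
          by simp
        finally show ?thesis unfolding variation_bound_def by (simp add: add_increasing)
      qed
    qed
    have part: "(\<Sum>j<length ts - 1. group_dist G N (path_of n x (ts ! j)) (path_of n x (ts ! Suc j)) powr p) \<le> B"
      if ts: "ts \<in> partitions 0 1" for ts
    proof -
      let ?m = "length ts - 1"
      define k where "k j = nat \<lfloor>ts ! j * real n\<rfloor>" for j
      have in01: "ts ! j \<in> {0..1}" if "j \<le> ?m" for j
        using partitionsD(1,2)[OF ts] that by (cases ts) auto
      have kn: "k j \<le> n" if "j \<le> ?m" for j using floor_index[OF in01[OF that]] by (simp add: k_def)
      have k_mono: "k j \<le> k (Suc j)" if "j < ?m" for j
        unfolding k_def using partitionsD(3)[OF ts, of j "Suc j"] that
        by (intro nat_mono floor_mono mult_right_mono) auto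
      have tele: "(\<Sum>j<?m. resets l 0 x 0 (k (Suc j)) - resets l 0 x 0 (k j)) \<le> resets l 0 x 0 n" for l
      proof -
        have "(\<Sum>j<?m. resets l 0 x 0 (k (Suc j)) - resets l 0 x 0 (k j)) \<le> resets l 0 x 0 (k ?m)"
          using k_mono by (intro sum_nat_increments_le) (auto intro: monoI resets_mono)
        also have "\<dots> \<le> resets l 0 x 0 n" using kn by (intro resets_mono) auto
        finally show ?thesis .
      qed
      have "ennreal (\<Sum>j<?m. group_dist G N (path_of n x (ts ! j)) (path_of n x (ts ! Suc j)) powr p) =
          (\<Sum>j<?m. ennreal (group_dist G N (?S (k j)) (?S (k (Suc j))) powr p))"
        using in01 by (subst sum_ennreal[symmetric]) (auto intro!: sum.cong simp: path_of_apply k_def)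
      also have "\<dots> \<le> (\<Sum>j<?m. variation_bound p ((K + 1) * R) C (\<lambda>i. ?rr i (k (Suc j)) - ?rr i (k j))
          (?res (k (Suc j)) - ?res (k j)))"
        using k_mono kn by (intro sum_mono incr) auto
      also have "\<dots> = variation_bound p ((K + 1) * R) C (\<lambda>i. \<Sum>j<?m. ?rr i (k (Suc j)) - ?rr i (k j))
          (\<Sum>j<?m. ?res (k (Suc j)) - ?res (k j))"
        unfolding variation_bound_def
        by (simp add: sum.distrib sum_distrib_left suminf_sum[OF summableI, symmetric] of_nat_sum)
      also have "\<dots> \<le> variation_bound p ((K + 1) * R) C (\<lambda>i. ?rr i n) (?res n)"
        unfolding variation_bound_def using tele
        by (intro add_mono mult_left_mono suminf_le summableI of_nat_mono) auto
      also note le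
      finally show ?thesis using B by (simp add: ennreal_le_iff)
    qed
    show "p_variation G N p 0 1 (path_of n x) \<le> ennreal (B powr (1 / p))"
      unfolding p_variation_def using part p
      by (auto intro!: SUP_least ennreal_leI powr_mono2 sum_nonneg)
  qed
qed

text \<open>With at most \<open>n\<close> resets at each scale, a geometric series dominates. As
  this holds for every sequence of steps, the bound may be handled as a real random
  variable.\<close>

lemma variation_bound_finite:
  assumes "p > 0" "C > 0" "\<And>i. r i \<le> n"
  shows "variation_bound p A C r r0 < \<infinity>"
proof -
  have eq: "(C / 2 ^ i) powr p = C powr p * ((1 / 2) powr p) ^ i" for i
  proof -
    have "(1 / 2 :: real) powr real i = (1 / 2) ^ i" by (rule powr_realpow) simp
    then have "C / 2 ^ i = C * (1 / 2) powr real i"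
      by (simp only: power_one_over times_divide_eq_right mult_1_right)
    then have "(C / 2 ^ i) powr p = C powr p * ((1 / 2) powr real i) powr p"
      using assms(2) by (simp add: powr_mult)
    also have "((1 / 2) powr real i) powr p = ((1 / 2) powr p) powr real i"
      by (simp only: powr_powr mult.commute)
    finally show ?thesis by (simp add: powr_realpow)
  qed
  have "(1 / 2 :: real) powr p < 1 powr p" using assms(1) by (intro powr_less_mono2) auto
  then have "summable (\<lambda>i. C powr p * ((1 / 2) powr p) ^ i * real n)"
    by (intro summable_mult2 summable_mult summable_geometric) auto
  then have "(\<Sum>i. ennreal (C powr p * ((1 / 2) powr p) ^ i * real n)) < \<infinity>"
    by (subst suminf_ennreal2) auto
  moreover have "(\<Sum>i. ennreal ((C / 2 ^ i) powr p) * of_nat (r i)) \<le> (\<Sum>i. ennreal (C powr p * ((1 / 2) powr p) ^ i * real n))"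
    using assms(3)
    by (intro suminf_le summableI) (auto simp: eq ennreal_mult'' ennreal_of_nat_eq_real_of_nat intro!: mult_left_mono)
  ultimately have "(\<Sum>i. ennreal ((C / 2 ^ i) powr p) * of_nat (r i)) < \<infinity>" by (rule le_less_trans[rotated])
  moreover have "ennreal (A powr p) * of_nat r0 < \<infinity>"
    by (simp add: ennreal_of_nat_eq_real_of_nat ennreal_mult[symmetric])
  ultimately show ?thesis unfolding variation_bound_def by simp
qed

text \<open>The partition consists of \<open>0\<close>, the resets up to \<open>J\<close> and the
  end. A later reset would make the last interval too short, so it is discarded; the chain started
  at \<open>J\<close> bounds the walk after \<open>J\<close> instead. On the last interval both
  bounds \<open>C / l\<close> may be incurred, hence the factor \<open>2\<close>.\<close>

lemma walk_in_step_approx: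
  obtains C where "C > 0"
    "\<And>\<delta> l x n R. 0 < \<delta> \<Longrightarrow> \<delta> < 1 \<Longrightarrow> l > 0 \<Longrightarrow> n \<ge> 1 \<Longrightarrow> walk_bounded R x n \<Longrightarrow>
       shorts l (nat \<lfloor>\<delta> * real n\<rfloor>) x 0 n = 0 \<Longrightarrow>
       resets l (nat \<lfloor>\<delta> * real n\<rfloor>) x (n - nat \<lfloor>\<delta> * real n\<rfloor> - 1) (nat \<lfloor>\<delta> * real n\<rfloor>) = 0 \<Longrightarrow>
       \<exists>p v. paths.gap_seq \<delta> p \<and> paths.step_approx {y. N y \<le> R} (C / l) p v (path_of n x)"
proof -
  obtain C where C: "C > 0"
    "\<And>l L x k i j. l > 0 \<Longrightarrow> i \<le> j \<Longrightarrow> resets l L x k i = resets l L x k j \<Longrightarrow>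
       rho (partial_product G x (k + i)) (partial_product G x (k + j)) \<le> C / l"
    using N_no_reset by blast
  show ?thesis
  proof (rule that[of "2 * C"])
    show "2 * C > 0" using C by simp
    fix \<delta> l R :: real and x and n :: nat
    define L where "L = nat \<lfloor>\<delta> * real n\<rfloor>"
    define J where "J = n - L - 1"
    assume \<delta>: "0 < \<delta>" "\<delta> < 1" and l: "l > 0" and n: "n \<ge> 1" and bd: "walk_bounded R x n"
      and "shorts l (nat \<lfloor>\<delta> * real n\<rfloor>) x 0 n = 0"
      and "resets l (nat \<lfloor>\<delta> * real n\<rfloor>) x (n - nat \<lfloor>\<delta> * real n\<rfloor> - 1) (nat \<lfloor>\<delta> * real n\<rfloor>) = 0"
    then have sh: "shorts l L x 0 n = 0" and rs: "resets l L x J L = 0"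
      by (simp_all add: L_def J_def)
    have "\<delta> * real n < 1 * real n" using \<delta> n by (intro mult_strict_right_mono) auto
    then have "L < n" using \<delta> unfolding L_def by (simp add: nat_less_iff floor_less_iff)
    then have JL: "J + L + 1 = n" by (simp add: J_def)
    have "real L = of_int \<lfloor>\<delta> * real n\<rfloor>" using \<delta> by (simp add: L_def)
    \<comment> \<open>\<open>L\<close> is rounded down, but integer gaps exceeding \<open>L\<close>
      are at least \<open>L + 1\<close>, and this exceeds \<open>\<delta> * n\<close>.\<close>
    then have \<delta>L: "\<delta> * real n < real (L + 1)" by linarith
    let ?S = "partial_product G x"
    define T where "T = {k. k \<le> J \<and> (k = 0 \<or> k \<in> reset_times l L x)}"
    have finT: "finite T" by (rule finite_subset[of _ "{..J}"]) (auto simp: T_def)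
    have T0: "0 \<in> T" by (simp add: T_def)
    have TJ: "k \<le> J" if "k \<in> T" for k using that by (simp add: T_def)
    have gapT: "k + L < k'" if "k \<in> T" "k' \<in> T" "k < k'" for k k'
      using reset_gap[OF sh that(3), of] that JL by (fastforce simp: T_def)
    \<comment> \<open>Iterating \<open>nxt\<close> from \<open>0\<close> enumerates \<open>T\<close>
      in increasing order and then stays at \<open>n\<close>, which is the form that
      \<open>gap_seq\<close> asks for.\<close>
    define nxt where "nxt k = (if \<exists>k'\<in>T. k < k' then Min {k' \<in> T. k < k'} else n)" for k
    define \<kappa> where "\<kappa> i = ((\<lambda>k. if k = n then n else nxt k) ^^ i) 0" for i
    have \<kappa>0: "\<kappa> 0 = 0" by (simp add: \<kappa>_def)
    have \<kappa>Suc: "\<kappa> (Suc i) = (if \<kappa> i = n then n else nxt (\<kappa> i))" for i by (simp add: \<kappa>_def)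
    have nxt: "(nxt k \<in> T \<and> k < nxt k) \<or> nxt k = n" for k
    proof (cases "\<exists>k'\<in>T. k < k'")
      case True
      then have "Min {k' \<in> T. k < k'} \<in> {k' \<in> T. k < k'}" using finT by (intro Min_in) auto
      then show ?thesis using True by (simp add: nxt_def)
    qed (simp add: nxt_def)
    have nxt_le: "nxt k \<le> k'" if "k' \<in> T" "k < k'" for k k'
    proof -
      have "nxt k = Min {k' \<in> T. k < k'}" using that by (auto simp: nxt_def)
      then show ?thesis using finT that by (auto intro: Min_le)
    qed
    have \<kappa>T: "\<kappa> i \<in> T \<or> \<kappa> i = n" for i
      by (induction i) (use \<kappa>0 T0 \<kappa>Suc nxt in auto)
    have \<kappa>n: "\<kappa> i \<le> n" for i using \<kappa>T[of i] TJ JL by fastforce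
    have \<kappa>gap: "\<kappa> i + L < \<kappa> (Suc i)" if "\<kappa> i \<noteq> n" for i
    proof -
      have i: "\<kappa> i \<in> T" using \<kappa>T that by blast
      from nxt[of "\<kappa> i"] show ?thesis
      proof
        assume "nxt (\<kappa> i) \<in> T \<and> \<kappa> i < nxt (\<kappa> i)"
        then show ?thesis using gapT[OF i] that by (simp add: \<kappa>Suc)
      next
        assume "nxt (\<kappa> i) = n"
        then show ?thesis using TJ[OF i] JL that by (simp add: \<kappa>Suc)
      qed
    qed
    define p where "p i = real (\<kappa> i) / real n" for i
    have "paths.gap_seq \<delta> p"
      unfolding paths.gap_seq_def
    proof (intro conjI allI)
      show "p 0 = 0" by (simp add: p_def \<kappa>0)
      fix i
      show "(p i \<le> 1 - \<delta> \<and> p i + \<delta> \<le> p (Suc i) \<and> p (Suc i) \<le> 1) \<or> (p i = 1 \<and> p (Suc i) = 1)"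
      proof (cases "\<kappa> i = n")
        case True
        then show ?thesis using n by (simp add: p_def \<kappa>Suc)
      next
        case False
        have "real (\<kappa> i) + real (L + 1) \<le> real (\<kappa> (Suc i))"
          using \<kappa>gap[OF False] by linarith
        then have "real (\<kappa> i) + \<delta> * real n \<le> real (\<kappa> (Suc i))" using \<delta>L by linarith
        moreover have "p i + \<delta> = (real (\<kappa> i) + \<delta> * real n) / real n"
          using n by (simp add: p_def add_divide_distrib)
        ultimately have "p i + \<delta> \<le> p (Suc i)" by (simp add: p_def divide_right_mono)
        moreover have "p (Suc i) \<le> 1" using \<kappa>n[of "Suc i"] n by (simp add: p_def)
        ultimately show ?thesis by linarith
      qed
    qed
    moreover have "paths.step_approx {y. N y \<le> R} (2 * C / l) p (\<lambda>i. ?S (\<kappa> i)) (path_of n x)"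
      unfolding paths.step_approx_def
    proof (intro allI conjI impI)
      fix i
      show "?S (\<kappa> i) \<in> {y. N y \<le> R}" using bd \<kappa>n by (simp add: walk_bounded_def)
      fix t assume t: "p i \<le> t \<and> t < p (Suc i)"
      define b where "b = nat \<lfloor>t * real n\<rfloor>"
      have "0 \<le> p i" "p (Suc i) \<le> 1" using \<kappa>n n by (auto simp: p_def)
      then have t01: "t \<in> {0..1}" using t by auto
      have tn: "real (\<kappa> i) \<le> t * real n" "t * real n < real (\<kappa> (Suc i))"
        using t n by (auto simp: p_def field_simps)
      have b: "\<kappa> i \<le> b" using tn(1) unfolding b_def by (simp add: le_nat_iff le_floor_iff)
      have "b < \<kappa> (Suc i)" using tn t01 unfolding b_def
        by (simp add: nat_less_iff floor_less_iff)
      then have bn: "b < n" and \<kappa>i: "\<kappa> i \<noteq> n" using \<kappa>n[of "Suc i"] b by (auto simp: \<kappa>Suc)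
      then have iT: "\<kappa> i \<in> T" using \<kappa>T by blast
      have no: "k \<notin> reset_times l L x" if "\<kappa> i < k" "k \<le> b" "k \<le> J" for k
      proof
        assume "k \<in> reset_times l L x"
        then have "k \<in> T" using that by (simp add: T_def)
        from nxt_le[OF this that(1)] show False using \<open>b < \<kappa> (Suc i)\<close> \<kappa>i that by (simp add: \<kappa>Suc)
      qed
      have Cl: "C / l > 0" using C l by simp
      have "rho (?S (\<kappa> i)) (?S b) \<le> 2 * C / l"
      proof (cases "b \<le> J")
        case True
        then have "resets l L x 0 (\<kappa> i) = resets l L x 0 b"
          using b no by (intro no_reset_between) auto
        from C(2)[OF l b this] Cl show ?thesis by simp
      next
        case False
        have \<kappa>J: "\<kappa> i \<le> J" using TJ[OF iT] .
        have "resets l L x 0 (\<kappa> i) = resets l L x 0 J"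
          using \<kappa>J no False by (intro no_reset_between) auto
        from C(2)[OF l \<kappa>J this] have 1: "rho (?S (\<kappa> i)) (?S J) \<le> C / l" by simp
        have "b - J \<le> L" using bn JL by simp
        then have "resets l L x J (b - J) = 0" using resets_mono[of "b - J" L l L x J] rs by simp
        then have "rho (?S (J + 0)) (?S (J + (b - J))) \<le> C / l" by (intro C(2)[OF l]) auto
        then have "rho (?S J) (?S b) \<le> C / l" using False by simp
        then show ?thesis using 1 paths.rho_triangle[of "?S (\<kappa> i)" "?S b" "?S J"] by simp
      qed
      then show "rho (?S (\<kappa> i)) (path_of n x t) \<le> 2 * C / l"
        by (simp add: path_of_apply[OF t01] b_def)
    qed
    ultimately show "\<exists>p v. paths.gap_seq \<delta> p \<and> paths.step_approx {y. N y \<le> R} (2 * C / l) p v (path_of n x)"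
      by blast
  qed
qed

end

section \<open>Ottaviani's inequality for random walks\<close>

context homogeneous_walk
begin

abbreviation walk :: "nat \<Rightarrow> 'w \<Rightarrow> 'g" where
  "walk k \<omega> \<equiv> partial_product G (\<lambda>i. X i \<omega>) k"

text \<open>Measurability is known for the steps \<open>1\<close> to \<open>n\<close> only. The
  identity as default value gives a measurable map into sequence space without changing the
  path.\<close>

definition steps :: "'w \<Rightarrow> nat \<Rightarrow> 'g" where
  "steps \<omega> = (\<lambda>i. if i \<in> {1..n} then X i \<omega> else \<one>)"

lemma steps_measurable [measurable]: "steps \<in> borel_measurable M"
  unfolding steps_def
proof (rule measurable_coordinatewise_then_product)
  fix i
  show "(\<lambda>\<omega>. if i \<in> {1..n} then X i \<omega> else \<one>) \<in> borel_measurable M"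
  proof (cases "i \<in> {1..n}")
    case True
    then show ?thesis using X_measurable[OF True] by (simp only: if_True)
  next
    case False
    then show ?thesis by (simp only: if_False) simp
  qed
qed

lemma path_of_steps: "path_of n (steps \<omega>) = path_of n (\<lambda>i. X i \<omega>)"
  by (rule path_of_cong) (simp add: steps_def)

lemma path_of_measurable: "(\<lambda>\<omega>. path_of n (\<lambda>i. X i \<omega>)) \<in> measurable M (borel_of (skorokhod_topology G N))"
  unfolding borel_of_def
proof (rule measurable_measure_of)
  show "{U. openin (skorokhod_topology G N) U} \<subseteq> Pow (topspace (skorokhod_topology G N))"
    using openin_subset by blast
  show "(\<lambda>\<omega>. path_of n (\<lambda>i. X i \<omega>)) \<in> space M \<rightarrow> topspace (skorokhod_topology G N)"
    by (simp add: path_of_cadlag)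
  fix W assume "W \<in> {U. openin (skorokhod_topology G N) U}"
  then have "path_of n -` W \<in> sets borel" using open_vimage_path_of by simp
  from measurable_sets[OF steps_measurable this]
  show "(\<lambda>\<omega>. path_of n (\<lambda>i. X i \<omega>)) -` W \<inter> space M \<in> sets M"
    by (simp add: vimage_def path_of_steps)
qed

lemma p_variation_measurable:
  assumes "p > 0"
  shows "(\<lambda>\<omega>. p_variation G N p 0 1 (path_of n (\<lambda>i. X i \<omega>))) \<in> borel_measurable M"
  using measurable_compose[OF steps_measurable p_variation_path_of_measurable[OF assms, of n]]
  by (simp add: path_of_steps)

lemma block_product_measurable:
  "{Suc k..k + j} \<subseteq> A \<Longrightarrow>
    (\<lambda>x. partial_product G (\<lambda>i. x (k + i)) j) \<in> measurable (PiM A (\<lambda>_. borel)) (borel :: 'g measure)"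
proof (induction j)
  case (Suc j)
  have "{Suc k..k + j} \<subseteq> A" using Suc.prems by (auto simp: subset_iff)
  note Suc.IH[OF this, measurable]
  have [measurable]: "(\<lambda>x. x (k + Suc j)) \<in> measurable (PiM A (\<lambda>_. borel)) (borel :: 'g measure)"
    using Suc.prems by (intro measurable_component_singleton) auto
  show ?case unfolding partial_product.simps by measurable
qed simp

lemma walk_measurable:
  assumes "k \<le> n"
  shows "walk k \<in> borel_measurable M"
proof -
  have A: "{1..k} \<subseteq> {1..n}" using assms by auto
  have "(\<lambda>\<omega>. partial_product G (restrict (\<lambda>i. X i \<omega>) {1..k}) k) \<in> borel_measurable M"
    using block_product_measurable[of 0 k "{1..k}"]
    by (intro measurable_compose[OF history_measurable[OF A]]) simp
  moreover have "partial_product G (restrict (\<lambda>i. X i \<omega>) {1..k}) k = walk k \<omega>" for \<omega>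
    by (rule partial_product_cong) simp
  ultimately show ?thesis by simp
qed

lemma partial_product_add:
  "partial_product G x (k + j) = partial_product G x k \<otimes> partial_product G (\<lambda>i. x (k + i)) j"
  by (induction j) (simp_all add: m_assoc)

lemma N_measurable [measurable (raw)]:
  assumes "f \<in> borel_measurable M'"
  shows "(\<lambda>x. N (f x)) \<in> borel_measurable M'"
  using measurable_compose[OF assms borel_measurable_continuous_onI[OF continuous_N]] .

text \<open>Split by the first time \<open>k\<close> in the block at which the norm exceeds
  \<open>R + C\<close>. This event is independent of the later steps, which with probability at
  least \<open>1 / 2\<close> keep the endpoint close to \<open>walk k\<close>; then the endpoint
  still has norm above \<open>R\<close>. The order in \<open>inv (walk e) \<otimes> walk k\<close>
  is the one that subadditivity of a possibly asymmetric \<open>N\<close> requires.\<close>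

lemma prob_max_block:
  assumes e: "e \<le> n"
    and half: "\<And>k. s \<le> k \<Longrightarrow> k \<le> e \<Longrightarrow> prob {\<omega> \<in> space M. N (inv (walk e \<omega>) \<otimes> walk k \<omega>) \<le> C} \<ge> 1 / 2"
  shows "prob {\<omega> \<in> space M. \<exists>k\<in>{s..e}. N (walk k \<omega>) > R + C} \<le> 2 * prob {\<omega> \<in> space M. N (walk e \<omega>) > R}"
proof -
  have [measurable]: "walk k \<in> borel_measurable M" if "k \<le> e" for k using walk_measurable that e by simp
  define F where "F k x \<longleftrightarrow> N (partial_product G x k) > R + C \<and> (\<forall>i\<in>{s..<k}. N (partial_product G x i) \<le> R + C)"
    for k and x :: "nat \<Rightarrow> 'g"
  define H where "H k x \<longleftrightarrow> N (inv (partial_product G (\<lambda>i. x (k + i)) (e - k))) \<le> C" for k and x :: "nat \<Rightarrow> 'g"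
  define TT where "TT k = {\<omega> \<in> space M. F k (\<lambda>i. X i \<omega>)}" for k
  define BB where "BB k = {\<omega> \<in> space M. H k (\<lambda>i. X i \<omega>)}" for k
  have [measurable]: "TT k \<in> events" if "k \<in> {s..e}" for k
  proof -
    have "{\<omega> \<in> space M. \<forall>i\<in>{s..<k}. N (walk i \<omega>) \<le> R + C} \<in> events"
      using that by (intro sets.sets_Collect_finite_All) (auto intro!: borel_measurable_le N_measurable walk_measurable e)
    then have "{\<omega> \<in> space M. N (walk k \<omega>) > R + C} \<inter> {\<omega> \<in> space M. \<forall>i\<in>{s..<k}. N (walk i \<omega>) \<le> R + C} \<in> events"
      using that by (intro sets.Int) auto
    moreover have "TT k = {\<omega> \<in> space M. N (walk k \<omega>) > R + C} \<inter> {\<omega> \<in> space M. \<forall>i\<in>{s..<k}. N (walk i \<omega>) \<le> R + C}"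
      by (auto simp: TT_def F_def)
    ultimately show ?thesis by simp
  qed
  have walk_eq: "inv (walk e \<omega>) \<otimes> walk k \<omega> = inv (partial_product G (\<lambda>i. X (k + i) \<omega>) (e - k))"
    if "k \<in> {s..e}" for k \<omega>
    using partial_product_add[of "\<lambda>i. X i \<omega>" k "e - k"] that by (simp add: inv_mult_group m_assoc)
  have BB_eq: "BB k = {\<omega> \<in> space M. N (inv (walk e \<omega>) \<otimes> walk k \<omega>) \<le> C}" if "k \<in> {s..e}" for k
    unfolding BB_def H_def walk_eq[OF that] ..
  have BB_ev: "BB k \<in> events" if "k \<in> {s..e}" for k
  proof -
    have A: "{Suc k..e} \<subseteq> {1..n}" using e by auto
    have "(\<lambda>\<omega>. partial_product G (\<lambda>i. X (k + i) \<omega>) (e - k)) \<in> borel_measurable M"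
    proof -
      have "(\<lambda>\<omega>. partial_product G (\<lambda>i. restrict (\<lambda>i. X i \<omega>) {Suc k..e} (k + i)) (e - k)) \<in> borel_measurable M"
        using block_product_measurable[of k "e - k" "{Suc k..e}"] that
        by (intro measurable_compose[OF history_measurable[OF A]]) simp
      moreover have "partial_product G (\<lambda>i. restrict (\<lambda>i. X i \<omega>) {Suc k..e} (k + i)) (e - k) =
          partial_product G (\<lambda>i. X (k + i) \<omega>) (e - k)" for \<omega>
        by (rule partial_product_cong) auto
      ultimately show ?thesis by simp
    qed
    note [measurable] = this borel_measurable_continuous_onI[OF continuous_on_inv_group[OF continuous_on_id]]
    show ?thesis unfolding BB_def H_def by measurable
  qed
  have ind: "prob (TT k \<inter> BB k) = prob (TT k) * prob (BB k)" if k: "k \<in> {s..e}" for k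
  proof -
    have [measurable]: "(\<lambda>x. partial_product G x (min i k)) \<in> measurable (PiM {1..k} (\<lambda>_. borel)) (borel :: 'g measure)"
      for i
      using block_product_measurable[of 0 "min i k" "{1..k}"] by simp
    \<comment> \<open>The index \<open>min i k\<close> makes every product a function of the first
      \<open>k\<close> coordinates, so that measurability holds for all \<open>i\<close> without a
      side condition.\<close>
    have Fk: "F k = (\<lambda>x. N (partial_product G x (min k k)) > R + C \<and>
        (\<forall>i\<in>{s..<k}. N (partial_product G x (min i k)) \<le> R + C))"
      by (auto simp: F_def fun_eq_iff min_def)
    have F: "F k \<in> measurable (PiM {1..k} (\<lambda>_. borel)) (count_space UNIV)"
      unfolding Fk by measurable
    have [measurable]: "(\<lambda>x. partial_product G (\<lambda>i. x (k + i)) (e - k)) \<in> measurable (PiM {Suc k..e} (\<lambda>_. borel)) (borel :: 'g measure)"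
      using block_product_measurable[of k "e - k" "{Suc k..e}"] k by simp
    note [measurable] = borel_measurable_continuous_onI[OF continuous_on_inv_group[OF continuous_on_id]]
    have H: "H k \<in> measurable (PiM {Suc k..e} (\<lambda>_. borel)) (count_space UNIV)"
      unfolding H_def by measurable
    have "indep_var (count_space UNIV) (\<lambda>\<omega>. F k (restrict (\<lambda>i. X i \<omega>) {1..k}))
        (count_space UNIV) (\<lambda>\<omega>. H k (restrict (\<lambda>i. X i \<omega>) {Suc k..e}))"
      using k e by (intro indep_histories F H) auto
    moreover have "F k (restrict (\<lambda>i. X i \<omega>) {1..k}) = F k (\<lambda>i. X i \<omega>)" for \<omega>
    proof -
      have "partial_product G (restrict (\<lambda>i. X i \<omega>) {1..k}) i = walk i \<omega>" if "i \<le> k" for i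
        using that by (intro partial_product_cong) simp
      then show ?thesis by (simp add: F_def)
    qed
    moreover have "H k (restrict (\<lambda>i. X i \<omega>) {Suc k..e}) = H k (\<lambda>i. X i \<omega>)" for \<omega>
    proof -
      have "partial_product G (\<lambda>i. restrict (\<lambda>i. X i \<omega>) {Suc k..e} (k + i)) (e - k) =
          partial_product G (\<lambda>i. X (k + i) \<omega>) (e - k)"
        by (rule partial_product_cong) auto
      then show ?thesis by (simp add: H_def)
    qed
    ultimately have "indep_var (count_space UNIV) (\<lambda>\<omega>. F k (\<lambda>i. X i \<omega>)) (count_space UNIV) (\<lambda>\<omega>. H k (\<lambda>i. X i \<omega>))"
      by simp
    from indep_varD[OF this, of "{True}" "{True}"] show ?thesis
      by (simp add: TT_def BB_def vimage_def Int_def conj_ac)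
  qed
  have "{\<omega> \<in> space M. \<exists>k\<in>{s..e}. N (walk k \<omega>) > R + C} \<subseteq> (\<Union>k\<in>{s..e}. TT k)"
  proof
    fix \<omega> assume "\<omega> \<in> {\<omega> \<in> space M. \<exists>k\<in>{s..e}. N (walk k \<omega>) > R + C}"
    then obtain k where \<omega>: "\<omega> \<in> space M" and k: "k \<in> {s..e} \<and> N (walk k \<omega>) > R + C" by blast
    obtain m where m: "m \<in> {s..e} \<and> N (walk m \<omega>) > R + C"
      and least: "\<And>i. i < m \<Longrightarrow> \<not> (i \<in> {s..e} \<and> N (walk i \<omega>) > R + C)"
      using k exists_least_iff[of "\<lambda>k. k \<in> {s..e} \<and> N (walk k \<omega>) > R + C"] by blast
    have "N (walk i \<omega>) \<le> R + C" if "i \<in> {s..<m}" for i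
      using least[of i] that m by auto
    then show "\<omega> \<in> (\<Union>k\<in>{s..e}. TT k)" using m \<omega> by (auto simp: TT_def F_def)
  qed
  then have "prob {\<omega> \<in> space M. \<exists>k\<in>{s..e}. N (walk k \<omega>) > R + C} \<le> prob (\<Union>k\<in>{s..e}. TT k)"
    by (intro finite_measure_mono) auto
  also have "\<dots> \<le> (\<Sum>k\<in>{s..e}. prob (TT k))"
    by (intro finite_measure_subadditive_finite) auto
  also have "\<dots> \<le> (\<Sum>k\<in>{s..e}. 2 * prob (TT k \<inter> BB k))"
  proof (rule sum_mono)
    fix k assume k: "k \<in> {s..e}"
    have "prob (TT k) * (1 / 2) \<le> prob (TT k) * prob (BB k)"
      using half[of k] k by (intro mult_left_mono) (auto simp: BB_eq)
    then show "prob (TT k) \<le> 2 * prob (TT k \<inter> BB k)" by (simp add: ind[OF k])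
  qed
  also have "\<dots> = 2 * (\<Sum>k\<in>{s..e}. prob (TT k \<inter> BB k))" by (simp add: sum_distrib_left)
  also have "(\<Sum>k\<in>{s..e}. prob (TT k \<inter> BB k)) = prob (\<Union>k\<in>{s..e}. TT k \<inter> BB k)"
  proof (rule finite_measure_finite_Union[symmetric])
    show "(\<lambda>k. TT k \<inter> BB k) ` {s..e} \<subseteq> events" using BB_ev by auto
    show "disjoint_family_on (\<lambda>k. TT k \<inter> BB k) {s..e}"
      unfolding disjoint_family_on_def
    proof (intro ballI impI)
      fix a b assume ab: "a \<in> {s..e}" "b \<in> {s..e}" "a \<noteq> b"
      have disj: "TT a \<inter> TT b = {}" if "a \<in> {s..e}" "a < b" for a b
      proof (rule equals0I)
        fix \<omega> assume "\<omega> \<in> TT a \<inter> TT b"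
        then have "N (walk a \<omega>) > R + C" "N (walk a \<omega>) \<le> R + C" using that by (auto simp: TT_def F_def)
        then show False by simp
      qed
      show "TT a \<inter> BB a \<inter> (TT b \<inter> BB b) = {}"
        using disj[of a b] disj[of b a] ab by (cases "a < b") auto
    qed
  qed simp
  also have "prob (\<Union>k\<in>{s..e}. TT k \<inter> BB k) \<le> prob {\<omega> \<in> space M. N (walk e \<omega>) > R}"
  proof (rule finite_measure_mono)
    show "(\<Union>k\<in>{s..e}. TT k \<inter> BB k) \<subseteq> {\<omega> \<in> space M. N (walk e \<omega>) > R}"
    proof (rule UN_least, rule subsetI)
      fix k \<omega> assume k: "k \<in> {s..e}" and \<omega>: "\<omega> \<in> TT k \<inter> BB k"
      have "N (walk k \<omega>) = N (walk e \<omega> \<otimes> (inv (walk e \<omega>) \<otimes> walk k \<omega>))" by (simp add: m_assoc[symmetric])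
      also have "\<dots> \<le> N (walk e \<omega>) + N (inv (walk e \<omega>) \<otimes> walk k \<omega>)" by (rule N_mult)
      finally show "\<omega> \<in> {\<omega> \<in> space M. N (walk e \<omega>) > R}"
        using \<omega> by (auto simp: TT_def F_def BB_eq[OF k])
    qed
    show "{\<omega> \<in> space M. N (walk e \<omega>) > R} \<in> events" using walk_measurable[OF e] by measurable
  qed
  finally show ?thesis by simp
qed

lemma walk_bounded_event: "{\<omega> \<in> space M. \<not> walk_bounded R (\<lambda>i. X i \<omega>) n} \<in> events"
proof -
  have "{\<omega> \<in> space M. \<not> walk_bounded R (\<lambda>i. X i \<omega>) n} = (\<Union>k\<in>{..n}. {\<omega> \<in> space M. N (walk k \<omega>) > R})"
    by (auto simp: walk_bounded_def not_le)
  moreover have "{\<omega> \<in> space M. N (walk k \<omega>) > R} \<in> events" if "k \<le> n" for k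
    using walk_measurable[OF that] by measurable
  ultimately show ?thesis by auto
qed

end

section \<open>Tightness\<close>

lemma borel_of_euclidean: "borel_of euclidean = borel"
  by (simp add: borel_of_def borel_def)

context homogeneous_walk
begin

lemma nn_integral_variation_bound:
  assumes n: "n \<ge> 1" and drift: "\<And>l. l \<ge> 1 \<Longrightarrow> drift_bound l (K * l powr \<kappa> / real n)"
  shows "(\<integral>\<^sup>+\<omega>. variation_bound p A C (\<lambda>i. resets (2 ^ Suc i) 0 (\<lambda>i. X i \<omega>) 0 n)
        (resets 1 0 (\<lambda>i. X i \<omega>) 0 n) \<partial>M) \<le>
      ennreal (A powr p) * ennreal K +
      (\<Sum>i. ennreal ((C / 2 ^ i) powr p) * ennreal (K * (2 ^ Suc i) powr \<kappa>))"
proof -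
  have E: "(\<integral>\<^sup>+\<omega>. of_nat (resets l 0 (\<lambda>i. X i \<omega>) 0 n) \<partial>M) \<le> ennreal (K * l powr \<kappa>)" if "l \<ge> 1" for l
    using nn_integral_resets[OF drift[OF that], of 0 n 0] n by (simp add: ennreal_of_nat_eq_real_of_nat)
  have "(\<integral>\<^sup>+\<omega>. variation_bound p A C (\<lambda>i. resets (2 ^ Suc i) 0 (\<lambda>i. X i \<omega>) 0 n)
        (resets 1 0 (\<lambda>i. X i \<omega>) 0 n) \<partial>M) =
      ennreal (A powr p) * (\<integral>\<^sup>+\<omega>. of_nat (resets 1 0 (\<lambda>i. X i \<omega>) 0 n) \<partial>M) +
      (\<Sum>i. ennreal ((C / 2 ^ i) powr p) * (\<integral>\<^sup>+\<omega>. of_nat (resets (2 ^ Suc i) 0 (\<lambda>i. X i \<omega>) 0 n) \<partial>M))"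
    unfolding variation_bound_def
    by (subst nn_integral_add, measurable, subst nn_integral_suminf, measurable)
       (simp add: nn_integral_cmult)
  also have "\<dots> \<le> ennreal (A powr p) * ennreal (K * 1 powr \<kappa>) +
      (\<Sum>i. ennreal ((C / 2 ^ i) powr p) * ennreal (K * (2 ^ Suc i) powr \<kappa>))"
    by (intro add_mono mult_left_mono suminf_le summableI E one_le_power) auto
  finally show ?thesis by simp
qed

lemma variation_bound_measurable [measurable]:
  "(\<lambda>\<omega>. variation_bound p A C (\<lambda>i. resets (2 ^ Suc i) 0 (\<lambda>i. X i \<omega>) 0 n)
      (resets 1 0 (\<lambda>i. X i \<omega>) 0 n)) \<in> borel_measurable M"
  unfolding variation_bound_def by measurable

text \<open>With drift \<open>a / n\<close> per step and \<open>L \<le> \<delta> * n\<close>, the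
  powers of \<open>n\<close> in the bounds cancel, which leaves an estimate of order
  \<open>\<delta>\<close> that is uniform over the rows.\<close>

lemma prob_short_gaps:
  assumes drift: "drift_bound l (a / real n)" and a: "a \<ge> 0" and n: "n \<ge> 1" and \<delta>: "0 < \<delta>" "\<delta> < 1"
  defines "L \<equiv> nat \<lfloor>\<delta> * real n\<rfloor>"
  defines "Bad \<equiv> {\<omega> \<in> space M. shorts l L (\<lambda>i. X i \<omega>) 0 n \<noteq> 0 \<or> resets l L (\<lambda>i. X i \<omega>) (n - L - 1) L \<noteq> 0}"
  shows "Bad \<in> events" and "prob Bad \<le> \<delta> * (2 * a + a\<^sup>2)"
proof -
  have L: "real L \<le> \<delta> * real n" using \<delta> by (simp add: L_def)
  have "\<delta> * real n < 1 * real n" using \<delta> n by (intro mult_strict_right_mono) auto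
  then have Ln: "L < n" using L by linarith
  let ?S = "{\<omega> \<in> space M. shorts l L (\<lambda>i. X i \<omega>) 0 n \<noteq> 0}"
  let ?R = "{\<omega> \<in> space M. resets l L (\<lambda>i. X i \<omega>) (n - L - 1) L \<noteq> 0}"
  have Bad: "Bad = ?S \<union> ?R" by (auto simp: Bad_def)
  have SR: "?S \<in> events" "?R \<in> events"
    using shorts_rv[of 0 n l L] resets_rv[of "n - L - 1" L l L] Ln by (auto intro!: measurable_sets_Collect)
  then show "Bad \<in> events" by (simp add: Bad)
  have "prob Bad \<le> prob ?S + prob ?R" unfolding Bad using SR by (rule measure_Un_le)
  also have "prob ?R \<le> real L * (a / real n)" using Ln by (intro prob_resets[OF drift]) auto
  also have "\<dots> \<le> \<delta> * real n * (a / real n)" using L a by (intro mult_right_mono) auto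
  also have "\<dots> = \<delta> * a" using n by simp
  also have "prob ?S \<le> a / real n * real L + real n * ((a / real n)\<^sup>2 * real L)" by (rule prob_shorts[OF drift])
  also have "\<dots> \<le> a / real n * (\<delta> * real n) + real n * ((a / real n)\<^sup>2 * (\<delta> * real n))"
    using L a by (intro add_mono mult_left_mono) auto
  also have "\<dots> = \<delta> * a + \<delta> * a\<^sup>2" using n by (simp add: power2_eq_square)
  finally show "prob Bad \<le> \<delta> * (2 * a + a\<^sup>2)" by (simp add: algebra_simps)
qed

text \<open>Verifies the hypothesis of \<open>prob_max_block\<close>: a chain started at
  \<open>k\<close> that does not reset up to \<open>e\<close> keeps the two positions close.\<close>

lemma prob_close:
  assumes drift: "drift_bound 1 c" and k: "k \<le> e" "e \<le> n"
    and C: "\<And>x. resets 1 0 x k (e - k) = 0 \<Longrightarrow> rho (partial_product G x k) (partial_product G x e) \<le> C"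
  shows "prob {\<omega> \<in> space M. N (inv (walk e \<omega>) \<otimes> walk k \<omega>) \<le> C} \<ge> 1 - real (e - k) * c"
proof -
  let ?R = "{\<omega> \<in> space M. resets 1 0 (\<lambda>i. X i \<omega>) k (e - k) \<noteq> 0}"
  have R: "?R \<in> events"
    using resets_rv[of k "e - k" 1 0] k by (auto intro!: measurable_sets_Collect)
  have [measurable]: "walk k \<in> borel_measurable M" "walk e \<in> borel_measurable M"
    using walk_measurable k by simp_all
  have "1 - real (e - k) * c \<le> 1 - prob ?R" using prob_resets[OF drift, of k "e - k" 0] k by simp
  also have "\<dots> = prob (space M - ?R)" using R by (simp add: prob_compl)
  also have "\<dots> \<le> prob {\<omega> \<in> space M. N (inv (walk e \<omega>) \<otimes> walk k \<omega>) \<le> C}"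
  proof (rule finite_measure_mono)
    show "space M - ?R \<subseteq> {\<omega> \<in> space M. N (inv (walk e \<omega>) \<otimes> walk k \<omega>) \<le> C}"
    proof
      fix \<omega> assume \<omega>: "\<omega> \<in> space M - ?R"
      then have "rho (walk k \<omega>) (walk e \<omega>) \<le> C" by (intro C) auto
      then have "N (inv (walk e \<omega>) \<otimes> walk k \<omega>) \<le> C"
        using N_nonneg[of "inv (walk k \<omega>) \<otimes> walk e \<omega>"] by (simp add: rho_def)
      then show "\<omega> \<in> {\<omega> \<in> space M. N (inv (walk e \<omega>) \<otimes> walk k \<omega>) \<le> C}" using \<omega> by simp
    qed
    note [measurable] = borel_measurable_continuous_onI[OF continuous_on_inv_group[OF continuous_on_id]]
    show "{\<omega> \<in> space M. N (inv (walk e \<omega>) \<otimes> walk k \<omega>) \<le> C} \<in> events" by measurable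
  qed
  finally show ?thesis .
qed

end

text \<open>Collects what the tightness arguments use. Local coordinates and scaling function enter
  through the drift inequality, with all their constants absorbed into \<open>K\<close>.\<close>

locale homogeneous_array = normed_homogeneous_group G Exp u d N
  for G :: "('g::{second_countable_topology, t2_space}) monoid" (structure)
  and Exp :: "'v::euclidean_space \<Rightarrow> 'g"
  and u :: "nat \<Rightarrow> 'v"
  and d :: "nat \<Rightarrow> real"
  and N :: "'g \<Rightarrow> real" +
  fixes M :: "nat \<Rightarrow> 'w measure" and X :: "nat \<Rightarrow> nat \<Rightarrow> 'w \<Rightarrow> 'g" and K \<kappa> :: real
  assumes row: "n \<ge> 1 \<Longrightarrow> iid_steps (M n) (X n) n"
    and K: "K \<ge> 0"
    and \<kappa>: "\<kappa> > 0"
    and drift: "n \<ge> 1 \<Longrightarrow> l \<ge> 1 \<Longrightarrow>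
      (\<integral>\<omega>. dbump l (x \<otimes> X n 1 \<omega>) \<partial>M n) \<le> dbump l x + K * l powr \<kappa> / real n"
    and tight_marginals:
      "h \<in> {0..1} \<Longrightarrow> tight_family euclidean {1..} M (\<lambda>n \<omega>. random_walk G X n \<omega> h)"
begin

lemma walk_row: "n \<ge> 1 \<Longrightarrow> homogeneous_walk G Exp u d N (M n) (X n) n"
  by (intro homogeneous_walk.intro normed_homogeneous_group_axioms row)

lemma drift_row:
  assumes "n \<ge> 1" "l \<ge> 1"
  shows "homogeneous_walk.drift_bound G Exp u d (M n) (X n) l (K * l powr \<kappa> / real n)"
  using assms K drift by (simp add: homogeneous_walk.drift_bound_def[OF walk_row])

lemma marginal_bound:
  assumes h: "h \<in> {0..1}" and \<epsilon>: "\<epsilon> > 0"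
  shows "\<exists>R\<ge>0. \<forall>n\<ge>1. measure (M n)
    {\<omega> \<in> space (M n). N (partial_product G (\<lambda>i. X n i \<omega>) (nat \<lfloor>h * real n\<rfloor>)) > R} \<le> \<epsilon>"
proof -
  have "\<exists>C. compactin euclidean C \<and> (\<forall>n\<in>{1..}. measure (M n) {\<omega> \<in> space (M n). random_walk G X n \<omega> h \<in> C} \<ge> 1 - \<epsilon>)"
    using tight_marginals[OF h] \<epsilon> unfolding tight_family_def by blast
  then obtain C where C: "compact C" "\<And>n. n \<ge> 1 \<Longrightarrow>
      measure (M n) {\<omega> \<in> space (M n). random_walk G X n \<omega> h \<in> C} \<ge> 1 - \<epsilon>"
    by auto
  have "compact (N ` C)" by (rule compact_continuous_image[OF continuous_on_subset[OF continuous_N subset_UNIV] C(1)])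
  then obtain R where R: "R > 0" "\<And>x. x \<in> C \<Longrightarrow> N x \<le> R"
    using compact_imp_bounded bounded_pos by (metis abs_le_iff image_eqI real_norm_def)
  have "measure (M n) {\<omega> \<in> space (M n). N (partial_product G (\<lambda>i. X n i \<omega>) (nat \<lfloor>h * real n\<rfloor>)) > R} \<le> \<epsilon>"
    if n: "n \<ge> 1" for n
  proof -
    interpret W: homogeneous_walk G Exp u d N "M n" "X n" n by (rule walk_row[OF n])
    let ?k = "nat \<lfloor>h * real n\<rfloor>"
    have eq: "random_walk G X n \<omega> h = W.walk ?k \<omega>" for \<omega> using h by (simp add: random_walk_def)
    have [measurable]: "W.walk ?k \<in> borel_measurable (M n)" by (intro W.walk_measurable floor_index h)
    have [measurable]: "C \<in> sets borel" using C(1) by (intro borel_closed compact_imp_closed)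
    have "W.prob {\<omega> \<in> space (M n). N (W.walk ?k \<omega>) > R} \<le> W.prob (space (M n) - {\<omega> \<in> space (M n). W.walk ?k \<omega> \<in> C})"
      using R(2) by (intro W.finite_measure_mono) (auto simp: not_less[symmetric])
    also have "\<dots> = 1 - W.prob {\<omega> \<in> space (M n). W.walk ?k \<omega> \<in> C}" by (intro W.prob_compl) measurable
    also have "\<dots> \<le> \<epsilon>" using C(2)[OF n] by (simp add: eq)
    finally show ?thesis .
  qed
  then show ?thesis using R(1) by (intro exI[of _ R]) auto
qed

text \<open>The maximal inequality reduces each of \<open>m\<close> blocks of time to its right
  endpoint, so that finitely many marginals suffice. If \<open>n < m\<close>, a block may be shorter
  than a step; those finitely many walks are bounded at each of their times.\<close>

lemma walk_bounded_tight:
  assumes \<epsilon>: "\<epsilon> > 0"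
  obtains R where "R \<ge> 0" "\<And>n. n \<ge> 1 \<Longrightarrow>
    measure (M n) {\<omega> \<in> space (M n). \<not> walk_bounded R (\<lambda>i. X n i \<omega>) n} \<le> \<epsilon>"
proof -
  obtain C where C: "C > 0"
    "\<And>l L x k i j. l > 0 \<Longrightarrow> i \<le> j \<Longrightarrow> resets l L x k i = resets l L x k j \<Longrightarrow>
       rho (partial_product G x (k + i)) (partial_product G x (k + j)) \<le> C / l"
    using N_no_reset by blast
  \<comment> \<open>For \<open>n \<ge> m\<close> a block spans at most
    \<open>n / m + 1 \<le> 2 * n / m\<close> steps, so a reset at scale \<open>1\<close> inside it
    has probability at most \<open>2 * K / m \<le> 1 / 2\<close>.\<close>
  define m where "m = nat \<lceil>4 * K\<rceil> + 1"
  have m: "m \<ge> 1" "4 * K \<le> real m" by (auto simp: m_def) linarith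
  define pr where "pr h R n = measure (M n)
    {\<omega> \<in> space (M n). N (partial_product G (\<lambda>i. X n i \<omega>) (nat \<lfloor>h * real n\<rfloor>)) > R}" for h R n
  \<comment> \<open>The factor \<open>2\<close> of the maximal inequality and the \<open>m\<close>
    blocks use up \<open>\<epsilon>\<close>; for \<open>n < m\<close> there are
    \<open>n + 1 \<le> 2 * m\<close> times to sum over.\<close>
  have "\<forall>h\<in>{0..1}. \<exists>R\<ge>0. \<forall>n\<ge>1. pr h R n \<le> \<epsilon> / (2 * real m)"
    unfolding pr_def using marginal_bound[of _ "\<epsilon> / (2 * real m)"] \<epsilon> m by simp
  then obtain Q where Q0: "\<And>h. h \<in> {0..1} \<Longrightarrow> Q h \<ge> 0"
    and Q: "\<And>h n. h \<in> {0..1} \<Longrightarrow> n \<ge> 1 \<Longrightarrow> pr h (Q h) n \<le> \<epsilon> / (2 * real m)"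
    by metis
  \<comment> \<open>The block endpoints together with all times \<open>k / n\<close> of rows with
    \<open>n < m\<close>: finitely many, so that one \<open>R\<close> exceeds every
    \<open>Q h + C\<close>.\<close>
  define I where "I = (\<lambda>i. real i / real m) ` {0..m} \<union> (\<lambda>(k, n). real k / real n) ` {(k, n). k \<le> n \<and> 1 \<le> n \<and> n < m}"
  have "finite {(k, n). k \<le> n \<and> 1 \<le> n \<and> n < m}"
    by (rule finite_subset[of _ "{..m} \<times> {..m}"]) auto
  then have finI: "finite I" by (simp add: I_def)
  have I01: "h \<in> {0..1}" if "h \<in> I" for h using that m by (auto simp: I_def)
  define R where "R = sum Q I + C"
  have RQ: "Q h + C \<le> R" if "h \<in> I" for h
    using member_le_sum[of h I Q] finI that Q0 I01 by (simp add: R_def)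
  show ?thesis
  proof (rule that[of R])
    show "R \<ge> 0" using C(1) Q0 I01 by (auto simp: R_def intro!: add_nonneg_nonneg sum_nonneg)
    fix n :: nat assume n: "n \<ge> 1"
    interpret W: homogeneous_walk G Exp u d N "M n" "X n" n by (rule walk_row[OF n])
    show "W.prob {\<omega> \<in> space (M n). \<not> walk_bounded R (\<lambda>i. X n i \<omega>) n} \<le> \<epsilon>"
    proof (cases "n < m")
      case True
      have "{\<omega> \<in> space (M n). \<not> walk_bounded R (\<lambda>i. X n i \<omega>) n} \<subseteq>
          (\<Union>k\<in>{..n}. {\<omega> \<in> space (M n). N (W.walk k \<omega>) > Q (real k / real n)})"
      proof
        fix \<omega> assume "\<omega> \<in> {\<omega> \<in> space (M n). \<not> walk_bounded R (\<lambda>i. X n i \<omega>) n}"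
        then obtain k where k: "\<omega> \<in> space (M n)" "k \<le> n" "N (W.walk k \<omega>) > R"
          by (auto simp: walk_bounded_def not_le)
        have "real k / real n \<in> I" using k(2) n True by (auto simp: I_def)
        from RQ[OF this] C(1) k show "\<omega> \<in> (\<Union>k\<in>{..n}. {\<omega> \<in> space (M n). N (W.walk k \<omega>) > Q (real k / real n)})"
          by (auto intro!: bexI[of _ k])
      qed
      moreover have ev: "{\<omega> \<in> space (M n). N (W.walk k \<omega>) > r} \<in> W.events" if "k \<le> n" for k r
        using W.walk_measurable[OF that] by measurable
      ultimately have "W.prob {\<omega> \<in> space (M n). \<not> walk_bounded R (\<lambda>i. X n i \<omega>) n} \<le>
          W.prob (\<Union>k\<in>{..n}. {\<omega> \<in> space (M n). N (W.walk k \<omega>) > Q (real k / real n)})"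
        by (intro W.finite_measure_mono) auto
      also have "\<dots> \<le> (\<Sum>k\<in>{..n}. W.prob {\<omega> \<in> space (M n). N (W.walk k \<omega>) > Q (real k / real n)})"
        using ev by (intro W.finite_measure_subadditive_finite) auto
      also have "\<dots> \<le> (\<Sum>k\<in>{..n}. \<epsilon> / (2 * real m))"
      proof (rule sum_mono)
        fix k assume k: "k \<in> {..n}"
        have "nat \<lfloor>real k / real n * real n\<rfloor> = k" using n by simp
        then show "W.prob {\<omega> \<in> space (M n). N (W.walk k \<omega>) > Q (real k / real n)} \<le> \<epsilon> / (2 * real m)"
          using Q[of "real k / real n" n] k n by (simp add: pr_def)
      qed
      also have "\<dots> = real (n + 1) * (\<epsilon> / (2 * real m))" by simp
      also have "\<dots> \<le> (2 * real m) * (\<epsilon> / (2 * real m))"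
        using True \<epsilon> by (intro mult_right_mono) auto
      also have "\<dots> = \<epsilon>" using m by simp
      finally show ?thesis .
    next
      case False
      define e where "e i = nat \<lfloor>real i / real m * real n\<rfloor>" for i
      have e_eq: "real (e i) = of_int \<lfloor>real i / real m * real n\<rfloor>" for i by (simp add: e_def)
      have e0: "e 0 = 0" and em: "e m = n" using m by (simp_all add: e_def)
      have i01: "real i / real m \<in> {0..1}" if "i \<le> m" for i using that m by auto
      have en: "e i \<le> n" if "i \<le> m" for i unfolding e_def by (rule floor_index[OF i01[OF that]])
      have iI: "real i / real m \<in> I" if "i \<le> m" for i using that by (auto simp: I_def)
      have block: "W.prob {\<omega> \<in> space (M n). \<exists>k\<in>{e i..e (Suc i)}. N (W.walk k \<omega>) > Q (real (Suc i) / real m) + C} \<le> \<epsilon> / real m"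
        if i: "i < m" for i
      proof -
        let ?h = "real (Suc i) / real m"
        have "W.prob {\<omega> \<in> space (M n). \<exists>k\<in>{e i..e (Suc i)}. N (W.walk k \<omega>) > Q ?h + C} \<le>
            2 * W.prob {\<omega> \<in> space (M n). N (W.walk (e (Suc i)) \<omega>) > Q ?h}"
        proof (rule W.prob_max_block)
          show "e (Suc i) \<le> n" using en i by simp
          fix k assume k: "e i \<le> k" "k \<le> e (Suc i)"
          have "real (e (Suc i)) \<le> real (Suc i) / real m * real n" unfolding e_eq by linarith
          moreover have "real (e i) > real i / real m * real n - 1" unfolding e_eq by linarith
          moreover have "real (Suc i) / real m * real n = real i / real m * real n + real n / real m"
            by (simp add: add_divide_distrib distrib_right)
          ultimately have "real (e (Suc i) - k) \<le> real n / real m + 1" using k by (simp add: of_nat_diff)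
          also have "\<dots> \<le> 2 * real n / real m" using False m by (simp add: divide_simps)
          finally have "real (e (Suc i) - k) * (K / real n) \<le> 2 * real n / real m * (K / real n)"
            using K by (intro mult_right_mono) auto
          also have "\<dots> = 2 * K / real m" using n by simp
          also have "\<dots> \<le> 1 / 2" using m by (simp add: divide_simps)
          finally have "1 / 2 \<le> 1 - real (e (Suc i) - k) * (K / real n)" by simp
          also have "\<dots> \<le> W.prob {\<omega> \<in> space (M n). N (inv (W.walk (e (Suc i)) \<omega>) \<otimes> W.walk k \<omega>) \<le> C}"
          proof (rule W.prob_close)
            show "W.drift_bound 1 (K / real n)" using drift_row[OF n, of 1] by simp
            show "k \<le> e (Suc i)" "e (Suc i) \<le> n" using k en i by auto
            fix x assume "resets 1 0 x k (e (Suc i) - k) = 0"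
            then show "rho (partial_product G x k) (partial_product G x (e (Suc i))) \<le> C"
              using C(2)[of 1 0 "e (Suc i) - k" 0 x k] k by simp
          qed
          finally show "1 / 2 \<le> W.prob {\<omega> \<in> space (M n). N (inv (W.walk (e (Suc i)) \<omega>) \<otimes> W.walk k \<omega>) \<le> C}" .
        qed
        also have "\<dots> \<le> 2 * (\<epsilon> / (2 * real m))"
          using Q[OF i01 n, of "Suc i"] i unfolding pr_def e_def by (intro mult_left_mono) auto
        finally show ?thesis by simp
      qed
      have ev: "{\<omega> \<in> space (M n). \<exists>k\<in>{a..b}. N (W.walk k \<omega>) > r} \<in> W.events" if "b \<le> n" for a b r
      proof -
        have "{\<omega> \<in> space (M n). \<exists>k\<in>{a..b}. N (W.walk k \<omega>) > r} = (\<Union>k\<in>{a..b}. {\<omega> \<in> space (M n). N (W.walk k \<omega>) > r})"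
          by auto
        moreover have "{\<omega> \<in> space (M n). N (W.walk k \<omega>) > r} \<in> W.events" if "k \<le> n" for k
          using W.walk_measurable[OF that] by measurable
        ultimately show ?thesis using that by auto
      qed
      have "{\<omega> \<in> space (M n). \<not> walk_bounded R (\<lambda>i. X n i \<omega>) n} \<subseteq>
          (\<Union>i\<in>{..<m}. {\<omega> \<in> space (M n). \<exists>k\<in>{e i..e (Suc i)}. N (W.walk k \<omega>) > Q (real (Suc i) / real m) + C})"
      proof
        fix \<omega> assume "\<omega> \<in> {\<omega> \<in> space (M n). \<not> walk_bounded R (\<lambda>i. X n i \<omega>) n}"
        then obtain k where k: "\<omega> \<in> space (M n)" "k \<le> n" "N (W.walk k \<omega>) > R"
          by (auto simp: walk_bounded_def not_le)
        have "\<exists>i<m. e i \<le> k \<and> k \<le> e (Suc i)"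
        proof (cases "k = n")
          case True
          then show ?thesis using en m em by (intro exI[of _ "m - 1"]) auto
        next
          case False
          then have "real (e 0) \<le> real k" "real k < real (e m)" using k(2) e0 em by auto
          then obtain i where "i < m" "real (e i) \<le> real k" "real k < real (e (Suc i))"
            by (rule exists_partition_index[of "\<lambda>i. real (e i)"])
          then show ?thesis by (intro exI[of _ i]) simp
        qed
        then obtain i where i: "i < m" "e i \<le> k" "k \<le> e (Suc i)" by blast
        have "Q (real (Suc i) / real m) + C \<le> R" using i by (intro RQ iI) simp
        then have "N (W.walk k \<omega>) > Q (real (Suc i) / real m) + C" using k(3) by linarith
        then have "\<omega> \<in> {\<omega> \<in> space (M n). \<exists>k\<in>{e i..e (Suc i)}. N (W.walk k \<omega>) > Q (real (Suc i) / real m) + C}"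
          using k(1) i(2,3) by (intro CollectI conjI bexI[of _ k]) auto
        then show "\<omega> \<in> (\<Union>i\<in>{..<m}. {\<omega> \<in> space (M n). \<exists>k\<in>{e i..e (Suc i)}. N (W.walk k \<omega>) > Q (real (Suc i) / real m) + C})"
          using i(1) by (intro UN_I[of i]) simp_all
      qed
      then have "W.prob {\<omega> \<in> space (M n). \<not> walk_bounded R (\<lambda>i. X n i \<omega>) n} \<le>
          W.prob (\<Union>i\<in>{..<m}. {\<omega> \<in> space (M n). \<exists>k\<in>{e i..e (Suc i)}. N (W.walk k \<omega>) > Q (real (Suc i) / real m) + C})"
        using ev en by (intro W.finite_measure_mono sets.finite_UN) auto
      also have "\<dots> \<le> (\<Sum>i\<in>{..<m}. W.prob {\<omega> \<in> space (M n). \<exists>k\<in>{e i..e (Suc i)}. N (W.walk k \<omega>) > Q (real (Suc i) / real m) + C})"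
        using ev en by (intro W.finite_measure_subadditive_finite) auto
      also have "\<dots> \<le> (\<Sum>i\<in>{..<m}. \<epsilon> / real m)" using block by (intro sum_mono) auto
      also have "\<dots> = \<epsilon>" using m by simp
      finally show ?thesis .
    qed
  qed
qed

theorem walk_tight: "tight_family (skorokhod_topology G N) {1..} M (random_walk G X)"
  unfolding tight_family_def
proof (intro conjI ballI allI impI)
  fix n :: nat assume "n \<in> {1..}"
  then interpret W: homogeneous_walk G Exp u d N "M n" "X n" n by (intro walk_row) simp
  show "random_walk G X n \<in> measurable (M n) (borel_of (skorokhod_topology G N))"
    using W.path_of_measurable by (simp add: random_walk_path_of[abs_def])
next
  fix \<epsilon> :: real assume \<epsilon>: "\<epsilon> > 0"
  obtain R where R: "R \<ge> 0" "\<And>n. n \<ge> 1 \<Longrightarrow>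
    measure (M n) {\<omega> \<in> space (M n). \<not> walk_bounded R (\<lambda>i. X n i \<omega>) n} \<le> \<epsilon> / 2"
    using walk_bounded_tight[of "\<epsilon> / 2"] \<epsilon> by auto
  obtain C where C: "C > 0"
    "\<And>\<delta> l x n R. 0 < \<delta> \<Longrightarrow> \<delta> < 1 \<Longrightarrow> l > 0 \<Longrightarrow> n \<ge> 1 \<Longrightarrow> walk_bounded R x n \<Longrightarrow>
       shorts l (nat \<lfloor>\<delta> * real n\<rfloor>) x 0 n = 0 \<Longrightarrow>
       resets l (nat \<lfloor>\<delta> * real n\<rfloor>) x (n - nat \<lfloor>\<delta> * real n\<rfloor> - 1) (nat \<lfloor>\<delta> * real n\<rfloor>) = 0 \<Longrightarrow>
       \<exists>p v. paths.gap_seq \<delta> p \<and> paths.step_approx {y. N y \<le> R} (C / l) p v (path_of n x)"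
    using walk_in_step_approx by blast
  define a where "a m = K * (2 ^ m) powr \<kappa>" for m :: nat
  \<comment> \<open>At scale \<open>2 ^ m\<close> the drift is \<open>a m / n\<close>, so this
    choice bounds the probability of a bad event at level \<open>m\<close> by
    \<open>\<epsilon> / 4 * (1 / 2) ^ m\<close>, which sums to \<open>\<epsilon> / 2\<close>. The
    other half of \<open>\<epsilon>\<close> is for unbounded walks. The summand \<open>1\<close>
    keeps the denominator positive if \<open>a m = 0\<close>, and the minimum keeps
    \<open>\<delta> m < 1\<close>.\<close>
  define \<delta> where "\<delta> m = min (1 / 2) (\<epsilon> / 4 * (1 / 2) ^ m / (2 * a m + (a m)\<^sup>2 + 1))" for m
  have a: "a m \<ge> 0" for m using K by (simp add: a_def)
  have den: "2 * a m + (a m)\<^sup>2 + 1 > 0" for m using a[of m] by (simp add: add_nonneg_pos)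
  have \<delta>: "0 < \<delta> m" "\<delta> m < 1" for m using den[of m] \<epsilon> by (auto simp: \<delta>_def)
  have \<delta>a: "\<delta> m * (2 * a m + (a m)\<^sup>2) \<le> \<epsilon> / 4 * (1 / 2) ^ m" for m
  proof -
    have "\<delta> m * (2 * a m + (a m)\<^sup>2) \<le> \<delta> m * (2 * a m + (a m)\<^sup>2 + 1)"
      using \<delta>(1)[of m] by (intro mult_left_mono) auto
    also have "\<dots> \<le> \<epsilon> / 4 * (1 / 2) ^ m / (2 * a m + (a m)\<^sup>2 + 1) * (2 * a m + (a m)\<^sup>2 + 1)"
      using den[of m] by (intro mult_right_mono) (auto simp: \<delta>_def)
    also have "\<dots> = \<epsilon> / 4 * (1 / 2) ^ m"
      using den[of m] by (metis less_irrefl nonzero_mult_div_cancel_right times_divide_eq_left)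
    finally show ?thesis .
  qed
  define S where "S = paths.sk_set {y. N y \<le> R} \<delta> (\<lambda>m. C / 2 ^ m)"
  have "(\<lambda>m. C * (1 / 2) ^ m) \<longlonglongrightarrow> C * 0" by (intro tendsto_mult tendsto_const LIMSEQ_power_zero) simp
  then have \<eta>: "(\<lambda>m. C / 2 ^ m) \<longlonglongrightarrow> 0" by (simp add: power_divide)
  have S: "compactin (skorokhod_topology G N) S"
    unfolding S_def skorokhod_topology_eq
    by (rule paths.sk_set_compact[OF compact_N_ball \<delta>(1) \<eta>])
  then have "closedin (skorokhod_topology G N) S"
    unfolding skorokhod_topology_eq by (intro compactin_imp_closedin paths.sk.Hausdorff_space_mtopology)
  then have "cadlag_paths G - S \<in> sets (borel_of (skorokhod_topology G N))"
    unfolding borel_of_def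
  proof (intro in_measure_of)
    show "{U. openin (skorokhod_topology G N) U} \<subseteq> Pow (topspace (skorokhod_topology G N))"
      using openin_subset by blast
  qed (simp add: closedin_def)
  show "\<exists>K. compactin (skorokhod_topology G N) K \<and>
     (\<forall>n\<in>{1..}. 1 - \<epsilon> \<le> measure (M n) {\<omega> \<in> space (M n). random_walk G X n \<omega> \<in> K})"
  proof (intro exI[of _ S] conjI ballI S)
    fix n :: nat assume "n \<in> {1..}"
    then have n: "n \<ge> 1" by simp
    interpret W: homogeneous_walk G Exp u d N "M n" "X n" n by (rule walk_row[OF n])
    define Bad where "Bad m = {\<omega> \<in> space (M n).
      shorts (2 ^ m) (nat \<lfloor>\<delta> m * real n\<rfloor>) (\<lambda>i. X n i \<omega>) 0 n \<noteq> 0 \<or>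
      resets (2 ^ m) (nat \<lfloor>\<delta> m * real n\<rfloor>) (\<lambda>i. X n i \<omega>) (n - nat \<lfloor>\<delta> m * real n\<rfloor> - 1) (nat \<lfloor>\<delta> m * real n\<rfloor>) \<noteq> 0}" for m
    define Big where "Big = {\<omega> \<in> space (M n). \<not> walk_bounded R (\<lambda>i. X n i \<omega>) n}"
    have dr: "W.drift_bound (2 ^ m) (a m / real n)" for m
      using drift_row[OF n, of "2 ^ m"] by (simp add: a_def)
    have Bad: "Bad m \<in> W.events" "W.prob (Bad m) \<le> \<epsilon> / 4 * (1 / 2) ^ m" for m
    proof -
      show "Bad m \<in> W.events" unfolding Bad_def by (rule W.prob_short_gaps(1)[OF dr a n \<delta>])
      have "W.prob (Bad m) \<le> \<delta> m * (2 * a m + (a m)\<^sup>2)"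
        unfolding Bad_def by (rule W.prob_short_gaps(2)[OF dr a n \<delta>])
      then show "W.prob (Bad m) \<le> \<epsilon> / 4 * (1 / 2) ^ m" using \<delta>a by (rule order_trans)
    qed
    have Big: "Big \<in> W.events" "W.prob Big \<le> \<epsilon> / 2"
      using W.walk_bounded_event R(2)[OF n] by (auto simp: Big_def)
    have geo: "(\<lambda>m. \<epsilon> / 4 * (1 / 2) ^ m) sums (\<epsilon> / 4 * (1 / (1 - 1 / 2)))"
      by (intro sums_mult geometric_sums) simp
    have sb: "summable (\<lambda>m. W.prob (Bad m))"
      by (rule summable_comparison_test'[OF sums_summable[OF geo], of 0]) (use Bad(2) in auto)
    have "W.prob (\<Union>m. Bad m) \<le> (\<Sum>m. W.prob (Bad m))"
      using Bad(1) sb by (intro W.finite_measure_subadditive_countably) auto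
    also have "\<dots> \<le> (\<Sum>m. \<epsilon> / 4 * (1 / 2) ^ m)"
      by (intro suminf_le Bad(2) sb sums_summable[OF geo])
    also have "\<dots> = \<epsilon> / 2" using sums_unique[OF geo] by simp
    finally have UBad: "W.prob (\<Union>m. Bad m) \<le> \<epsilon> / 2" .
    let ?G = "{\<omega> \<in> space (M n). random_walk G X n \<omega> \<in> S}"
    have "{\<omega> \<in> space (M n). path_of n (\<lambda>i. X n i \<omega>) \<in> cadlag_paths G - S} \<in> W.events"
      using measurable_sets[OF W.path_of_measurable \<open>cadlag_paths G - S \<in> _\<close>]
      by (simp add: vimage_def Int_def conj_commute)
    then have G': "{\<omega> \<in> space (M n). path_of n (\<lambda>i. X n i \<omega>) \<notin> S} \<in> W.events"
      by (simp add: path_of_cadlag)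
    have "{\<omega> \<in> space (M n). path_of n (\<lambda>i. X n i \<omega>) \<notin> S} \<subseteq> Big \<union> (\<Union>m. Bad m)"
    proof
      fix \<omega> assume \<omega>: "\<omega> \<in> {\<omega> \<in> space (M n). path_of n (\<lambda>i. X n i \<omega>) \<notin> S}"
      show "\<omega> \<in> Big \<union> (\<Union>m. Bad m)"
      proof (rule ccontr)
        assume no: "\<omega> \<notin> Big \<union> (\<Union>m. Bad m)"
        have bd: "walk_bounded R (\<lambda>i. X n i \<omega>) n" using no \<omega> by (simp add: Big_def)
        have "path_of n (\<lambda>i. X n i \<omega>) \<in> S"
          unfolding S_def paths.sk_set_def
        proof (intro CollectI conjI allI path_of_cadlag)
          show "path_of n (\<lambda>i. X n i \<omega>) ` {0..1} \<subseteq> {y. N y \<le> R}"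
            using bd floor_index[of _ n] by (auto simp: path_of_apply walk_bounded_def)
          fix m
          have "\<omega> \<notin> Bad m" using no by blast
          then show "\<exists>p v. paths.gap_seq (\<delta> m) p \<and>
              paths.step_approx {y. N y \<le> R} (C / 2 ^ m) p v (path_of n (\<lambda>i. X n i \<omega>))"
            using \<omega> by (intro C(2) \<delta> n bd) (auto simp: Bad_def)
        qed
        then show False using \<omega> by simp
      qed
    qed
    then have "W.prob {\<omega> \<in> space (M n). path_of n (\<lambda>i. X n i \<omega>) \<notin> S} \<le> W.prob (Big \<union> (\<Union>m. Bad m))"
      using Big(1) Bad(1) by (intro W.finite_measure_mono) auto
    also have "\<dots> \<le> W.prob Big + W.prob (\<Union>m. Bad m)"
      using Big(1) Bad(1) by (intro measure_Un_le) auto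
    also have "\<dots> \<le> \<epsilon>" using Big(2) UBad by simp
    finally have "W.prob {\<omega> \<in> space (M n). path_of n (\<lambda>i. X n i \<omega>) \<notin> S} \<le> \<epsilon>" .
    moreover have "?G = space (M n) - {\<omega> \<in> space (M n). path_of n (\<lambda>i. X n i \<omega>) \<notin> S}"
      by (auto simp: random_walk_path_of)
    ultimately show "1 - \<epsilon> \<le> W.prob ?G" using W.prob_compl[OF G'] by simp
  qed
qed

text \<open>\<open>enn2real\<close> sends infinity to \<open>0\<close>, so tightness of the
  real-valued variation would say nothing about a path of infinite variation; such paths are
  excluded here.\<close>

lemma p_variation_walk_finite:
  assumes "p > 0"
  shows "p_variation G N p 0 1 (path_of n x) < \<infinity>"
proof -
  obtain C D where C: "C > 0" and le: "\<And>p x n R B. p > 0 \<Longrightarrow> B \<ge> 0 \<Longrightarrow> walk_bounded R x n \<Longrightarrow>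
       variation_bound p (D * R) C (\<lambda>i. resets (2 ^ Suc i) 0 x 0 n) (resets 1 0 x 0 n) \<le> ennreal B \<Longrightarrow>
       p_variation G N p 0 1 (path_of n x) \<le> ennreal (B powr (1 / p))"
    using p_variation_le by metis
  define R where "R = (\<Sum>k\<le>n. N (partial_product G x k))"
  have bd: "walk_bounded R x n"
    unfolding walk_bounded_def R_def by (auto intro!: member_le_sum N_nonneg)
  have "variation_bound p (D * R) C (\<lambda>i. resets (2 ^ Suc i) 0 x 0 n) (resets 1 0 x 0 n) < \<infinity>"
    by (intro variation_bound_finite[of _ _ _ n] assms C resets_le)
  then obtain B where B: "B \<ge> 0"
    "variation_bound p (D * R) C (\<lambda>i. resets (2 ^ Suc i) 0 x 0 n) (resets 1 0 x 0 n) = ennreal B"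
    by (cases rule: ennreal_cases) auto
  then have "p_variation G N p 0 1 (path_of n x) \<le> ennreal (B powr (1 / p))"
    using B by (intro le[OF assms _ bd]) simp_all
  then show ?thesis by (rule le_less_trans) simp
qed

text \<open>The expected number of resets at scale \<open>2\<^sup>-\<^sup>i\<close> is of order \<open>2\<^sup>i\<^sup>\<kappa>\<close>, which is summable against \<open>2\<^sup>-\<^sup>i\<^sup>p\<close>.\<close>

theorem p_variation_tight:
  assumes p: "p > \<kappa>"
  shows "tight_family euclideanreal {1..} M (\<lambda>n \<omega>. enn2real (p_variation G N p 0 1 (random_walk G X n \<omega>)))"
  unfolding tight_family_def borel_of_euclidean
proof (intro conjI ballI allI impI)
  have p0: "p > 0" using p \<kappa> by simp
  {
    fix n :: nat assume "n \<in> {1..}"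
    then interpret W: homogeneous_walk G Exp u d N "M n" "X n" n by (intro walk_row) simp
    show "(\<lambda>\<omega>. enn2real (p_variation G N p 0 1 (random_walk G X n \<omega>))) \<in> borel_measurable (M n)"
      using W.p_variation_measurable[OF p0] by (simp add: random_walk_path_of)
  }
  fix \<epsilon> :: real assume \<epsilon>: "\<epsilon> > 0"
  obtain C D where C: "C > 0" "D > 0" and le: "\<And>p x n R B. p > 0 \<Longrightarrow> B \<ge> 0 \<Longrightarrow> walk_bounded R x n \<Longrightarrow>
       variation_bound p (D * R) C (\<lambda>i. resets (2 ^ Suc i) 0 x 0 n) (resets 1 0 x 0 n) \<le> ennreal B \<Longrightarrow>
       p_variation G N p 0 1 (path_of n x) \<le> ennreal (B powr (1 / p))"
    using p_variation_le by metis
  obtain R where R: "R \<ge> 0" "\<And>n. n \<ge> 1 \<Longrightarrow>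
    measure (M n) {\<omega> \<in> space (M n). \<not> walk_bounded R (\<lambda>i. X n i \<omega>) n} \<le> \<epsilon> / 2"
    using walk_bounded_tight[of "\<epsilon> / 2"] \<epsilon> by auto
  define c where "c i = (C / 2 ^ i) powr p * (K * (2 ^ Suc i) powr \<kappa>)" for i :: nat
  have c_eq: "c i = C powr p * K * 2 powr \<kappa> * (2 powr (\<kappa> - p)) ^ i" for i
  proof -
    have pow: "(2 ^ j :: real) = 2 powr real j" for j by (simp add: powr_realpow)
    have "C / 2 powr real i = C * 2 powr (- real i)" by (simp add: powr_minus divide_inverse)
    then have "(C / 2 powr real i) powr p = C powr p * (2 powr (- real i)) powr p"
      using C(1) by (simp add: powr_mult)
    then have "(C / 2 powr real i) powr p = C powr p * 2 powr (- (real i * p))"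
      by (simp only: powr_powr mult_minus_left)
    moreover have "(2 powr (\<kappa> - p)) ^ i = 2 powr ((\<kappa> - p) * real i)"
      by (simp add: powr_realpow[symmetric] powr_powr)
    moreover have "2 powr (- (real i * p)) * 2 powr (real (Suc i) * \<kappa>) = 2 powr \<kappa> * 2 powr ((\<kappa> - p) * real i)"
      by (simp add: powr_add[symmetric] algebra_simps)
    ultimately show ?thesis unfolding c_def pow powr_powr by (simp add: algebra_simps)
  qed
  have "2 powr (\<kappa> - p) < 2 powr 0" using p by (intro powr_less_mono) auto
  then have sum_c: "summable c" unfolding c_eq[abs_def] by (intro summable_mult summable_geometric) simp
  have c0: "c i \<ge> 0" for i using K by (simp add: c_def)
  define V where "V = (D * R) powr p * K + suminf c"
  have V0: "V \<ge> 0" using K c0 by (auto simp: V_def intro!: add_nonneg_nonneg suminf_nonneg sum_c)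
  have V_eq: "ennreal ((D * R) powr p) * ennreal K +
      (\<Sum>i. ennreal ((C / 2 ^ i) powr p) * ennreal (K * (2 ^ Suc i) powr \<kappa>)) = ennreal V"
  proof -
    have "(\<Sum>i. ennreal ((C / 2 ^ i) powr p) * ennreal (K * (2 ^ Suc i) powr \<kappa>)) = (\<Sum>i. ennreal (c i))"
      using K by (intro arg_cong[where f = suminf] ext) (simp add: c_def ennreal_mult)
    also have "\<dots> = ennreal (suminf c)" using c0 sum_c by (intro suminf_ennreal2)
    finally show ?thesis
      using K c0 sum_c by (simp add: V_def ennreal_mult[symmetric] ennreal_plus[symmetric] suminf_nonneg del: ennreal_plus)
  qed
  \<comment> \<open>Markov's inequality at level \<open>B\<close> leaves at most
    \<open>\<epsilon> / 2\<close>; the summand \<open>1\<close> keeps \<open>B\<close> positive when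
    \<open>V = 0\<close>.\<close>
  define B where "B = 2 * V / \<epsilon> + 1"
  have B: "B > 0" "V / B \<le> \<epsilon> / 2" using V0 \<epsilon> by (auto simp: B_def field_simps add_pos_nonneg)
  show "\<exists>K. compactin euclideanreal K \<and>
     (\<forall>n\<in>{1..}. 1 - \<epsilon> \<le> measure (M n) {\<omega> \<in> space (M n). enn2real (p_variation G N p 0 1 (random_walk G X n \<omega>)) \<in> K})"
  proof (intro exI[of _ "{0..B powr (1 / p)}"] conjI ballI)
    show "compactin euclideanreal {0..B powr (1 / p)}" by simp
    fix n :: nat assume "n \<in> {1..}"
    then have n: "n \<ge> 1" by simp
    interpret W: homogeneous_walk G Exp u d N "M n" "X n" n by (rule walk_row[OF n])
    let ?vb = "\<lambda>\<omega>. variation_bound p (D * R) C (\<lambda>i. resets (2 ^ Suc i) 0 (\<lambda>i. X n i \<omega>) 0 n)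
        (resets 1 0 (\<lambda>i. X n i \<omega>) 0 n)"
    let ?pv = "\<lambda>\<omega>. p_variation G N p 0 1 (path_of n (\<lambda>i. X n i \<omega>))"
    have fin: "?vb \<omega> < \<infinity>" for \<omega> by (intro variation_bound_finite[of _ _ _ n] p0 C resets_le)
    then have e2: "ennreal (enn2real (?vb \<omega>)) = ?vb \<omega>" for \<omega> by simp
    define Big where "Big = {\<omega> \<in> space (M n). \<not> walk_bounded R (\<lambda>i. X n i \<omega>) n}"
    have Big: "Big \<in> W.events" "W.prob Big \<le> \<epsilon> / 2"
      using W.walk_bounded_event R(2)[OF n] by (auto simp: Big_def)
    define Var where "Var = {\<omega> \<in> space (M n). enn2real (?vb \<omega>) \<ge> B}"
    have vm: "(\<lambda>\<omega>. enn2real (?vb \<omega>)) \<in> borel_measurable (M n)"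
      by (intro borel_measurable_enn2real W.variation_bound_measurable)
    have Var_ev: "Var \<in> W.events" unfolding Var_def using vm by measurable
    have "W.prob Var \<le> V / B"
      unfolding Var_def
    proof (rule W.prob_ge_le_nn_integral[OF vm B(1) _ V0])
      show "(\<integral>\<^sup>+\<omega>. ennreal (enn2real (?vb \<omega>)) \<partial>M n) \<le> ennreal V"
        unfolding e2 V_eq[symmetric] by (rule W.nn_integral_variation_bound[OF n drift_row[OF n]])
    qed
    then have Var: "W.prob Var \<le> \<epsilon> / 2" using B(2) by (rule order_trans)
    have pvm: "(\<lambda>\<omega>. enn2real (?pv \<omega>)) \<in> borel_measurable (M n)"
      by (intro borel_measurable_enn2real W.p_variation_measurable p0)
    let ?Out = "{\<omega> \<in> space (M n). enn2real (?pv \<omega>) > B powr (1 / p)}"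
    have Out: "?Out \<in> W.events" using pvm by measurable
    have "?Out \<subseteq> Big \<union> Var"
    proof
      fix \<omega> assume \<omega>: "\<omega> \<in> ?Out"
      show "\<omega> \<in> Big \<union> Var"
      proof (rule ccontr)
        assume no: "\<omega> \<notin> Big \<union> Var"
        then have bd: "walk_bounded R (\<lambda>i. X n i \<omega>) n" and "enn2real (?vb \<omega>) < B"
          using \<omega> by (auto simp: Big_def Var_def)
        then have "?vb \<omega> \<le> ennreal B" using e2[of \<omega>] by (metis ennreal_leI less_imp_le)
        then have "?pv \<omega> \<le> ennreal (B powr (1 / p))" using B(1) by (intro le[OF p0 _ bd]) simp_all
        then have "enn2real (?pv \<omega>) \<le> B powr (1 / p)" by (rule enn2real_leI[rotated]) simp
        then show False using \<omega> by simp
      qed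
    qed
    then have "W.prob ?Out \<le> W.prob (Big \<union> Var)"
      using Big(1) Var_ev by (intro W.finite_measure_mono) auto
    also have "\<dots> \<le> W.prob Big + W.prob Var"
      using Big(1) Var_ev by (rule measure_Un_le)
    also have "\<dots> \<le> \<epsilon>" using Big(2) Var by simp
    finally have "W.prob ?Out \<le> \<epsilon>" .
    moreover have "{\<omega> \<in> space (M n). enn2real (p_variation G N p 0 1 (random_walk G X n \<omega>)) \<in> {0..B powr (1 / p)}} =
        space (M n) - ?Out"
      by (auto simp: random_walk_path_of)
    ultimately show "1 - \<epsilon> \<le> W.prob {\<omega> \<in> space (M n). enn2real (p_variation G N p 0 1 (random_walk G X n \<omega>)) \<in> {0..B powr (1 / p)}}"
      using W.prob_compl[OF Out] by simp
  qed
qed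

end

section \<open>The drift of the dilated bump functions\<close>

context homogeneous_group
begin

text \<open>Under the mean, the first order terms involve only the means of the coordinates and the
  remainder only the mean of \<open>\<theta>\<close>, both controlled by constants over
  \<open>r\<close>. Here \<open>r\<close> stands for the number of steps in the row.\<close>

lemma dbump_drift:
  assumes P: "prob_space P" and Y [measurable]: "Y \<in> borel_measurable P"
    and \<xi>: "local_coordinates G Exp u U \<xi>" and \<theta>: "scaling_function G u U \<xi> \<theta>"
    and C: "C \<ge> 0" and r: "r > 0" and l: "l \<ge> 1"
    and \<beta>: "\<And>i. i \<in> {1..DIM('v)} \<Longrightarrow> \<bar>\<beta> i\<bar> \<le> C * l powr \<kappa>"
    and inc: "\<And>y. dbump l (x \<otimes> y) - dbump l x \<le> (\<Sum>i = 1..DIM('v). \<beta> i * \<xi> i y) + C * l powr \<kappa> * \<theta> y"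
    and b: "\<And>i. i \<in> {1..DIM('v)} \<Longrightarrow> r * \<bar>\<integral>\<omega>. \<xi> i (Y \<omega>) \<partial>P\<bar> \<le> b i"
    and t: "r * (\<integral>\<omega>. \<theta> (Y \<omega>) \<partial>P) \<le> t"
  shows "(\<integral>\<omega>. dbump l (x \<otimes> Y \<omega>) \<partial>P) \<le>
    dbump l x + C * ((\<Sum>i = 1..DIM('v). b i) + t) * l powr \<kappa> / r"
proof -
  interpret P: prob_space P by fact
  let ?I = "{1..DIM('v)}" and ?L = "C * l powr \<kappa>"
  obtain B where B: "\<And>i y. i \<in> ?I \<Longrightarrow> \<bar>\<xi> i y\<bar> \<le> B" and cont: "\<And>i. i \<in> ?I \<Longrightarrow> continuous_on UNIV (\<xi> i)"
    using local_coordinates_bounded[OF \<xi>] by metis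
  have int_\<xi>: "integrable P (\<lambda>\<omega>. \<xi> i (Y \<omega>))" if i: "i \<in> ?I" for i
    using measurable_compose[OF Y borel_measurable_continuous_onI[OF cont[OF i]]] B[OF i]
    by (intro P.integrable_const_bound[where B = B]) auto
  have \<theta>c: "continuous_on UNIV \<theta>" and "bounded (range \<theta>)"
    using \<theta> by (auto simp: scaling_function_def)
  then obtain T where T: "\<And>y. \<bar>\<theta> y\<bar> \<le> T" unfolding bounded_iff by auto
  have int_\<theta>: "integrable P (\<lambda>\<omega>. \<theta> (Y \<omega>))"
    using measurable_compose[OF Y borel_measurable_continuous_onI[OF \<theta>c]] T
    by (intro P.integrable_const_bound[where B = T]) auto
  have "continuous_on UNIV (\<lambda>y. dbump l (x \<otimes> y))"
    by (intro continuous_on_compose2[OF continuous_dbump] continuous_intros) auto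
  then have int_f: "integrable P (\<lambda>\<omega>. dbump l (x \<otimes> Y \<omega>))"
    using measurable_compose[OF Y borel_measurable_continuous_onI]
    by (intro P.integrable_const_bound[where B = 1]) (auto simp: dbump_nonneg dbump_le_1)
  have int_s: "integrable P (\<lambda>\<omega>. \<Sum>i\<in>?I. \<beta> i * \<xi> i (Y \<omega>))"
    by (intro Bochner_Integration.integrable_sum integrable_mult_right int_\<xi>)
  have int_t: "integrable P (\<lambda>\<omega>. ?L * \<theta> (Y \<omega>))" by (intro integrable_mult_right int_\<theta>)
  have "(\<integral>\<omega>. dbump l (x \<otimes> Y \<omega>) \<partial>P) \<le>
      (\<integral>\<omega>. dbump l x + ((\<Sum>i\<in>?I. \<beta> i * \<xi> i (Y \<omega>)) + ?L * \<theta> (Y \<omega>)) \<partial>P)"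
  proof (rule integral_mono[OF int_f])
    show "integrable P (\<lambda>\<omega>. dbump l x + ((\<Sum>i\<in>?I. \<beta> i * \<xi> i (Y \<omega>)) + ?L * \<theta> (Y \<omega>)))"
      by (intro Bochner_Integration.integrable_add int_s int_t P.integrable_const)
    fix \<omega>
    show "dbump l (x \<otimes> Y \<omega>) \<le> dbump l x + ((\<Sum>i\<in>?I. \<beta> i * \<xi> i (Y \<omega>)) + ?L * \<theta> (Y \<omega>))"
      using inc[of "Y \<omega>"] by linarith
  qed
  also have "\<dots> = dbump l x + ((\<integral>\<omega>. (\<Sum>i\<in>?I. \<beta> i * \<xi> i (Y \<omega>)) \<partial>P) + (\<integral>\<omega>. ?L * \<theta> (Y \<omega>) \<partial>P))"
    unfolding Bochner_Integration.integral_add[OF P.integrable_const Bochner_Integration.integrable_add[OF int_s int_t]]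
      Bochner_Integration.integral_add[OF int_s int_t]
    using P.prob_space by simp
  also have "(\<integral>\<omega>. (\<Sum>i\<in>?I. \<beta> i * \<xi> i (Y \<omega>)) \<partial>P) = (\<Sum>i\<in>?I. \<beta> i * (\<integral>\<omega>. \<xi> i (Y \<omega>) \<partial>P))"
    by (subst Bochner_Integration.integral_sum) (intro integrable_mult_right int_\<xi>, simp_all)
  also have "\<dots> \<le> (\<Sum>i\<in>?I. ?L * (b i / r))"
  proof (rule sum_mono)
    fix i assume i: "i \<in> ?I"
    have "\<bar>\<integral>\<omega>. \<xi> i (Y \<omega>) \<partial>P\<bar> \<le> b i / r" using b[OF i] r by (simp add: pos_le_divide_eq mult.commute)
    then have "\<bar>\<beta> i\<bar> * \<bar>\<integral>\<omega>. \<xi> i (Y \<omega>) \<partial>P\<bar> \<le> ?L * (b i / r)"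
      using \<beta>[OF i] C by (intro mult_mono) auto
    then show "\<beta> i * (\<integral>\<omega>. \<xi> i (Y \<omega>) \<partial>P) \<le> ?L * (b i / r)"
      by (metis abs_ge_self abs_mult order_trans)
  qed
  also have "(\<integral>\<omega>. ?L * \<theta> (Y \<omega>) \<partial>P) = ?L * (\<integral>\<omega>. \<theta> (Y \<omega>) \<partial>P)" by simp
  also have "\<dots> \<le> ?L * (t / r)"
    using t r C by (intro mult_left_mono) (auto simp: pos_le_divide_eq mult.commute)
  also have "(\<Sum>i\<in>?I. ?L * (b i / r)) = ?L * ((\<Sum>i\<in>?I. b i) / r)"
    by (simp only: sum_distrib_left sum_divide_distrib)
  finally show ?thesis by (simp add: algebra_simps add_divide_distrib)
qed

end

theorem theorem4p1:
  fixes G :: "('g::{second_countable_topology, t2_space}) monoid"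
    and Exp :: "'v::euclidean_space \<Rightarrow> 'g"
    and u :: "nat \<Rightarrow> 'v"
    and d q :: "nat \<Rightarrow> real"
    and N \<theta> :: "'g \<Rightarrow> real"
    and U :: "'g set"
    and \<xi> :: "nat \<Rightarrow> 'g \<Rightarrow> real"
    and M :: "nat \<Rightarrow> 'w measure"
    and X :: "nat \<Rightarrow> nat \<Rightarrow> 'w \<Rightarrow> 'g"
    and \<kappa> :: real
  assumes "homogeneous_group G Exp u d"
    and "subadditive_homogeneous_norm G Exp u d N"
    and "local_coordinates G Exp u U \<xi>"
    and "iid_array G M X"
    and q: "\<forall>i\<in>{1..DIM('v)}. 0 < q i \<and> q i \<le> 2"
    and \<kappa>: "\<kappa> = Max ((\<lambda>i. q i * d i) ` {1..DIM('v)})"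
    and A: "\<forall>h\<in>{0..1}. tight_family euclidean {1..} M (\<lambda>n \<omega>. random_walk G X n \<omega> h)"
    and B: "\<forall>i\<in>{1..DIM('v)}.
              bdd_above ((\<lambda>n. real n * \<bar>integral\<^sup>L (M n) (\<lambda>\<omega>. \<xi> i (X n 1 \<omega>))\<bar>) ` {1..})"
    and C: "scaling_function G u U \<xi> \<theta>" "scales M X \<theta>"
      "\<forall>\<^sub>F x in nhds \<one>\<^bsub>G\<^esub>. \<theta> x = (\<Sum>i = 1..DIM('v). \<bar>\<xi> i x\<bar> powr q i)"
  shows "tight_family (skorokhod_topology G N) {1..} M (random_walk G X) \<and>
    (\<forall>p>\<kappa>.
       (\<forall>n\<ge>1. \<forall>\<omega>\<in>space (M n). p_variation G N p 0 1 (random_walk G X n \<omega>) < \<infinity>) \<and>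
       tight_family euclideanreal {1..} M
         (\<lambda>n \<omega>. enn2real (p_variation G N p 0 1 (random_walk G X n \<omega>))))"
proof -
  interpret H: homogeneous_group G Exp u d by fact
  interpret NH: normed_homogeneous_group G Exp u d N
    by (intro normed_homogeneous_group.intro normed_homogeneous_group_axioms.intro assms)
  let ?I = "{1..DIM('v)}"
  have \<kappa>_ge: "q i * d i \<le> \<kappa>" if "i \<in> ?I" for i using that by (auto simp: \<kappa> intro!: Max_ge)
  have one: "1 \<in> ?I" using DIM_positive[where 'a = 'v] by (simp add: Suc_leI)
  have "0 < q 1 * d 1" using q one H.d_ge_1 by (intro mult_pos_pos) auto
  then have \<kappa>_pos: "\<kappa> > 0" using \<kappa>_ge[OF one] by simp
  have q': "\<And>i. i \<in> ?I \<Longrightarrow> 0 < q i \<and> q i \<le> 2" using q by blast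
  obtain c where c: "c > 0" and inc:
    "\<And>l x. l \<ge> 1 \<Longrightarrow> \<exists>\<beta>. (\<forall>i\<in>?I. \<bar>\<beta> i\<bar> \<le> c * l powr \<kappa>) \<and>
       (\<forall>y. H.dbump l (x \<otimes>\<^bsub>G\<^esub> y) - H.dbump l x \<le> (\<Sum>i\<in>?I. \<beta> i * \<xi> i y) + c * l powr \<kappa> * \<theta> y)"
    using H.dbump_increment[OF assms(3) C(1,3) q' \<kappa>_ge] by blast
  have "\<forall>i\<in>?I. \<exists>b. \<forall>n\<ge>1. real n * \<bar>\<integral>\<omega>. \<xi> i (X n 1 \<omega>) \<partial>M n\<bar> \<le> b"
  proof
    fix i assume "i \<in> ?I"
    then obtain b where
      "\<forall>y\<in>(\<lambda>n. real n * \<bar>\<integral>\<omega>. \<xi> i (X n 1 \<omega>) \<partial>M n\<bar>) ` {1..}. y \<le> b"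
      using B unfolding bdd_above_def by blast
    then show "\<exists>b. \<forall>n\<ge>1. real n * \<bar>\<integral>\<omega>. \<xi> i (X n 1 \<omega>) \<partial>M n\<bar> \<le> b"
      by (intro exI[of _ b]) auto
  qed
  then obtain b where b: "\<And>i n. i \<in> ?I \<Longrightarrow> n \<ge> 1 \<Longrightarrow> real n * \<bar>\<integral>\<omega>. \<xi> i (X n 1 \<omega>) \<partial>M n\<bar> \<le> b i"
    by metis
  obtain t where t: "\<And>n. n \<ge> 1 \<Longrightarrow> real n * (\<integral>\<omega>. \<theta> (X n 1 \<omega>) \<partial>M n) \<le> t"
    using C(2) unfolding scales_def bdd_above_def by auto
  have row: "iid_steps (M n) (X n) n" if n: "n \<ge> 1" for n
    using assms(4) n unfolding iid_array_def iid_steps_def iid_steps_axioms_def by blast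
  \<comment> \<open>Constant of the pointwise increment times the bounds from hypotheses
    \<open>B\<close> and \<open>C\<close>; the \<open>max 0\<close> makes \<open>K \<ge> 0\<close>
    immediate.\<close>
  define K where "K = c * ((\<Sum>i\<in>?I. max 0 (b i)) + max 0 t)"
  interpret W: homogeneous_array G Exp u d N M X K \<kappa>
  proof (intro homogeneous_array.intro homogeneous_array_axioms.intro)
    show "normed_homogeneous_group G Exp u d N" by (rule NH.normed_homogeneous_group_axioms)
    show "iid_steps (M n) (X n) n" if "n \<ge> 1" for n by (rule row[OF that])
    show "K \<ge> 0" using c by (auto simp: K_def intro!: mult_nonneg_nonneg add_nonneg_nonneg sum_nonneg)
    show "\<kappa> > 0" by (rule \<kappa>_pos)
    show "tight_family euclidean {1..} M (\<lambda>n \<omega>. random_walk G X n \<omega> h)" if "h \<in> {0..1}" for h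
      using A that by blast
    fix n :: nat and l :: real and x assume n: "1 \<le> n" and l: "1 \<le> l"
    interpret I: iid_steps "M n" "X n" n by (rule row[OF n])
    obtain \<beta> where \<beta>: "\<And>i. i \<in> ?I \<Longrightarrow> \<bar>\<beta> i\<bar> \<le> c * l powr \<kappa>"
      "\<And>y. H.dbump l (x \<otimes>\<^bsub>G\<^esub> y) - H.dbump l x \<le> (\<Sum>i\<in>?I. \<beta> i * \<xi> i y) + c * l powr \<kappa> * \<theta> y"
      using inc[OF l, of x] by blast
    show "(\<integral>\<omega>. H.dbump l (x \<otimes>\<^bsub>G\<^esub> X n 1 \<omega>) \<partial>M n) \<le> H.dbump l x + K * l powr \<kappa> / real n"
      unfolding K_def
    proof (rule H.dbump_drift[OF I.prob_space_axioms _ assms(3) C(1) _ _ l \<beta>])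
      show "X n 1 \<in> borel_measurable (M n)" using n by (intro I.X_measurable) simp
      show "real n * \<bar>\<integral>\<omega>. \<xi> i (X n 1 \<omega>) \<partial>M n\<bar> \<le> max 0 (b i)" if "i \<in> ?I" for i
        using b[OF that n] by simp
      show "real n * (\<integral>\<omega>. \<theta> (X n 1 \<omega>) \<partial>M n) \<le> max 0 t" using t[OF n] by simp
    qed (use c n in auto)
  qed
  have "p_variation G N p 0 1 (random_walk G X n \<omega>) < \<infinity>" if "p > \<kappa>" for p n \<omega>
    using that \<kappa>_pos unfolding NH.random_walk_path_of by (intro W.p_variation_walk_finite) simp
  then show ?thesis using W.walk_tight W.p_variation_tight by blast
qed

end
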